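(* Let $\mathfrak{s}$ be a Lie algebra. If $\mathfrak{n}$ is an almost minimal solvable Lie $\mathfrak{s}$-algebra, then it is isomorphic (as an $\mathfrak{s}$-algebra) to $\mathfrak{h}(\mathfrak{v})/Z$, for some full $\mathfrak{s}$-module $\mathfrak{v}$ and some linear subspace $Z$ of $\mathrm{Alt}_{\mathfrak{s}}(\mathfrak{v})^*$. It is minimal if and only if $\mathfrak{v}$ is irreducible. Moreover, for a full $\mathfrak{s}$-module $\mathfrak{v}$ and subspaces $Z,Z'$ of $\mathrm{Alt}_{\mathfrak{s}}(\mathfrak{v})^*$, the almost minimal $\mathfrak{s}$-algebras $\mathfrak{h}(\mathfrak{v})/Z$ and $\mathfrak{h}(\mathfrak{v})/Z'$ are isomorphic (as $\mathfrak{s}$-algebras) if and only if $Z$ and $Z'$ are in the same orbit for the natural action of $\mathrm{Aut}_{\mathfrak{s}}(\mathfrak{v})$ on the Grassmannian of $\mathrm{Alt}_{\mathfrak{s}}(\mathfrak{v})^*$.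
   Context: All Lie algebras are finite-dimensional over a fixed field $K$ of characteristic zero. $D\mathfrak{n}$ denotes the derived subalgebra of $\mathfrak{n}$. A Lie $\mathfrak{s}$-algebra is a Lie algebra $\mathfrak{n}$ endowed with a Lie algebra morphism $\mathfrak{s}\to\mathrm{Der}(\mathfrak{n})$ such that the resulting action of $\mathfrak{s}$ on $\mathfrak{n}$, written $(s,n)\mapsto[s,n]$, is completely reducible. $[\mathfrak{h}_1,\mathfrak{h}_2]$ denotes the Lie subalgebra (here of $\mathfrak{s}\ltimes\mathfrak{n}$) generated by the brackets $[h_1,h_2]$, $h_j\in\mathfrak{h}_j$. An $\mathfrak{s}$-subalgebra is a Lie subalgebra stable under $\mathfrak{s}$. A Lie $\mathfrak{s}$-algebra $\mathfrak{n}$ is minimal if $[\mathfrak{s},\mathfrak{n}]\neq 0$ and every $\mathfrak{s}$-subalgebra $\mathfrak{n}'$ satisfies $\mathfrak{n}'=\mathfrak{n}$ or $[\mathfrak{s},\mathfrak{n}']=0$. A solvable Lie $\mathfrak{s}$-algebra $\mathfrak{n}$ is almost minimal if 1) $[\mathfrak{n},D\mathfrak{n}]=0$, 2) $[\mathfrak{s},\mathfrak{n}]=\mathfrak{n}$, 3) $[\mathfrak{s},D\mathfrak{n}]=0$. An $\mathfrak{s}$-module is full if it is completely reducible and does not contain the trivial irreducible (one-dimensional) module. For a full $\mathfrak{s}$-module $\mathfrak{v}$, $\mathrm{Alt}_{\mathfrak{s}}(\mathfrak{v})$ is the space of alternating bilinear forms $\varphi$ on $\mathfrak{v}$ that are $\mathfrak{s}$-invariant: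 $\varphi([s,v],w)+\varphi(v,[s,w])=0$ for all $s\in\mathfrak{s}$, $v,w\in\mathfrak{v}$; $\mathrm{Alt}_{\mathfrak{s}}(\mathfrak{v})^*$ is its linear dual. The Lie $\mathfrak{s}$-algebra $\mathfrak{h}(\mathfrak{v})$ is the vector space $\mathfrak{v}\oplus\mathrm{Alt}_{\mathfrak{s}}(\mathfrak{v})^*$ with bracket $[(x,z),(x',z')]=(0,e_{x,x'})$, where $e_{x,x'}(\varphi)=\varphi(x,x')$, and $\mathfrak{s}$-action $[s,(x,z)]=([s,x],0)$. $\mathrm{Aut}_{\mathfrak{s}}(\mathfrak{v})$ is the group of $\mathfrak{s}$-module automorphisms of $\mathfrak{v}$. The Grassmannian of a vector space is the set of all its linear subspaces. *)

theory Defs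
  imports
    "HOL-Algebra.Group_Action"
    "HOL-Algebra.QuotRing"
    "Jordan_Normal_Form.Missing_VectorSpace"
begin

text \<open>
  As for \<^locale>\<open>algebra\<close> in HOL-Algebra, an algebra over the field \<open>K\<close> is a \<open>module\<close> record
  over \<open>K\<close> whose field \<open>mult\<close> carries the product, here the Lie bracket; the field \<open>one\<close> plays
  no role. For a mere module, \<open>mult\<close> plays no role either.
\<close>

definition char_zero :: "('k, 'm) ring_scheme \<Rightarrow> bool" where
  "char_zero K \<longleftrightarrow> (\<forall>n::nat. n > 0 \<longrightarrow> [n] \<cdot>\<^bsub>K\<^esub> \<one>\<^bsub>K\<^esub> \<noteq> \<zero>\<^bsub>K\<^esub>)"

locale lie_algebra = vectorspace K L for K and L (structure) +
  assumes finite_dimensional: "fin_dim"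
    and bracket_closed: "\<lbrakk>x \<in> carrier L; y \<in> carrier L\<rbrakk> \<Longrightarrow> x \<otimes> y \<in> carrier L"
    and bracket_add_left: "\<lbrakk>x \<in> carrier L; y \<in> carrier L; z \<in> carrier L\<rbrakk>
      \<Longrightarrow> (x \<oplus> y) \<otimes> z = (x \<otimes> z) \<oplus> (y \<otimes> z)"
    and bracket_add_right: "\<lbrakk>x \<in> carrier L; y \<in> carrier L; z \<in> carrier L\<rbrakk>
      \<Longrightarrow> x \<otimes> (y \<oplus> z) = (x \<otimes> y) \<oplus> (x \<otimes> z)"
    and bracket_smult_left: "\<lbrakk>c \<in> carrier K; x \<in> carrier L; y \<in> carrier L\<rbrakk>
      \<Longrightarrow> (c \<odot> x) \<otimes> y = c \<odot> (x \<otimes> y)"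
    and bracket_smult_right: "\<lbrakk>c \<in> carrier K; x \<in> carrier L; y \<in> carrier L\<rbrakk>
      \<Longrightarrow> x \<otimes> (c \<odot> y) = c \<odot> (x \<otimes> y)"
    and bracket_self: "x \<in> carrier L \<Longrightarrow> x \<otimes> x = \<zero>"
    and jacobi: "\<lbrakk>x \<in> carrier L; y \<in> carrier L; z \<in> carrier L\<rbrakk>
      \<Longrightarrow> (x \<otimes> (y \<otimes> z)) \<oplus> ((y \<otimes> (z \<otimes> x)) \<oplus> (z \<otimes> (x \<otimes> y))) = \<zero>"

definition lie_subalgebra ::
    "('k, 'm) ring_scheme \<Rightarrow> 'a set \<Rightarrow> ('k, 'a, 'n) module_scheme \<Rightarrow> bool" where
  "lie_subalgebra K H L \<longleftrightarrow> subspace K H L \<and> (\<forall>x\<in>H. \<forall>y\<in>H. x \<otimes>\<^bsub>L\<^esub> y \<in> H)"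

definition lie_generated ::
    "('k, 'm) ring_scheme \<Rightarrow> ('k, 'a, 'n) module_scheme \<Rightarrow> 'a set \<Rightarrow> 'a set" where
  "lie_generated K L X = \<Inter>{H. lie_subalgebra K H L \<and> X \<subseteq> H}"

definition bracket_sub ::
    "('k, 'm) ring_scheme \<Rightarrow> ('k, 'a, 'n) module_scheme \<Rightarrow> 'a set \<Rightarrow> 'a set \<Rightarrow> 'a set" where
  "bracket_sub K L A B = lie_generated K L {x \<otimes>\<^bsub>L\<^esub> y | x y. x \<in> A \<and> y \<in> B}"

definition derived_sub ::
    "('k, 'm) ring_scheme \<Rightarrow> ('k, 'a, 'n) module_scheme \<Rightarrow> 'a set \<Rightarrow> 'a set" where
  "derived_sub K L A = bracket_sub K L A A"

definition lie_solvable :: "('k, 'm) ring_scheme \<Rightarrow> ('k, 'a, 'n) module_scheme \<Rightarrow> bool" where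
  "lie_solvable K L \<longleftrightarrow> (\<exists>n. (derived_sub K L ^^ n) (carrier L) = {\<zero>\<^bsub>L\<^esub>})"


subsection \<open>Modules and algebras with an action of a Lie algebra\<close>

record ('k, 's, 'a) smodule = "('k, 'a) module" +
  act :: "'s \<Rightarrow> 'a \<Rightarrow> 'a"

text \<open>Modules are finite-dimensional like all Lie algebras under consideration.\<close>

locale s_module = S: lie_algebra K S + vectorspace K V
  for K :: "('k, 'm) ring_scheme" and S :: "('k, 's, 'n) module_scheme"
    and V :: "('k, 's, 'a, 'l) smodule_scheme" (structure) +
  assumes finite_dimensional: "fin_dim"
    and act_closed: "\<lbrakk>s \<in> carrier S; x \<in> carrier V\<rbrakk> \<Longrightarrow> act V s x \<in> carrier V"
    and act_add_right: "\<lbrakk>s \<in> carrier S; x \<in> carrier V; y \<in> carrier V\<rbrakk>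
      \<Longrightarrow> act V s (x \<oplus> y) = act V s x \<oplus> act V s y"
    and act_smult_right: "\<lbrakk>s \<in> carrier S; c \<in> carrier K; x \<in> carrier V\<rbrakk>
      \<Longrightarrow> act V s (c \<odot> x) = c \<odot> act V s x"
    and act_add_left: "\<lbrakk>s \<in> carrier S; t \<in> carrier S; x \<in> carrier V\<rbrakk>
      \<Longrightarrow> act V (s \<oplus>\<^bsub>S\<^esub> t) x = act V s x \<oplus> act V t x"
    and act_smult_left: "\<lbrakk>s \<in> carrier S; c \<in> carrier K; x \<in> carrier V\<rbrakk>
      \<Longrightarrow> act V (c \<odot>\<^bsub>S\<^esub> s) x = c \<odot> act V s x"
    and act_bracket: "\<lbrakk>s \<in> carrier S; t \<in> carrier S; x \<in> carrier V\<rbrakk>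
      \<Longrightarrow> act V (s \<otimes>\<^bsub>S\<^esub> t) x = act V s (act V t x) \<ominus> act V t (act V s x)"

definition s_submodule :: "('k, 'm) ring_scheme \<Rightarrow> ('k, 's, 'n) module_scheme
    \<Rightarrow> 'a set \<Rightarrow> ('k, 's, 'a, 'l) smodule_scheme \<Rightarrow> bool" where
  "s_submodule K S W V \<longleftrightarrow> subspace K W V \<and> (\<forall>s\<in>carrier S. \<forall>w\<in>W. act V s w \<in> W)"

definition completely_reducible :: "('k, 'm) ring_scheme \<Rightarrow> ('k, 's, 'n) module_scheme
    \<Rightarrow> ('k, 's, 'a, 'l) smodule_scheme \<Rightarrow> bool" where
  "completely_reducible K S V \<longleftrightarrow> (\<forall>W. s_submodule K S W V \<longrightarrow>
     (\<exists>W'. s_submodule K S W' V \<and> W \<inter> W' = {\<zero>\<^bsub>V\<^esub>} \<and> W <+>\<^bsub>V\<^esub> W' = carrier V))"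

definition irreducible_module :: "('k, 'm) ring_scheme \<Rightarrow> ('k, 's, 'n) module_scheme
    \<Rightarrow> ('k, 's, 'a, 'l) smodule_scheme \<Rightarrow> bool" where
  "irreducible_module K S V \<longleftrightarrow> s_module K S V \<and> carrier V \<noteq> {\<zero>\<^bsub>V\<^esub>} \<and>
     (\<forall>W. s_submodule K S W V \<longrightarrow> W = {\<zero>\<^bsub>V\<^esub>} \<or> W = carrier V)"

definition full_module :: "('k, 'm) ring_scheme \<Rightarrow> ('k, 's, 'n) module_scheme
    \<Rightarrow> ('k, 's, 'a, 'l) smodule_scheme \<Rightarrow> bool" where
  "full_module K S V \<longleftrightarrow> s_module K S V \<and> completely_reducible K S V \<and>
     \<not> (\<exists>W. s_submodule K S W V \<and> vectorspace.dim K (V\<lparr>carrier := W\<rparr>) = 1 \<and>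
            (\<forall>s\<in>carrier S. \<forall>w\<in>W. act V s w = \<zero>\<^bsub>V\<^esub>))"

text \<open>
  A Lie algebra morphism \<open>S \<rightarrow> Der(N)\<close> is the same thing as a module structure
  for which every element of \<open>S\<close> satisfies the Leibniz rule.
\<close>

locale lie_s_algebra = s_module K S N + lie_algebra K N
  for K :: "('k, 'm) ring_scheme" and S :: "('k, 's, 'n) module_scheme"
    and N :: "('k, 's, 'a, 'l) smodule_scheme" (structure) +
  assumes act_derivation: "\<lbrakk>s \<in> carrier S; x \<in> carrier N; y \<in> carrier N\<rbrakk>
      \<Longrightarrow> act N s (x \<otimes> y) = (act N s x \<otimes> y) \<oplus> (x \<otimes> act N s y)"
    and completely_reducible: "completely_reducible K S N"

text \<open>
  \<open>act_sub K S N B\<close> is \<open>[S, B]\<close> for \<open>B \<subseteq> N\<close>. It is generated by elements of \<open>N\<close>, and \<open>N\<close>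
  is a subalgebra of the semidirect product of \<open>S\<close> and \<open>N\<close>, so that generating
  inside \<open>N\<close> or inside the semidirect product yields the same subalgebra.
\<close>

definition act_sub :: "('k, 'm) ring_scheme \<Rightarrow> ('k, 's, 'n) module_scheme
    \<Rightarrow> ('k, 's, 'a, 'l) smodule_scheme \<Rightarrow> 'a set \<Rightarrow> 'a set" where
  "act_sub K S N B = lie_generated K N {act N s x | s x. s \<in> carrier S \<and> x \<in> B}"

definition s_subalgebra :: "('k, 'm) ring_scheme \<Rightarrow> ('k, 's, 'n) module_scheme
    \<Rightarrow> 'a set \<Rightarrow> ('k, 's, 'a, 'l) smodule_scheme \<Rightarrow> bool" where
  "s_subalgebra K S H N \<longleftrightarrow> lie_subalgebra K H N \<and> (\<forall>s\<in>carrier S. \<forall>x\<in>H. act N s x \<in> H)"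

definition minimal_s_algebra :: "('k, 'm) ring_scheme \<Rightarrow> ('k, 's, 'n) module_scheme
    \<Rightarrow> ('k, 's, 'a, 'l) smodule_scheme \<Rightarrow> bool" where
  "minimal_s_algebra K S N \<longleftrightarrow> lie_s_algebra K S N \<and>
     act_sub K S N (carrier N) \<noteq> {\<zero>\<^bsub>N\<^esub>} \<and>
     (\<forall>H. s_subalgebra K S H N \<longrightarrow> H = carrier N \<or> act_sub K S N H = {\<zero>\<^bsub>N\<^esub>})"

definition almost_minimal_s_algebra :: "('k, 'm) ring_scheme \<Rightarrow> ('k, 's, 'n) module_scheme
    \<Rightarrow> ('k, 's, 'a, 'l) smodule_scheme \<Rightarrow> bool" where
  "almost_minimal_s_algebra K S N \<longleftrightarrow> lie_s_algebra K S N \<and> lie_solvable K N \<and>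
     bracket_sub K N (carrier N) (derived_sub K N (carrier N)) = {\<zero>\<^bsub>N\<^esub>} \<and>
     act_sub K S N (carrier N) = carrier N \<and>
     act_sub K S N (derived_sub K N (carrier N)) = {\<zero>\<^bsub>N\<^esub>}"

definition s_algebra_iso :: "('k, 'm) ring_scheme \<Rightarrow> ('k, 's, 'n) module_scheme
    \<Rightarrow> ('k, 's, 'a, 'l1) smodule_scheme \<Rightarrow> ('k, 's, 'b, 'l2) smodule_scheme \<Rightarrow> ('a \<Rightarrow> 'b) set" where
  "s_algebra_iso K S M N = {f \<in> module_hom K M N. bij_betw f (carrier M) (carrier N) \<and>
     (\<forall>x\<in>carrier M. \<forall>y\<in>carrier M. f (x \<otimes>\<^bsub>M\<^esub> y) = f x \<otimes>\<^bsub>N\<^esub> f y) \<and>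
     (\<forall>s\<in>carrier S. \<forall>x\<in>carrier M. f (act M s x) = act N s (f x))}"

definition s_algebra_isomorphic :: "('k, 'm) ring_scheme \<Rightarrow> ('k, 's, 'n) module_scheme
    \<Rightarrow> ('k, 's, 'a, 'l1) smodule_scheme \<Rightarrow> ('k, 's, 'b, 'l2) smodule_scheme \<Rightarrow> bool" where
  "s_algebra_isomorphic K S M N \<longleftrightarrow> s_algebra_iso K S M N \<noteq> {}"

text \<open>
  Extends \<^const>\<open>FactRing\<close>; as there, an operation on cosets is the union of the cosets of
  the results on representatives, and it is meaningful when \<open>I\<close> is an ideal stable under the action.
\<close>

definition s_quotient :: "('k, 's, 'a, 'l) smodule_scheme \<Rightarrow> 'a set \<Rightarrow> ('k, 's, 'a set) smodule" where
  "s_quotient N I =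
    \<lparr>carrier = a_rcosets\<^bsub>N\<^esub> I,
     mult = rcoset_mult N I,
     one = I +>\<^bsub>N\<^esub> \<one>\<^bsub>N\<^esub>,
     zero = I,
     add = set_add N,
     smult = (\<lambda>c A. \<Union>x\<in>A. I +>\<^bsub>N\<^esub> (c \<odot>\<^bsub>N\<^esub> x)),
     act = (\<lambda>s A. \<Union>x\<in>A. I +>\<^bsub>N\<^esub> act N s x)\<rparr>"


subsection \<open>The algebras \<open>h(V)\<close>\<close>

text \<open>
  Forms and functionals are extensional functions (on \<open>carrier V \<times> carrier V\<close> and
  on the carrier of the dualized space, respectively).
\<close>

definition alt_space :: "('k, 'm) ring_scheme \<Rightarrow> ('k, 's, 'n) module_scheme
    \<Rightarrow> ('k, 's, 'v, 'l) smodule_scheme \<Rightarrow> ('k, 'v \<times> 'v \<Rightarrow> 'k) module" where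
  "alt_space K S V = (ring.func_space K (carrier V \<times> carrier V))
    \<lparr>carrier := {\<phi> \<in> carrier V \<times> carrier V \<rightarrow>\<^sub>E carrier K.
       (\<forall>x\<in>carrier V. \<forall>y\<in>carrier V. \<forall>z\<in>carrier V.
          \<phi> (x \<oplus>\<^bsub>V\<^esub> y, z) = \<phi> (x, z) \<oplus>\<^bsub>K\<^esub> \<phi> (y, z) \<and>
          \<phi> (x, y \<oplus>\<^bsub>V\<^esub> z) = \<phi> (x, y) \<oplus>\<^bsub>K\<^esub> \<phi> (x, z)) \<and>
       (\<forall>c\<in>carrier K. \<forall>x\<in>carrier V. \<forall>y\<in>carrier V.
          \<phi> (c \<odot>\<^bsub>V\<^esub> x, y) = c \<otimes>\<^bsub>K\<^esub> \<phi> (x, y) \<and>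
          \<phi> (x, c \<odot>\<^bsub>V\<^esub> y) = c \<otimes>\<^bsub>K\<^esub> \<phi> (x, y)) \<and>
       (\<forall>x\<in>carrier V. \<phi> (x, x) = \<zero>\<^bsub>K\<^esub>) \<and>
       (\<forall>s\<in>carrier S. \<forall>x\<in>carrier V. \<forall>y\<in>carrier V.
          \<phi> (act V s x, y) \<oplus>\<^bsub>K\<^esub> \<phi> (x, act V s y) = \<zero>\<^bsub>K\<^esub>)}\<rparr>"

definition dual_space ::
    "('k, 'm) ring_scheme \<Rightarrow> ('k, 'a, 'n) module_scheme \<Rightarrow> ('k, 'a \<Rightarrow> 'k) module" where
  "dual_space K A = (ring.func_space K (carrier A))
    \<lparr>carrier := {f \<in> carrier A \<rightarrow>\<^sub>E carrier K.
       (\<forall>x\<in>carrier A. \<forall>y\<in>carrier A. f (x \<oplus>\<^bsub>A\<^esub> y) = f x \<oplus>\<^bsub>K\<^esub> f y) \<and>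
       (\<forall>c\<in>carrier K. \<forall>x\<in>carrier A. f (c \<odot>\<^bsub>A\<^esub> x) = c \<otimes>\<^bsub>K\<^esub> f x)}\<rparr>"

definition alt_dual :: "('k, 'm) ring_scheme \<Rightarrow> ('k, 's, 'n) module_scheme
    \<Rightarrow> ('k, 's, 'v, 'l) smodule_scheme \<Rightarrow> ('k, ('v \<times> 'v \<Rightarrow> 'k) \<Rightarrow> 'k) module" where
  "alt_dual K S V = dual_space K (alt_space K S V)"

definition h_algebra :: "('k, 'm) ring_scheme \<Rightarrow> ('k, 's, 'n) module_scheme
    \<Rightarrow> ('k, 's, 'v, 'l) smodule_scheme
    \<Rightarrow> ('k, 's, 'v \<times> (('v \<times> 'v \<Rightarrow> 'k) \<Rightarrow> 'k)) smodule" where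
  "h_algebra K S V =
    \<lparr>carrier = carrier V \<times> carrier (alt_dual K S V),
     mult = (\<lambda>p q. (\<zero>\<^bsub>V\<^esub>, \<lambda>\<phi>\<in>carrier (alt_space K S V). \<phi> (fst p, fst q))),
     one = (\<zero>\<^bsub>V\<^esub>, \<zero>\<^bsub>alt_dual K S V\<^esub>),
     zero = (\<zero>\<^bsub>V\<^esub>, \<zero>\<^bsub>alt_dual K S V\<^esub>),
     add = (\<lambda>p q. (fst p \<oplus>\<^bsub>V\<^esub> fst q, snd p \<oplus>\<^bsub>alt_dual K S V\<^esub> snd q)),
     smult = (\<lambda>c p. (c \<odot>\<^bsub>V\<^esub> fst p, c \<odot>\<^bsub>alt_dual K S V\<^esub> snd p)),
     act = (\<lambda>s p. (act V s (fst p), \<zero>\<^bsub>alt_dual K S V\<^esub>))\<rparr>"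

text \<open>\<open>h(V)/Z\<close>, where the subspace \<open>Z\<close> of the second summand is viewed inside \<open>h(V)\<close>\<close>

definition h_quotient :: "('k, 'm) ring_scheme \<Rightarrow> ('k, 's, 'n) module_scheme
    \<Rightarrow> ('k, 's, 'v, 'l) smodule_scheme \<Rightarrow> (('v \<times> 'v \<Rightarrow> 'k) \<Rightarrow> 'k) set
    \<Rightarrow> ('k, 's, ('v \<times> (('v \<times> 'v \<Rightarrow> 'k) \<Rightarrow> 'k)) set) smodule" where
  "h_quotient K S V Z = s_quotient (h_algebra K S V) ({\<zero>\<^bsub>V\<^esub>} \<times> Z)"

definition module_aut_group :: "('k, 'm) ring_scheme \<Rightarrow> ('k, 's, 'n) module_scheme
    \<Rightarrow> ('k, 's, 'v, 'l) smodule_scheme \<Rightarrow> ('v \<Rightarrow> 'v) monoid" where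
  "module_aut_group K S V = (BijGroup (carrier V))
    \<lparr>carrier := {g \<in> module_hom K V V \<inter> Bij (carrier V).
       \<forall>s\<in>carrier S. \<forall>x\<in>carrier V. g (act V s x) = act V s (g x)}\<rparr>"

definition grassmannian ::
    "('k, 'm) ring_scheme \<Rightarrow> ('k, 'a, 'n) module_scheme \<Rightarrow> 'a set set" where
  "grassmannian K A = {Z. subspace K Z A}"

text \<open>
  An automorphism \<open>g\<close> acts on forms by \<open>(g\<cdot>\<phi>)(x, y) = \<phi>(g\<inverse> x, g\<inverse> y)\<close>, hence on
  functionals by \<open>(g\<cdot>z)(\<phi>) = z(g\<inverse>\<cdot>\<phi>)\<close>, that is, \<open>(g\<cdot>z)(\<phi>) = z((x, y) \<mapsto> \<phi>(g x, g y))\<close>.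
\<close>

definition alt_dual_action :: "('k, 'm) ring_scheme \<Rightarrow> ('k, 's, 'n) module_scheme
    \<Rightarrow> ('k, 's, 'v, 'l) smodule_scheme
    \<Rightarrow> ('v \<Rightarrow> 'v) \<Rightarrow> (('v \<times> 'v \<Rightarrow> 'k) \<Rightarrow> 'k) \<Rightarrow> (('v \<times> 'v \<Rightarrow> 'k) \<Rightarrow> 'k)" where
  "alt_dual_action K S V g z =
     (\<lambda>\<phi>\<in>carrier (alt_space K S V). z (\<lambda>(x, y)\<in>carrier V \<times> carrier V. \<phi> (g x, g y)))"

definition grassmannian_action :: "('k, 'm) ring_scheme \<Rightarrow> ('k, 's, 'n) module_scheme
    \<Rightarrow> ('k, 's, 'v, 'l) smodule_scheme
    \<Rightarrow> ('v \<Rightarrow> 'v) \<Rightarrow> (('v \<times> 'v \<Rightarrow> 'k) \<Rightarrow> 'k) set \<Rightarrow> (('v \<times> 'v \<Rightarrow> 'k) \<Rightarrow> 'k) set" where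
  "grassmannian_action K S V g Z = alt_dual_action K S V g ` Z"

end

theory Submission
  imports Defs
begin

text \<open>
  Write \<open>N\<close> for an almost minimal solvable Lie \<open>S\<close>-algebra and let \<open>I\<close> be its submodule of
  \<open>S\<close>-invariant elements. Complete reducibility gives \<open>N = V \<oplus> I\<close> for a submodule \<open>V\<close>, and
  \<open>V\<close> is full because it meets \<open>I\<close> trivially (\<open>complement_of_invariants\<close>). The bracket
  restricted to \<open>V \<times> V\<close> is alternating, and it is \<open>S\<close>-invariant because \<open>S\<close> kills all brackets.
  Hence each of its coordinates is an element of \<open>Alt(V)\<close>, the space of invariant alternating
  forms, and evaluating functionals on these coordinates produces a linear map
  \<open>\<psi> : Alt(V)\<^sup>* \<rightarrow> N\<close> that sends the evaluation functional \<open>e x y\<close> to \<open>[x, y]\<close>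
  (\<open>bracket_factorization\<close>). The map \<open>(x, z) \<mapsto> x + \<psi> z\<close> is then a homomorphism
  \<open>h(V) \<rightarrow> N\<close>; its image is a subalgebra containing \<open>[S, N]\<close>, so it is everything, and its kernel is
  \<open>0 \<times> ker \<psi>\<close>. This is \<open>almost_minimal_is_h_quotient\<close>.
  
  Everything rests on one fact about \<open>h(V)\<close>: the evaluations \<open>e x y\<close> span \<open>Alt(V)\<^sup>*\<close>. They have
  no common zero, and already finitely many of them, for \<open>x\<close> and \<open>y\<close> in a finite generating
  set of \<open>V\<close>, have none; finitely many functionals without a common zero span the dual
  (\<open>dual_subspace_contains\<close>). So a linear identity on \<open>Alt(V)\<^sup>*\<close> need only be checked on
  evaluations (\<open>alt_dual_generated\<close>), and there it is a statement about brackets.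
  
  Quotients are handled through surjective homomorphisms. Being an almost minimal Lie
  \<open>S\<close>-algebra descends along a surjection (\<open>lie_s_algebra_epi_image\<close>, \<open>almost_minimal_epi_image\<close>),
  and two surjections from the same algebra with the same kernel have isomorphic targets
  (\<open>isomorphic_if_same_kernel\<close>). Therefore it is enough to study \<open>h(V)\<close> itself together with the
  projections \<open>h(V) \<rightarrow> h(V)/Z\<close>.
  
  A quotient \<open>h(V)/Z\<close> still projects onto \<open>V\<close>. The \<open>S\<close>-subalgebras of the quotient whose image
  in \<open>V\<close> vanishes are killed by \<open>S\<close>, and those that map onto \<open>V\<close> contain \<open>[S, N]\<close>, hence are
  everything; conversely each submodule of \<open>V\<close> is the image of an \<open>S\<close>-subalgebra. This gives
  the criterion for minimality (\<open>minimal_iff_irreducible\<close>).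
  
  Finally, let \<open>f : h(V)/Z \<rightarrow> h(V)/Z'\<close> be an isomorphism. It preserves invariants, which are the
  classes of \<open>0 \<times> Alt(V)\<^sup>*\<close>, so it induces an automorphism \<open>g\<close> of the module \<open>V\<close>. As \<open>f\<close> preserves
  brackets, it sends the class of \<open>e x y\<close> to that of \<open>e (g x) (g y) = g \<cdot> e x y\<close>, so it acts on the
  classes of all of \<open>Alt(V)\<^sup>*\<close> as \<open>g\<close>, and \<open>Z' = g \<cdot> Z\<close> (\<open>common_quotient_module_aut\<close>). In the other
  direction an automorphism \<open>g\<close> of \<open>V\<close> extends to \<open>h(V)\<close> and carries \<open>Z\<close> to \<open>g \<cdot> Z\<close>
  (\<open>module_aut_quotient_epi\<close>).
\<close>

section \<open>Subspaces, complements and functionals\<close>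

lemma subspaceI:
  assumes "vectorspace K V" "W \<subseteq> carrier V" "\<zero>\<^bsub>V\<^esub> \<in> W"
    "\<And>x y. x \<in> W \<Longrightarrow> y \<in> W \<Longrightarrow> x \<oplus>\<^bsub>V\<^esub> y \<in> W"
    "\<And>c x. c \<in> carrier K \<Longrightarrow> x \<in> W \<Longrightarrow> c \<odot>\<^bsub>V\<^esub> x \<in> W"
  shows "subspace K W V"
proof -
  interpret vectorspace K V by fact
  show ?thesis
    using assms by (simp add: subspace_def submodule_def module_axioms)
qed

lemma subspaceD:
  assumes "subspace K W V"
  shows "W \<subseteq> carrier V" "\<zero>\<^bsub>V\<^esub> \<in> W"
    "\<And>x y. x \<in> W \<Longrightarrow> y \<in> W \<Longrightarrow> x \<oplus>\<^bsub>V\<^esub> y \<in> W"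
    "\<And>c x. c \<in> carrier K \<Longrightarrow> x \<in> W \<Longrightarrow> c \<odot>\<^bsub>V\<^esub> x \<in> W"
  using assms by (auto simp: subspace_def submodule_def)

lemma subspace_uminus:
  assumes "subspace K W V" "x \<in> W"
  shows "\<ominus>\<^bsub>V\<^esub> x \<in> W"
proof -
  interpret vectorspace K V using assms(1) by (simp add: subspace_def)
  have "x \<in> carrier V" using assms subspaceD(1) by blast
  then have "\<ominus>\<^bsub>V\<^esub> x = (\<ominus>\<^bsub>K\<^esub> \<one>\<^bsub>K\<^esub>) \<odot>\<^bsub>V\<^esub> x" by (simp add: smult_minus_1)
  then show ?thesis using subspaceD(4)[OF assms(1) _ assms(2)] by simp
qed

lemma subspace_minus:
  assumes "subspace K W V" "x \<in> W" "y \<in> W"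
  shows "x \<ominus>\<^bsub>V\<^esub> y \<in> W"
  using assms subspace_uminus subspaceD(3) by (metis a_minus_def)

lemma set_addI: "h \<in> H \<Longrightarrow> k \<in> L \<Longrightarrow> h \<oplus>\<^bsub>V\<^esub> k \<in> H <+>\<^bsub>V\<^esub> L"
  by (auto simp: set_add_def')

lemma set_addE:
  assumes "x \<in> H <+>\<^bsub>V\<^esub> L"
  obtains h k where "h \<in> H" "k \<in> L" "x = h \<oplus>\<^bsub>V\<^esub> k"
  using assms by (auto simp: set_add_def')

lemma set_add_mono: "L \<subseteq> L' \<Longrightarrow> H <+>\<^bsub>V\<^esub> L \<subseteq> H <+>\<^bsub>V\<^esub> L'"
  unfolding set_add_def set_mult_def by fast

context vectorspace
begin

lemma minus_add_cancel: "x \<in> carrier V \<Longrightarrow> y \<in> carrier V \<Longrightarrow> (x \<ominus>\<^bsub>V\<^esub> y) \<oplus>\<^bsub>V\<^esub> y = x"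
  by (simp add: a_minus_def M.a_assoc M.l_neg)

lemma add_minus_cancel: "x \<in> carrier V \<Longrightarrow> y \<in> carrier V \<Longrightarrow> (x \<oplus>\<^bsub>V\<^esub> y) \<ominus>\<^bsub>V\<^esub> y = x"
  by (simp add: a_minus_def M.a_assoc M.r_neg)

lemma minus_eq_zero_iff: "x \<in> carrier V \<Longrightarrow> y \<in> carrier V \<Longrightarrow> x \<ominus>\<^bsub>V\<^esub> y = \<zero>\<^bsub>V\<^esub> \<longleftrightarrow> x = y"
  by (metis M.l_zero M.minus_eq M.r_neg minus_add_cancel)

text \<open>
  Finite dimension without linear combinations: to show that a property holds on a whole
  finite-dimensional space, it is enough that the vectors with the property form a subspace
  which contains a suitable finite set.
\<close>

lemma fin_dim_iff_subspaces:
  "fin_dim \<longleftrightarrow> (\<exists>A. finite A \<and> A \<subseteq> carrier V \<and> (\<forall>W. subspace K W V \<and> A \<subseteq> W \<longrightarrow> carrier V \<subseteq> W))"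
  unfolding fin_dim_def
proof (intro ex_cong1 conj_cong refl)
  fix A assume A: "A \<subseteq> carrier V"
  show "gen_set A \<longleftrightarrow> (\<forall>W. subspace K W V \<and> A \<subseteq> W \<longrightarrow> carrier V \<subseteq> W)"
  proof (intro iffI allI impI, elim conjE)
    fix W assume "gen_set A" "subspace K W V" "A \<subseteq> W"
    moreover from this have "span A \<subseteq> W" by (intro span_is_subset) (auto simp: subspace_def)
    ultimately show "carrier V \<subseteq> W" by (simp only:)
  next
    assume "\<forall>W. subspace K W V \<and> A \<subseteq> W \<longrightarrow> carrier V \<subseteq> W"
    then have "carrier V \<subseteq> span A" using span_is_subspace[OF A] in_own_span[OF A] by (simp only:)
    then show "gen_set A" using span_is_subspace[OF A] subspaceD(1) by blast
  qed
qed

lemma subspace_set_add: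
  assumes "subspace K U V" "subspace K W V"
  shows "subspace K (U <+>\<^bsub>V\<^esub> W) V"
proof (rule subspaceI[OF vectorspace_axioms])
  note U = subspaceD[OF assms(1)] and W = subspaceD[OF assms(2)]
  show "U <+>\<^bsub>V\<^esub> W \<subseteq> carrier V" using U(1) W(1) by (auto simp: set_add_def')
  show "\<zero>\<^bsub>V\<^esub> \<in> U <+>\<^bsub>V\<^esub> W" using U(2) W(2) by (force simp: set_add_def')
  fix x y assume "x \<in> U <+>\<^bsub>V\<^esub> W" "y \<in> U <+>\<^bsub>V\<^esub> W"
  then obtain a b c d where *: "a \<in> U" "b \<in> W" "c \<in> U" "d \<in> W" "x = a \<oplus>\<^bsub>V\<^esub> b" "y = c \<oplus>\<^bsub>V\<^esub> d"
    by (auto simp: set_add_def')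
  then have "x \<oplus>\<^bsub>V\<^esub> y = (a \<oplus>\<^bsub>V\<^esub> c) \<oplus>\<^bsub>V\<^esub> (b \<oplus>\<^bsub>V\<^esub> d)"
    using U(1) W(1) by (simp add: M.a_ac subset_iff)
  then show "x \<oplus>\<^bsub>V\<^esub> y \<in> U <+>\<^bsub>V\<^esub> W" using * U(3) W(3) by (metis set_addI)
next
  note U = subspaceD[OF assms(1)] and W = subspaceD[OF assms(2)]
  fix k x assume k: "k \<in> carrier K" and "x \<in> U <+>\<^bsub>V\<^esub> W"
  then obtain a b where *: "a \<in> U" "b \<in> W" "x = a \<oplus>\<^bsub>V\<^esub> b" by (auto simp: set_add_def')
  then have "k \<odot>\<^bsub>V\<^esub> x = k \<odot>\<^bsub>V\<^esub> a \<oplus>\<^bsub>V\<^esub> k \<odot>\<^bsub>V\<^esub> b"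
    using U(1) W(1) k by (simp add: smult_r_distr subset_iff)
  then show "k \<odot>\<^bsub>V\<^esub> x \<in> U <+>\<^bsub>V\<^esub> W" using * U(4) W(4) k by (metis set_addI)
qed

lemma set_add_left: "subspace K U V \<Longrightarrow> subspace K W V \<Longrightarrow> x \<in> U \<Longrightarrow> x \<in> U <+>\<^bsub>V\<^esub> W"
  using subspaceD(1,2)[of K U V] subspaceD(1,2)[of K W V] by (force simp: set_add_def')

lemma set_add_right: "subspace K U V \<Longrightarrow> subspace K W V \<Longrightarrow> x \<in> W \<Longrightarrow> x \<in> U <+>\<^bsub>V\<^esub> W"
  using subspaceD(1,2)[of K U V] subspaceD(1,2)[of K W V] by (force simp: set_add_def')

lemma subspace_line:
  assumes "b \<in> carrier V"
  shows "subspace K {c \<odot>\<^bsub>V\<^esub> b | c. c \<in> carrier K} V"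
proof (rule subspaceI[OF vectorspace_axioms])
  show "\<zero>\<^bsub>V\<^esub> \<in> {c \<odot>\<^bsub>V\<^esub> b | c. c \<in> carrier K}" using assms by (force intro!: exI[of _ "\<zero>\<^bsub>K\<^esub>"])
  fix x y assume "x \<in> {c \<odot>\<^bsub>V\<^esub> b | c. c \<in> carrier K}" "y \<in> {c \<odot>\<^bsub>V\<^esub> b | c. c \<in> carrier K}"
  then obtain c d where "c \<in> carrier K" "d \<in> carrier K" "x = c \<odot>\<^bsub>V\<^esub> b" "y = d \<odot>\<^bsub>V\<^esub> b" by blast
  then show "x \<oplus>\<^bsub>V\<^esub> y \<in> {c \<odot>\<^bsub>V\<^esub> b | c. c \<in> carrier K}"
    using assms by (auto intro!: exI[of _ "c \<oplus>\<^bsub>K\<^esub> d"] simp: smult_l_distr)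
next
  fix k x assume "k \<in> carrier K" "x \<in> {c \<odot>\<^bsub>V\<^esub> b | c. c \<in> carrier K}"
  then show "k \<odot>\<^bsub>V\<^esub> x \<in> {c \<odot>\<^bsub>V\<^esub> b | c. c \<in> carrier K}"
    using assms by (auto simp: smult_assoc1[symmetric])
qed (use assms in auto)

lemma mem_line: "b \<in> carrier V \<Longrightarrow> b \<in> {c \<odot>\<^bsub>V\<^esub> b | c. c \<in> carrier K}"
  by (auto intro!: exI[of _ "\<one>\<^bsub>K\<^esub>"])

text \<open>
  A finite generating set is absorbed one vector \<open>b\<close> at a time: if \<open>b\<close> is not yet in \<open>U + W\<close>, then
  enlarging \<open>W\<close> by the line through \<open>b\<close> keeps it disjoint from \<open>U\<close>, since a vector of \<open>U\<close> that
  involves \<open>b\<close> with a nonzero coefficient would put \<open>b\<close> into \<open>U + W\<close>.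
\<close>

lemma complement_exists:
  assumes fin_dim and U: "subspace K U V"
  shows "\<exists>W. subspace K W V \<and> U \<inter> W = {\<zero>\<^bsub>V\<^esub>} \<and> U <+>\<^bsub>V\<^esub> W = carrier V"
proof -
  obtain A where A: "finite A" "A \<subseteq> carrier V"
    "\<And>W. subspace K W V \<Longrightarrow> A \<subseteq> W \<Longrightarrow> carrier V \<subseteq> W"
    using assms(1) unfolding fin_dim_iff_subspaces by metis
  have "\<exists>W. subspace K W V \<and> U \<inter> W = {\<zero>\<^bsub>V\<^esub>} \<and> B \<subseteq> U <+>\<^bsub>V\<^esub> W" if "B \<subseteq> A" for B
    using finite_subset[OF that A(1)] that
  proof (induction B rule: finite_induct)
    case empty
    have "subspace K {\<zero>\<^bsub>V\<^esub>} V" by (rule subspaceI[OF vectorspace_axioms]) auto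
    then show ?case using subspaceD(2)[OF U] by auto
  next
    case (insert b B)
    then obtain W where W: "subspace K W V" "U \<inter> W = {\<zero>\<^bsub>V\<^esub>}" "B \<subseteq> U <+>\<^bsub>V\<^esub> W" by auto
    note UW = subspace_set_add[OF U W(1)]
    have b: "b \<in> carrier V" using insert.prems A(2) by auto
    show ?case
    proof (cases "b \<in> U <+>\<^bsub>V\<^esub> W")
      case True
      then show ?thesis using W by blast
    next
      case False
      let ?L = "{c \<odot>\<^bsub>V\<^esub> b | c. c \<in> carrier K}"
      have L: "subspace K ?L V" by (rule subspace_line[OF b])
      let ?W = "W <+>\<^bsub>V\<^esub> ?L"
      have W': "subspace K ?W V" by (rule subspace_set_add[OF W(1) L])
      have "x = \<zero>\<^bsub>V\<^esub>" if x: "x \<in> U" "x \<in> ?W" for x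
      proof -
        obtain w c where w: "w \<in> W" "c \<in> carrier K" "x = w \<oplus>\<^bsub>V\<^esub> c \<odot>\<^bsub>V\<^esub> b"
          using x(2) by (auto simp: set_add_def')
        have carr: "x \<in> carrier V" "w \<in> carrier V"
          using x w subspaceD(1)[OF U] subspaceD(1)[OF W(1)] by auto
        have "c = \<zero>\<^bsub>K\<^esub>"
        proof (rule ccontr)
          assume c: "c \<noteq> \<zero>\<^bsub>K\<^esub>"
          have "c \<odot>\<^bsub>V\<^esub> b = x \<ominus>\<^bsub>V\<^esub> w"
            using w carr b by (metis M.a_comm add_minus_cancel smult_closed)
          then have "c \<odot>\<^bsub>V\<^esub> b \<in> U <+>\<^bsub>V\<^esub> W"
            using subspace_minus[OF UW set_add_left[OF U W(1) x(1)] set_add_right[OF U W(1) w(1)]] by simp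
          then have "(inv\<^bsub>K\<^esub> c) \<odot>\<^bsub>V\<^esub> (c \<odot>\<^bsub>V\<^esub> b) \<in> U <+>\<^bsub>V\<^esub> W"
            using subspaceD(4)[OF UW] w(2) c by (simp add: field_Units)
          then show False
            using False w(2) c b by (simp add: field_Units smult_assoc1[symmetric])
        qed
        then have "x = w" using w carr b by simp
        then show ?thesis using W(2) x(1) w(1) by blast
      qed
      then have "U \<inter> ?W = {\<zero>\<^bsub>V\<^esub>}" using subspaceD(2)[OF U] subspaceD(2)[OF W'] by blast
      moreover have "W \<subseteq> ?W" using set_add_left[OF W(1) L] by blast
      then have "U <+>\<^bsub>V\<^esub> W \<subseteq> U <+>\<^bsub>V\<^esub> ?W" by (rule set_add_mono)
      moreover have "b \<in> U <+>\<^bsub>V\<^esub> ?W"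
        by (rule set_add_right[OF U W' set_add_right[OF W(1) L mem_line[OF b]]])
      ultimately show ?thesis using W' W(3) by blast
    qed
  qed
  then obtain W where "subspace K W V" "U \<inter> W = {\<zero>\<^bsub>V\<^esub>}" "A \<subseteq> U <+>\<^bsub>V\<^esub> W" by blast
  then show ?thesis using A(3)[OF subspace_set_add[OF U]] subspaceD(1)[OF subspace_set_add[OF U]] by blast
qed

text \<open>
  The components in \<open>U\<close> of a finite generating set generate \<open>U\<close>.
\<close>

lemma fin_dim_complemented:
  assumes fin_dim and U: "subspace K U V" and W: "subspace K W V"
    and int: "U \<inter> W = {\<zero>\<^bsub>V\<^esub>}" and sum: "U <+>\<^bsub>V\<^esub> W = carrier V"
  shows "vectorspace.fin_dim K (V\<lparr>carrier := U\<rparr>)"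
proof -
  note UD = subspaceD[OF U] and WD = subspaceD[OF W]
  interpret U: vectorspace K "V\<lparr>carrier := U\<rparr>" by (rule subspace_is_vs[OF U])
  obtain A where A: "finite A" "A \<subseteq> carrier V"
    "\<And>X. subspace K X V \<Longrightarrow> A \<subseteq> X \<Longrightarrow> carrier V \<subseteq> X"
    using assms(1) unfolding fin_dim_iff_subspaces by metis
  have "\<exists>u\<in>U. \<exists>w\<in>W. a = u \<oplus>\<^bsub>V\<^esub> w" if "a \<in> A" for a
  proof -
    have "a \<in> U <+>\<^bsub>V\<^esub> W" using that A(2) sum by auto
    then show ?thesis by (rule set_addE) blast
  qed
  then obtain u where u: "\<And>a. a \<in> A \<Longrightarrow> u a \<in> U \<and> (\<exists>w\<in>W. a = u a \<oplus>\<^bsub>V\<^esub> w)" by metis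
  have "U \<subseteq> X" if X: "subspace K X (V\<lparr>carrier := U\<rparr>)" "u ` A \<subseteq> X" for X
  proof -
    have "X \<subseteq> U" using subspaceD(1)[OF X(1)] by simp
    have X': "subspace K X V"
      using subspaceD[OF X(1)] UD(1) by (intro subspaceI[OF vectorspace_axioms]) auto
    have "A \<subseteq> X <+>\<^bsub>V\<^esub> W"
    proof
      fix a assume "a \<in> A"
      then obtain w where "w \<in> W" "a = u a \<oplus>\<^bsub>V\<^esub> w" "u a \<in> X" using u X(2) by blast
      then show "a \<in> X <+>\<^bsub>V\<^esub> W" using set_addI[of "u a" X w W V] by simp
    qed
    then have XW: "carrier V \<subseteq> X <+>\<^bsub>V\<^esub> W" by (rule A(3)[OF subspace_set_add[OF X' W]])
    show ?thesis
    proof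
      fix v assume v: "v \<in> U"
      then have "v \<in> X <+>\<^bsub>V\<^esub> W" using XW UD(1) by auto
      then obtain x w where *: "x \<in> X" "w \<in> W" "v = x \<oplus>\<^bsub>V\<^esub> w" by (rule set_addE)
      have carr: "x \<in> carrier V" "w \<in> carrier V" using * \<open>X \<subseteq> U\<close> UD(1) WD(1) by auto
      have w: "w = v \<ominus>\<^bsub>V\<^esub> x" unfolding *(3) using carr by (simp add: M.a_comm[of x] add_minus_cancel)
      have "w \<in> U" unfolding w using v \<open>X \<subseteq> U\<close> *(1) by (intro subspace_minus[OF U v]) auto
      then have "w = \<zero>\<^bsub>V\<^esub>" using int * by blast
      then show "v \<in> X" using * carr by simp
    qed
  qed
  then show ?thesis
    unfolding U.fin_dim_iff_subspaces using A(1) u by (intro exI[of _ "u ` A"]) auto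
qed

end

context vectorspace
begin

text \<open>
  Coordinates with respect to a basis are unique, hence linear in the vector.
\<close>

lemma coordinates_exist:
  assumes fin_dim
  obtains B coord where "finite B" "B \<subseteq> carrier V"
    "\<And>b x. b \<in> B \<Longrightarrow> x \<in> carrier V \<Longrightarrow> coord b x \<in> carrier K"
    "\<And>b x y. b \<in> B \<Longrightarrow> x \<in> carrier V \<Longrightarrow> y \<in> carrier V \<Longrightarrow> coord b (x \<oplus>\<^bsub>V\<^esub> y) = coord b x \<oplus>\<^bsub>K\<^esub> coord b y"
    "\<And>b c x. b \<in> B \<Longrightarrow> c \<in> carrier K \<Longrightarrow> x \<in> carrier V \<Longrightarrow> coord b (c \<odot>\<^bsub>V\<^esub> x) = c \<otimes>\<^bsub>K\<^esub> coord b x"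
    "\<And>x. x \<in> carrier V \<Longrightarrow> lincomb (\<lambda>b. coord b x) B = x"
proof -
  obtain B where B: "finite B" "basis B" using finite_basis_exists[OF assms] by blast
  have BV: "B \<subseteq> carrier V" using B(2) by (simp add: basis_def)
  have ex1: "\<exists>!a. a \<in> B \<rightarrow>\<^sub>E carrier K \<and> lincomb a B = v" if "v \<in> carrier V" for v
    using basis_criterion[OF B(1) BV] B(2) that by blast
  define cf where "cf v = (THE a. a \<in> B \<rightarrow>\<^sub>E carrier K \<and> lincomb a B = v)" for v
  have cf: "cf v \<in> B \<rightarrow>\<^sub>E carrier K" "lincomb (cf v) B = v" if "v \<in> carrier V" for v
    using theI'[OF ex1[OF that]] by (auto simp: cf_def)
  have uniq: "cf v b = a b" if "a \<in> B \<rightarrow> carrier K" "lincomb a B = v" "v \<in> carrier V" "b \<in> B" for a b v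
  proof -
    have "lincomb (restrict a B) B = v"
      using that(1,2) BV B(1) by (subst lincomb_cong[where a="restrict a B" and b=a]) auto
    then have "cf v = restrict a B"
      unfolding cf_def using that(1) by (intro the1_equality[OF ex1[OF that(3)]]) auto
    then show ?thesis using that(4) by simp
  qed
  have fn: "cf v \<in> B \<rightarrow> carrier K" if "v \<in> carrier V" for v using cf(1)[OF that] by auto
  show thesis
  proof (rule that[of B "\<lambda>b v. cf v b"])
    fix b x y assume *: "b \<in> B" "x \<in> carrier V" "y \<in> carrier V"
    show "cf (x \<oplus>\<^bsub>V\<^esub> y) b = cf x b \<oplus>\<^bsub>K\<^esub> cf y b"
      using * B(1) BV cf fn by (intro uniq) (auto simp: lincomb_sum)
  next
    fix b c x assume *: "b \<in> B" "c \<in> carrier K" "x \<in> carrier V"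
    show "cf (c \<odot>\<^bsub>V\<^esub> x) b = c \<otimes>\<^bsub>K\<^esub> cf x b"
      using * B(1) BV cf fn by (intro uniq) (auto simp: lincomb_smult)
  qed (use B(1) BV cf in \<open>auto\<close>)
qed

end

lemma set_add_comm:
  assumes "vectorspace K V" "U \<subseteq> carrier V" "W \<subseteq> carrier V"
  shows "U <+>\<^bsub>V\<^esub> W = W <+>\<^bsub>V\<^esub> U"
proof -
  interpret vectorspace K V by fact
  have "A <+>\<^bsub>V\<^esub> B \<subseteq> B <+>\<^bsub>V\<^esub> A" if "A \<subseteq> carrier V" "B \<subseteq> carrier V" for A B
  proof
    fix x assume "x \<in> A <+>\<^bsub>V\<^esub> B"
    then obtain a b where ab: "a \<in> A" "b \<in> B" "x = a \<oplus>\<^bsub>V\<^esub> b" by (rule set_addE)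
    then have "x = b \<oplus>\<^bsub>V\<^esub> a" using that M.a_comm by blast
    then show "x \<in> B <+>\<^bsub>V\<^esub> A" using set_addI[OF ab(2,1)] by simp
  qed
  then show ?thesis using assms(2,3) by blast
qed

lemma dual_space_simps:
  assumes "ring K"
  shows "carrier (dual_space K A) = {f \<in> carrier A \<rightarrow>\<^sub>E carrier K.
      (\<forall>x\<in>carrier A. \<forall>y\<in>carrier A. f (x \<oplus>\<^bsub>A\<^esub> y) = f x \<oplus>\<^bsub>K\<^esub> f y) \<and>
      (\<forall>c\<in>carrier K. \<forall>x\<in>carrier A. f (c \<odot>\<^bsub>A\<^esub> x) = c \<otimes>\<^bsub>K\<^esub> f x)}"
    "\<zero>\<^bsub>dual_space K A\<^esub> = (\<lambda>x\<in>carrier A. \<zero>\<^bsub>K\<^esub>)"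
    "f \<oplus>\<^bsub>dual_space K A\<^esub> g = (\<lambda>x\<in>carrier A. f x \<oplus>\<^bsub>K\<^esub> g x)"
    "c \<odot>\<^bsub>dual_space K A\<^esub> f = (\<lambda>x\<in>carrier A. c \<otimes>\<^bsub>K\<^esub> f x)"
  by (simp_all add: dual_space_def ring.func_space_def[OF assms])

lemma dual_space_vectorspace:
  assumes "vectorspace K A"
  shows "vectorspace K (dual_space K A)"
proof -
  interpret A: vectorspace K A by fact
  let ?F = "A.func_space (carrier A)"
  have F: "vectorspace K ?F" by (rule A.func_space_is_vs)
  let ?D = "carrier (dual_space K A)"
  have closed: "f x \<in> carrier K" if "f \<in> ?D" "x \<in> carrier A" for f x
    using that by (auto simp: dual_space_simps[OF A.R.ring_axioms])
  have "subspace K ?D ?F"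
  proof (rule subspaceI[OF F])
    show "?D \<subseteq> carrier ?F" by (auto simp: dual_space_simps[OF A.R.ring_axioms] A.func_space_def)
    show "\<zero>\<^bsub>?F\<^esub> \<in> ?D" by (simp add: dual_space_simps[OF A.R.ring_axioms] A.func_space_def)
  next
    fix f g assume *: "f \<in> ?D" "g \<in> ?D"
    with closed[OF *(1)] closed[OF *(2)] show "f \<oplus>\<^bsub>?F\<^esub> g \<in> ?D"
      by (auto simp: dual_space_simps[OF A.R.ring_axioms] A.func_space_def A.R.a_ac A.R.r_distr)
  next
    fix c f assume *: "c \<in> carrier K" "f \<in> ?D"
    with closed[OF *(2)] show "c \<odot>\<^bsub>?F\<^esub> f \<in> ?D"
      by (auto simp: dual_space_simps[OF A.R.ring_axioms] A.func_space_def A.R.m_ac A.R.r_distr)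
  qed
  then have "vectorspace K (?F\<lparr>carrier := ?D\<rparr>)" by (rule vectorspace.subspace_is_vs[OF F])
  also have "?F\<lparr>carrier := ?D\<rparr> = dual_space K A" by (simp add: dual_space_def)
  finally show ?thesis .
qed

text \<open>
  A functional that vanishes on the common zeros of finitely many functionals \<open>F\<close> is a linear
  combination of them. To induct on \<open>F\<close>, the claim is restricted to a subspace \<open>B\<close>: after removing
  one functional \<open>f\<close> from \<open>F\<close>, the hypothesis still holds on the kernel of \<open>f\<close> in \<open>B\<close>, so there
  \<open>g\<close> agrees with some \<open>w\<close> in \<open>W\<close>, and \<open>g - w\<close> is a multiple of \<open>f\<close> because it vanishes on that kernel.
\<close>

lemma dual_subspace_contains:
  assumes A: "vectorspace K A" and W: "subspace K W (dual_space K A)"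
    and F: "finite F" "F \<subseteq> W" and g: "g \<in> carrier (dual_space K A)"
    and sep: "\<And>a. a \<in> carrier A \<Longrightarrow> (\<And>f. f \<in> F \<Longrightarrow> f a = \<zero>\<^bsub>K\<^esub>) \<Longrightarrow> g a = \<zero>\<^bsub>K\<^esub>"
  shows "g \<in> W"
proof -
  interpret A: vectorspace K A by fact
  note D = dual_space_simps[OF A.R.ring_axioms, of A]
  note WD = subspaceD[OF W]
  have closed: "f x \<in> carrier K" if "f \<in> carrier (dual_space K A)" "x \<in> carrier A" for f x
    using that by (auto simp: D)
  have lin: "f (x \<ominus>\<^bsub>A\<^esub> c \<odot>\<^bsub>A\<^esub> y) = f x \<ominus>\<^bsub>K\<^esub> c \<otimes>\<^bsub>K\<^esub> f y"
    if "f \<in> carrier (dual_space K A)" "x \<in> carrier A" "c \<in> carrier K" "y \<in> carrier A" for f x c y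
  proof -
    have "x \<ominus>\<^bsub>A\<^esub> c \<odot>\<^bsub>A\<^esub> y = x \<oplus>\<^bsub>A\<^esub> (\<ominus>\<^bsub>K\<^esub> c) \<odot>\<^bsub>A\<^esub> y"
      using that by (simp add: a_minus_def A.smult_l_minus)
    then show ?thesis using that closed[OF that(1,4)] by (simp add: D a_minus_def A.R.l_minus)
  qed
  have "\<exists>w\<in>W. \<forall>b\<in>B. w b = g b"
    if "subspace K B A" "g \<in> carrier (dual_space K A)"
      "\<And>a. a \<in> B \<Longrightarrow> (\<And>f. f \<in> F \<Longrightarrow> f a = \<zero>\<^bsub>K\<^esub>) \<Longrightarrow> g a = \<zero>\<^bsub>K\<^esub>" for B g
    using F that
  proof (induction F arbitrary: B g rule: finite_induct)
    case empty
    then have "\<forall>b\<in>B. \<zero>\<^bsub>dual_space K A\<^esub> b = g b" using subspaceD(1)[OF empty(2)] by (auto simp: D)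
    then show ?case using WD(2) by blast
  next
    case (insert f F)
    note BD = subspaceD[OF insert.prems(2)]
    have f: "f \<in> W" "f \<in> carrier (dual_space K A)" using insert.prems(1) WD(1) by auto
    let ?B = "{b \<in> B. f b = \<zero>\<^bsub>K\<^esub>}"
    have B: "subspace K ?B A"
    proof (rule subspaceI[OF A])
      have "f \<zero>\<^bsub>A\<^esub> = f (\<zero>\<^bsub>K\<^esub> \<odot>\<^bsub>A\<^esub> \<zero>\<^bsub>A\<^esub>)" by simp
      also have "\<dots> = \<zero>\<^bsub>K\<^esub> \<otimes>\<^bsub>K\<^esub> f \<zero>\<^bsub>A\<^esub>"
        using f(2) A.R.zero_closed A.M.zero_closed by (simp only: D mem_Collect_eq)
      also have "\<dots> = \<zero>\<^bsub>K\<^esub>" using closed[OF f(2)] by simp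
      finally show "\<zero>\<^bsub>A\<^esub> \<in> ?B" using BD(2) by simp
    qed (use BD f(2) in \<open>auto simp: D subset_iff\<close>)
    have "\<exists>w\<in>W. \<forall>b\<in>?B. w b = g b"
      using insert.prems by (intro insert.IH B) auto
    then obtain w where w: "w \<in> W" "\<And>b. b \<in> ?B \<Longrightarrow> w b = g b" by blast
    have wD: "w \<in> carrier (dual_space K A)" using w(1) WD(1) by auto
    show ?case
    proof (cases "\<forall>b\<in>B. f b = \<zero>\<^bsub>K\<^esub>")
      case True
      then show ?thesis using w by auto
    next
      case False
      then obtain x where x: "x \<in> B" "f x \<noteq> \<zero>\<^bsub>K\<^esub>" by blast
      have xA: "x \<in> carrier A" using x BD(1) by auto
      note carr = closed[OF f(2) xA] closed[OF wD xA] closed[OF insert.prems(3) xA]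
      have unit: "f x \<in> Units K" using carr x by (simp add: A.field_Units)
      \<comment> \<open>the factor for which \<open>g - w\<close> and \<open>c f\<close> agree at \<open>x\<close>\<close>
      define c where "c = (g x \<ominus>\<^bsub>K\<^esub> w x) \<otimes>\<^bsub>K\<^esub> inv\<^bsub>K\<^esub> (f x)"
      have c: "c \<in> carrier K" using carr unit by (simp add: c_def)
      let ?w = "w \<oplus>\<^bsub>dual_space K A\<^esub> c \<odot>\<^bsub>dual_space K A\<^esub> f"
      have "?w b = g b" if b: "b \<in> B" for b
      proof -
        have bA: "b \<in> carrier A" using b BD(1) by auto
        note carr' = closed[OF f(2) bA] closed[OF wD bA] closed[OF insert.prems(3) bA]
        define d where "d = f b \<otimes>\<^bsub>K\<^esub> inv\<^bsub>K\<^esub> (f x)"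
        have d: "d \<in> carrier K" using carr' unit by (simp add: d_def)
        \<comment> \<open>moving \<open>b\<close> along \<open>x\<close> into the kernel of \<open>f\<close>\<close>
        let ?b = "b \<ominus>\<^bsub>A\<^esub> d \<odot>\<^bsub>A\<^esub> x"
        have "?b \<in> B" using b x(1) d by (intro subspace_minus[OF insert.prems(2)] BD(4))
        moreover have "f ?b = \<zero>\<^bsub>K\<^esub>"
          unfolding lin[OF f(2) bA d xA]
          using carr carr' unit by (simp add: d_def A.R.m_assoc A.R.r_neg a_minus_def)
        ultimately have "w ?b = g ?b" using w(2) by simp
        then have *: "w b \<ominus>\<^bsub>K\<^esub> d \<otimes>\<^bsub>K\<^esub> w x = g b \<ominus>\<^bsub>K\<^esub> d \<otimes>\<^bsub>K\<^esub> g x"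
          by (simp add: lin[OF wD bA d xA] lin[OF insert.prems(3) bA d xA])
        have "c \<otimes>\<^bsub>K\<^esub> f b = d \<otimes>\<^bsub>K\<^esub> (g x \<ominus>\<^bsub>K\<^esub> w x)"
          using carr carr' unit by (simp add: c_def d_def A.R.m_ac)
        then have "w b \<oplus>\<^bsub>K\<^esub> c \<otimes>\<^bsub>K\<^esub> f b = (w b \<ominus>\<^bsub>K\<^esub> d \<otimes>\<^bsub>K\<^esub> w x) \<oplus>\<^bsub>K\<^esub> d \<otimes>\<^bsub>K\<^esub> g x"
          using carr carr' d by (simp add: a_minus_def A.R.r_distr A.R.r_minus A.R.a_ac)
        also have "\<dots> = g b" unfolding *
          using carr carr' d by (simp add: a_minus_def A.R.a_assoc A.R.l_neg)
        finally show ?thesis using bA c carr' by (simp add: D)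
      qed
      moreover have "?w \<in> W" using w f c by (intro WD(3,4))
      ultimately show ?thesis by blast
    qed
  qed
  moreover have "subspace K (carrier A) A" by (rule subspaceI[OF A]) auto
  ultimately obtain w where w: "w \<in> W" "\<And>a. a \<in> carrier A \<Longrightarrow> w a = g a"
    using g sep by blast
  have "w = g"
  proof (rule extensionalityI)
    show "w \<in> extensional (carrier A)" "g \<in> extensional (carrier A)"
      using w(1) WD(1) g by (auto simp: D PiE_def)
  qed (rule w(2))
  with w(1) show ?thesis by simp
qed

section \<open>Invariant alternating forms and their dual\<close>

lemma alt_space_simps:
  fixes V :: "('k, 's, 'v, 'l) smodule_scheme"
  assumes "ring K"
  shows "carrier (alt_space K S V) = {\<phi> \<in> carrier V \<times> carrier V \<rightarrow>\<^sub>E carrier K.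
       (\<forall>x\<in>carrier V. \<forall>y\<in>carrier V. \<forall>z\<in>carrier V.
          \<phi> (x \<oplus>\<^bsub>V\<^esub> y, z) = \<phi> (x, z) \<oplus>\<^bsub>K\<^esub> \<phi> (y, z) \<and>
          \<phi> (x, y \<oplus>\<^bsub>V\<^esub> z) = \<phi> (x, y) \<oplus>\<^bsub>K\<^esub> \<phi> (x, z)) \<and>
       (\<forall>c\<in>carrier K. \<forall>x\<in>carrier V. \<forall>y\<in>carrier V.
          \<phi> (c \<odot>\<^bsub>V\<^esub> x, y) = c \<otimes>\<^bsub>K\<^esub> \<phi> (x, y) \<and>
          \<phi> (x, c \<odot>\<^bsub>V\<^esub> y) = c \<otimes>\<^bsub>K\<^esub> \<phi> (x, y)) \<and>
       (\<forall>x\<in>carrier V. \<phi> (x, x) = \<zero>\<^bsub>K\<^esub>) \<and>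
       (\<forall>s\<in>carrier S. \<forall>x\<in>carrier V. \<forall>y\<in>carrier V.
          \<phi> (act V s x, y) \<oplus>\<^bsub>K\<^esub> \<phi> (x, act V s y) = \<zero>\<^bsub>K\<^esub>)}"
    "\<zero>\<^bsub>alt_space K S V\<^esub> = (\<lambda>p\<in>carrier V \<times> carrier V. \<zero>\<^bsub>K\<^esub>)"
    "\<phi> \<oplus>\<^bsub>alt_space K S V\<^esub> \<psi> = (\<lambda>p\<in>carrier V \<times> carrier V. \<phi> p \<oplus>\<^bsub>K\<^esub> \<psi> p)"
    "c \<odot>\<^bsub>alt_space K S V\<^esub> \<phi> = (\<lambda>p\<in>carrier V \<times> carrier V. c \<otimes>\<^bsub>K\<^esub> \<phi> p)"
  by (simp_all add: alt_space_def ring.func_space_def[OF assms])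

text \<open>
  The functional \<open>e\<^bsub>x,y\<^esub>\<close> of the definition of \<open>h(V)\<close>.
\<close>

definition alt_eval :: "('k, 'm) ring_scheme \<Rightarrow> ('k, 's, 'n) module_scheme
    \<Rightarrow> ('k, 's, 'v, 'l) smodule_scheme \<Rightarrow> 'v \<Rightarrow> 'v \<Rightarrow> (('v \<times> 'v \<Rightarrow> 'k) \<Rightarrow> 'k)" where
  "alt_eval K S V x y = (\<lambda>\<phi>\<in>carrier (alt_space K S V). \<phi> (x, y))"

lemma s_submoduleD:
  assumes "s_submodule K S W V"
  shows "subspace K W V" "\<And>s w. s \<in> carrier S \<Longrightarrow> w \<in> W \<Longrightarrow> act V s w \<in> W"
  using assms by (auto simp: s_submodule_def)

context s_module
begin

lemma act_zero: "s \<in> carrier S \<Longrightarrow> act V s \<zero> = \<zero>"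
  using act_smult_right[of s "\<zero>\<^bsub>K\<^esub>" "\<zero>"] act_closed[of s "\<zero>"] by simp

lemma alt_space_closed: 
  assumes "\<phi> \<in> carrier (alt_space K S V)" "x \<in> carrier V" "y \<in> carrier V"
  shows "\<phi> (x, y) \<in> carrier K"
  using assms by (auto simp: alt_space_simps[OF S.R.ring_axioms])

lemma alt_space_vectorspace: "vectorspace K (alt_space K S V)"
proof -
  let ?F = "S.func_space (carrier V \<times> carrier V)"
  have F: "vectorspace K ?F" by (rule func_space_is_vs)
  let ?A = "carrier (alt_space K S V)"
  note A = alt_space_simps[OF S.R.ring_axioms, of S V] and Fd = S.func_space_def
  have "subspace K ?A ?F"
  proof (rule subspaceI[OF F])
    show "?A \<subseteq> carrier ?F" by (auto simp: A Fd)
    show "\<zero>\<^bsub>?F\<^esub> \<in> ?A" by (auto simp: A Fd act_closed)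
  next
    fix f g assume *: "f \<in> ?A" "g \<in> ?A"
    note c = alt_space_closed[OF *(1)] alt_space_closed[OF *(2)]
    have skew: "f (act V s x, y) \<oplus>\<^bsub>K\<^esub> g (act V s x, y) \<oplus>\<^bsub>K\<^esub> (f (x, act V s y) \<oplus>\<^bsub>K\<^esub> g (x, act V s y)) = \<zero>\<^bsub>K\<^esub>"
      if "s \<in> carrier S" "x \<in> carrier V" "y \<in> carrier V" for s x y
    proof -
      have "f (act V s x, y) \<oplus>\<^bsub>K\<^esub> g (act V s x, y) \<oplus>\<^bsub>K\<^esub> (f (x, act V s y) \<oplus>\<^bsub>K\<^esub> g (x, act V s y))
        = (f (act V s x, y) \<oplus>\<^bsub>K\<^esub> f (x, act V s y)) \<oplus>\<^bsub>K\<^esub> (g (act V s x, y) \<oplus>\<^bsub>K\<^esub> g (x, act V s y))"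
        using that by (simp add: c act_closed S.R.a_ac)
      also have "\<dots> = \<zero>\<^bsub>K\<^esub>" using * that by (simp add: A)
      finally show ?thesis .
    qed
    show "f \<oplus>\<^bsub>?F\<^esub> g \<in> ?A"
      using * c skew by (auto simp: A Fd S.R.a_ac S.R.r_distr act_closed)
  next
    fix c f assume c: "c \<in> carrier K" and *: "f \<in> ?A"
    note cl = alt_space_closed[OF *]
    have skew: "c \<otimes>\<^bsub>K\<^esub> f (act V s x, y) \<oplus>\<^bsub>K\<^esub> c \<otimes>\<^bsub>K\<^esub> f (x, act V s y) = \<zero>\<^bsub>K\<^esub>"
      if "s \<in> carrier S" "x \<in> carrier V" "y \<in> carrier V" for s x y
      using * that c by (simp add: A cl act_closed S.R.r_distr[symmetric])
    show "c \<odot>\<^bsub>?F\<^esub> f \<in> ?A"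
      using * c cl skew by (auto simp: A Fd S.R.m_ac S.R.r_distr act_closed)
  qed
  then have "vectorspace K (?F\<lparr>carrier := ?A\<rparr>)" by (rule vectorspace.subspace_is_vs[OF F])
  also have "?F\<lparr>carrier := ?A\<rparr> = alt_space K S V" by (simp add: alt_space_def)
  finally show ?thesis .
qed

lemma alt_dual_vectorspace: "vectorspace K (alt_dual K S V)"
  unfolding alt_dual_def by (rule dual_space_vectorspace[OF alt_space_vectorspace])

lemmas alt_dual_simps = dual_space_simps[OF S.R.ring_axioms, of "alt_space K S V", folded alt_dual_def]

lemma alt_eval_closed:
  "x \<in> carrier V \<Longrightarrow> y \<in> carrier V \<Longrightarrow> alt_eval K S V x y \<in> carrier (alt_dual K S V)"
proof -
  interpret A: vectorspace K "alt_space K S V" by (rule alt_space_vectorspace)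
  assume "x \<in> carrier V" "y \<in> carrier V"
  then show ?thesis
    using A.M.a_closed A.smult_closed
    by (auto simp: alt_dual_simps alt_eval_def alt_space_closed) (auto simp: alt_space_simps[OF S.R.ring_axioms])
qed

lemma alt_eval_add:
  assumes "x \<in> carrier V" "y \<in> carrier V" "z \<in> carrier V"
  shows "alt_eval K S V (x \<oplus> y) z = alt_eval K S V x z \<oplus>\<^bsub>alt_dual K S V\<^esub> alt_eval K S V y z"
    "alt_eval K S V x (y \<oplus> z) = alt_eval K S V x y \<oplus>\<^bsub>alt_dual K S V\<^esub> alt_eval K S V x z"
  using assms by (auto simp: alt_dual_simps alt_eval_def fun_eq_iff restrict_def alt_space_simps(1)[OF S.R.ring_axioms])

lemma alt_eval_smult:
  assumes "c \<in> carrier K" "x \<in> carrier V" "y \<in> carrier V"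
  shows "alt_eval K S V (c \<odot> x) y = c \<odot>\<^bsub>alt_dual K S V\<^esub> alt_eval K S V x y"
    "alt_eval K S V x (c \<odot> y) = c \<odot>\<^bsub>alt_dual K S V\<^esub> alt_eval K S V x y"
  using assms by (auto simp: alt_dual_simps alt_eval_def fun_eq_iff restrict_def alt_space_simps(1)[OF S.R.ring_axioms])

lemma alt_eval_self: "x \<in> carrier V \<Longrightarrow> alt_eval K S V x x = \<zero>\<^bsub>alt_dual K S V\<^esub>"
  by (auto simp: alt_dual_simps alt_eval_def fun_eq_iff restrict_def alt_space_simps(1)[OF S.R.ring_axioms])

lemma alt_eval_act:
  assumes "s \<in> carrier S" "x \<in> carrier V" "y \<in> carrier V"
  shows "alt_eval K S V (act V s x) y \<oplus>\<^bsub>alt_dual K S V\<^esub> alt_eval K S V x (act V s y) = \<zero>\<^bsub>alt_dual K S V\<^esub>"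
  using assms by (auto simp: alt_dual_simps alt_eval_def fun_eq_iff restrict_def alt_space_simps(1)[OF S.R.ring_axioms])

text \<open>
  A form that vanishes on pairs from a generating set of \<open>V\<close> is zero, so the finitely many
  evaluations at such pairs have no common zero in \<open>Alt(V)\<close>. This proves at the same time that the
  dual of \<open>Alt(V)\<close> is finite-dimensional.
\<close>

lemma alt_dual_finitely_generated:
  "\<exists>F. finite F \<and> F \<subseteq> {alt_eval K S V x y | x y. x \<in> carrier V \<and> y \<in> carrier V} \<and>
    (\<forall>W. subspace K W (alt_dual K S V) \<and> F \<subseteq> W \<longrightarrow> carrier (alt_dual K S V) \<subseteq> W)"
proof -
  obtain A where A: "finite A" "A \<subseteq> carrier V"
    "\<And>W. subspace K W V \<Longrightarrow> A \<subseteq> W \<Longrightarrow> carrier V \<subseteq> W"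
    using finite_dimensional unfolding fin_dim_iff_subspaces by metis
  let ?F = "(\<lambda>(a, b). alt_eval K S V a b) ` (A \<times> A)"
  interpret A: vectorspace K "alt_space K S V" by (rule alt_space_vectorspace)
  note As = alt_space_simps[OF S.R.ring_axioms, of S V]
  have "g \<in> W" if W: "subspace K W (alt_dual K S V)" "?F \<subseteq> W" and g: "g \<in> carrier (alt_dual K S V)" for g W
  proof (rule dual_subspace_contains[OF alt_space_vectorspace W(1)[unfolded alt_dual_def] _ W(2) g[unfolded alt_dual_def]])
    show "finite ?F" using A(1) by simp
    fix \<phi> assume \<phi>: "\<phi> \<in> carrier (alt_space K S V)" and "\<And>f. f \<in> ?F \<Longrightarrow> f \<phi> = \<zero>\<^bsub>K\<^esub>"
    then have 0: "\<phi> (a, b) = \<zero>\<^bsub>K\<^esub>" if "a \<in> A" "b \<in> A" for a b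
      using that by (force simp: alt_eval_def)
    have z: "\<phi> (\<zero>, y) = \<zero>\<^bsub>K\<^esub> \<and> \<phi> (y, \<zero>) = \<zero>\<^bsub>K\<^esub>" if y: "y \<in> carrier V" for y
    proof -
      have "\<phi> (\<zero>\<^bsub>K\<^esub> \<odot> \<zero>, y) = \<zero>\<^bsub>K\<^esub> \<otimes>\<^bsub>K\<^esub> \<phi> (\<zero>, y)" "\<phi> (y, \<zero>\<^bsub>K\<^esub> \<odot> \<zero>) = \<zero>\<^bsub>K\<^esub> \<otimes>\<^bsub>K\<^esub> \<phi> (y, \<zero>)"
        using \<phi> y S.R.zero_closed M.zero_closed by (simp_all only: As mem_Collect_eq)
      then show ?thesis using alt_space_closed[OF \<phi>] y by simp
    qed
    have "subspace K {x \<in> carrier V. \<forall>b\<in>A. \<phi> (x, b) = \<zero>\<^bsub>K\<^esub>} V"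
      using \<phi> A(2) z by (intro subspaceI[OF vectorspace_axioms]) (auto simp: As subset_iff)
    then have 1: "\<phi> (x, b) = \<zero>\<^bsub>K\<^esub>" if "x \<in> carrier V" "b \<in> A" for x b
      using A(3) 0 A(2) that by blast
    have "subspace K {y \<in> carrier V. \<forall>x\<in>carrier V. \<phi> (x, y) = \<zero>\<^bsub>K\<^esub>} V"
      using \<phi> z by (intro subspaceI[OF vectorspace_axioms]) (auto simp: As subset_iff)
    then have 2: "\<phi> (x, y) = \<zero>\<^bsub>K\<^esub>" if "x \<in> carrier V" "y \<in> carrier V" for x y
      using A(3) 1 A(2) that by blast
    have "\<phi> = \<zero>\<^bsub>alt_space K S V\<^esub>"
      using \<phi> 2 by (intro extensionalityI[of _ "carrier V \<times> carrier V"]) (auto simp: As PiE_def)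
    also have "\<dots> = \<zero>\<^bsub>K\<^esub> \<odot>\<^bsub>alt_space K S V\<^esub> \<zero>\<^bsub>alt_space K S V\<^esub>" by simp
    finally have "g \<phi> = g (\<zero>\<^bsub>K\<^esub> \<odot>\<^bsub>alt_space K S V\<^esub> \<zero>\<^bsub>alt_space K S V\<^esub>)" by (rule arg_cong)
    also have "\<dots> = \<zero>\<^bsub>K\<^esub> \<otimes>\<^bsub>K\<^esub> g \<zero>\<^bsub>alt_space K S V\<^esub>"
      using g S.R.zero_closed A.M.zero_closed by (simp only: alt_dual_simps mem_Collect_eq)
    also have "\<dots> = \<zero>\<^bsub>K\<^esub>" using PiE_mem[of g "carrier (alt_space K S V)" "\<lambda>_. carrier K" "\<zero>\<^bsub>alt_space K S V\<^esub>"] g by (simp add: alt_dual_simps(1))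
    finally show "g \<phi> = \<zero>\<^bsub>K\<^esub>" .
  qed
  moreover have "?F \<subseteq> {alt_eval K S V x y | x y. x \<in> carrier V \<and> y \<in> carrier V}"
    using A(2) by (auto intro!: exI)
  ultimately show ?thesis using A(1) by (intro exI[of _ ?F]) blast
qed

lemma alt_dual_generated:
  assumes "subspace K W (alt_dual K S V)"
    and "\<And>x y. x \<in> carrier V \<Longrightarrow> y \<in> carrier V \<Longrightarrow> alt_eval K S V x y \<in> W"
  shows "carrier (alt_dual K S V) \<subseteq> W"
proof -
  obtain F where F: "F \<subseteq> {alt_eval K S V x y | x y. x \<in> carrier V \<and> y \<in> carrier V}"
    "\<forall>W. subspace K W (alt_dual K S V) \<and> F \<subseteq> W \<longrightarrow> carrier (alt_dual K S V) \<subseteq> W"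
    using alt_dual_finitely_generated by (elim exE conjE)
  have "F \<subseteq> W" using F(1) assms(2) by blast
  with F(2) assms(1) show ?thesis by blast
qed

text \<open>
  A nonzero invariant vector spans a trivial submodule of dimension one, and every nonzero vector
  of such a submodule is invariant. Absence of invariant vectors is the form of fullness that is
  used below.
\<close>

lemma full_module_iff:
  "full_module K S V \<longleftrightarrow> completely_reducible K S V \<and>
     (\<forall>x\<in>carrier V. (\<forall>s\<in>carrier S. act V s x = \<zero>) \<longrightarrow> x = \<zero>)"
proof -
  have "\<exists>W. s_submodule K S W V \<and> vectorspace.dim K (V\<lparr>carrier := W\<rparr>) = 1 \<and>
            (\<forall>s\<in>carrier S. \<forall>w\<in>W. act V s w = \<zero>)"
    if x: "x \<in> carrier V" "\<forall>s\<in>carrier S. act V s x = \<zero>" "x \<noteq> \<zero>" for x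
  proof (intro exI conjI)
    let ?L = "{c \<odot> x | c. c \<in> carrier K}"
    have L: "subspace K ?L V" by (rule subspace_line[OF x(1)])
    interpret L: vectorspace K "V\<lparr>carrier := ?L\<rparr>" by (rule subspace_is_vs[OF L])
    show triv: "\<forall>s\<in>carrier S. \<forall>w\<in>?L. act V s w = \<zero>" using x by (auto simp: act_smult_right)
    then show "s_submodule K S ?L V"
      using L subspaceD(2)[OF L] by (simp add: s_submodule_def)
    have sp: "subspace K (L.span {x}) (V\<lparr>carrier := ?L\<rparr>)"
      using mem_line[OF x(1)] by (intro L.span_is_subspace) auto
    have "?L \<subseteq> L.span {x}"
      using subspaceD(4)[OF sp] L.span_self[of x] mem_line[OF x(1)] by auto
    then have "L.span {x} = ?L" using subspaceD(1)[OF sp] by auto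
    then show "L.dim = 1"
      using x mem_line[OF x(1)] by (intro L.dim1I[of x]) auto
  qed
  moreover have False
    if W: "s_submodule K S W V" "vectorspace.dim K (V\<lparr>carrier := W\<rparr>) = 1"
      "\<forall>s\<in>carrier S. \<forall>w\<in>W. act V s w = \<zero>"
      and inv: "\<forall>x\<in>carrier V. (\<forall>s\<in>carrier S. act V s x = \<zero>) \<longrightarrow> x = \<zero>" for W
  proof -
    note WD = subspaceD[OF s_submoduleD(1)[OF W(1)]]
    interpret W: vectorspace K "V\<lparr>carrier := W\<rparr>" by (rule subspace_is_vs[OF s_submoduleD(1)[OF W(1)]])
    have W0: "W = {\<zero>}" using W(3) inv WD(1,2) by blast
    have "W.span {\<zero>} \<subseteq> {\<zero>}" using W.span_is_subspace[of "{\<zero>}"] WD(2) W0 subspaceD(1) by fastforce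
    then have "W.gen_set {\<zero>\<^bsub>V\<lparr>carrier := W\<rparr>\<^esub>}" using W.span_zero[of "{\<zero>}"] W0 by auto
    then have "W.dim = 0" by (rule W.dim0I)
    then show False using W(2) by simp
  qed
  ultimately show ?thesis
    unfolding full_module_def using s_module_axioms by blast
qed

text \<open>
  A complement of a submodule that contains \<open>[S, V]\<close> consists of invariant vectors.
\<close>

lemma full_module_generated:
  assumes "full_module K S V" and U: "s_submodule K S U V"
    and act: "\<And>s x. s \<in> carrier S \<Longrightarrow> x \<in> carrier V \<Longrightarrow> act V s x \<in> U"
  shows "U = carrier V"
proof -
  obtain C where C: "s_submodule K S C V" "U \<inter> C = {\<zero>}" "U <+>\<^bsub>V\<^esub> C = carrier V"
    using assms(1,2) unfolding full_module_def completely_reducible_def by blast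
  have CV: "C \<subseteq> carrier V" and UV: "U \<subseteq> carrier V"
    using subspaceD(1) s_submoduleD(1) C(1) U by blast+
  have "act V s c = \<zero>" if "s \<in> carrier S" "c \<in> C" for s c
    using act[OF that(1)] s_submoduleD(2)[OF C(1) that] that CV C(2) by blast
  then have C0: "c = \<zero>" if "c \<in> C" for c
    using that assms(1) CV unfolding full_module_iff by blast
  have "x \<in> U" if "x \<in> carrier V" for x
  proof -
    have "x \<in> U <+>\<^bsub>V\<^esub> C" using that C(3) by simp
    then obtain u c where u: "u \<in> U" and c: "c \<in> C" "x = u \<oplus> c" by (rule set_addE)
    have "x = u" unfolding c(2) C0[OF c(1)] using u UV by (intro M.r_zero) auto
    then show ?thesis using u by simp
  qed
  then show ?thesis using UV by blast
qed

end

section \<open>Lie subalgebras and almost minimality\<close>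

lemma lie_subalgebraI:
  assumes "subspace K H L" "\<And>x y. x \<in> H \<Longrightarrow> y \<in> H \<Longrightarrow> x \<otimes>\<^bsub>L\<^esub> y \<in> H"
  shows "lie_subalgebra K H L"
  using assms by (auto simp: lie_subalgebra_def)

lemma lie_subalgebraD:
  assumes "lie_subalgebra K H L"
  shows "subspace K H L" "\<And>x y. x \<in> H \<Longrightarrow> y \<in> H \<Longrightarrow> x \<otimes>\<^bsub>L\<^esub> y \<in> H"
  using assms by (auto simp: lie_subalgebra_def)

lemma lie_generated_minimal: "lie_subalgebra K H L \<Longrightarrow> X \<subseteq> H \<Longrightarrow> lie_generated K L X \<subseteq> H"
  unfolding lie_generated_def by blast

lemma lie_generatedI: "(\<And>H. lie_subalgebra K H L \<Longrightarrow> X \<subseteq> H \<Longrightarrow> x \<in> H) \<Longrightarrow> x \<in> lie_generated K L X"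
  unfolding lie_generated_def by blast

lemma lie_generatedD: "x \<in> lie_generated K L X \<Longrightarrow> lie_subalgebra K H L \<Longrightarrow> X \<subseteq> H \<Longrightarrow> x \<in> H"
  unfolding lie_generated_def by blast

lemma lie_generated_superset: "X \<subseteq> lie_generated K L X"
  unfolding lie_generated_def by blast

context lie_algebra
begin

lemma bracket_zero_right: "x \<in> carrier L \<Longrightarrow> x \<otimes> \<zero> = \<zero>"
  using bracket_smult_right[of "\<zero>\<^bsub>K\<^esub>" x \<zero>] bracket_closed[of x \<zero>] by simp

lemma bracket_zero_left: "x \<in> carrier L \<Longrightarrow> \<zero> \<otimes> x = \<zero>"
  using bracket_smult_left[of "\<zero>\<^bsub>K\<^esub>" \<zero> x] bracket_closed[of \<zero> x] by simp

lemma bracket_antisym: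
  assumes "x \<in> carrier L" "y \<in> carrier L"
  shows "x \<otimes> y \<oplus> y \<otimes> x = \<zero>"
proof -
  have "(x \<oplus> y) \<otimes> (x \<oplus> y) = x \<otimes> y \<oplus> y \<otimes> x"
    using assms by (simp add: bracket_add_left bracket_add_right bracket_closed
        bracket_self[OF assms(1)] bracket_self[OF assms(2)] M.a_comm)
  then show ?thesis using bracket_self[of "x \<oplus> y"] assms by simp
qed

lemma lie_subalgebra_carrier: "lie_subalgebra K (carrier L) L"
  by (intro lie_subalgebraI subspaceI[OF vectorspace_axioms]) (auto simp: bracket_closed)

lemma lie_subalgebra_zero: "lie_subalgebra K {\<zero>} L"
  by (intro lie_subalgebraI subspaceI[OF vectorspace_axioms]) (auto simp: bracket_zero_left)

lemma lie_generated_subalgebra: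
  assumes "X \<subseteq> carrier L"
  shows "lie_subalgebra K (lie_generated K L X) L"
proof (intro lie_subalgebraI subspaceI[OF vectorspace_axioms])
  show "lie_generated K L X \<subseteq> carrier L"
    by (rule lie_generated_minimal[OF lie_subalgebra_carrier assms])
  note in_all = lie_generatedI and each = lie_generatedD and sub = lie_subalgebraD(1)
  show "\<zero> \<in> lie_generated K L X"
    by (rule in_all) (rule subspaceD(2)[OF sub])
  show "x \<oplus> y \<in> lie_generated K L X"
    if "x \<in> lie_generated K L X" "y \<in> lie_generated K L X" for x y
    by (rule in_all, rule subspaceD(3)[OF sub]) (use that in \<open>auto dest: each\<close>)
  show "c \<odot> x \<in> lie_generated K L X" if "c \<in> carrier K" "x \<in> lie_generated K L X" for c x
    by (rule in_all, rule subspaceD(4)[OF sub]) (use that in \<open>auto dest: each\<close>)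
  show "x \<otimes> y \<in> lie_generated K L X"
    if "x \<in> lie_generated K L X" "y \<in> lie_generated K L X" for x y
    by (rule in_all, rule lie_subalgebraD(2)) (use that in \<open>auto dest: each\<close>)
qed

lemma lie_generated_trivial_iff:
  assumes "X \<subseteq> carrier L"
  shows "lie_generated K L X = {\<zero>} \<longleftrightarrow> X \<subseteq> {\<zero>}"
proof
  assume "lie_generated K L X = {\<zero>}"
  then show "X \<subseteq> {\<zero>}" using lie_generated_superset[of X K L] by (simp only:)
next
  assume "X \<subseteq> {\<zero>}"
  then have "lie_generated K L X \<subseteq> {\<zero>}" by (rule lie_generated_minimal[OF lie_subalgebra_zero])
  moreover have "\<zero> \<in> lie_generated K L X"
    using subspaceD(2)[OF lie_subalgebraD(1)[OF lie_generated_subalgebra[OF assms]]] .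
  ultimately show "lie_generated K L X = {\<zero>}" by blast
qed

lemma bracket_sub_trivial_iff:
  assumes "A \<subseteq> carrier L" "B \<subseteq> carrier L"
  shows "bracket_sub K L A B = {\<zero>} \<longleftrightarrow> (\<forall>x\<in>A. \<forall>y\<in>B. x \<otimes> y = \<zero>)"
  unfolding bracket_sub_def
proof (subst lie_generated_trivial_iff)
  show "{x \<otimes> y | x y. x \<in> A \<and> y \<in> B} \<subseteq> carrier L" using assms by (auto intro!: bracket_closed)
qed auto

end

context lie_s_algebra
begin

lemma act_sub_trivial_iff:
  assumes "B \<subseteq> carrier N"
  shows "act_sub K S N B = {\<zero>} \<longleftrightarrow> (\<forall>s\<in>carrier S. \<forall>x\<in>B. act N s x = \<zero>)"
  unfolding act_sub_def
proof (subst lie_generated_trivial_iff)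
  show "{act N s x | s x. s \<in> carrier S \<and> x \<in> B} \<subseteq> carrier N" using assms by (auto intro!: act_closed)
qed auto

text \<open>
  The elements annihilated by all brackets form a subalgebra (they bracket to zero among
  themselves), so it suffices to test the generators of the derived subalgebra.
\<close>

lemma derived_sub_annihilator:
  "(\<forall>x\<in>carrier N. \<forall>d\<in>derived_sub K N (carrier N). x \<otimes> d = \<zero>) \<longleftrightarrow>
    (\<forall>x\<in>carrier N. \<forall>y\<in>carrier N. \<forall>z\<in>carrier N. x \<otimes> (y \<otimes> z) = \<zero>)" (is "?L \<longleftrightarrow> ?R")
proof
  assume ?L
  moreover have "y \<otimes> z \<in> derived_sub K N (carrier N)" if "y \<in> carrier N" "z \<in> carrier N" for y z
    unfolding derived_sub_def bracket_sub_def
    by (rule subsetD[OF lie_generated_superset]) (use that in blast)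
  ultimately show ?R by blast
next
  assume R: ?R
  have "lie_subalgebra K {d \<in> carrier N. \<forall>x\<in>carrier N. x \<otimes> d = \<zero>} N"
    using R by (intro lie_subalgebraI subspaceI[OF vectorspace_axioms])
      (auto simp: bracket_zero_right bracket_add_right bracket_smult_right bracket_closed)
  then have "derived_sub K N (carrier N) \<subseteq> {d \<in> carrier N. \<forall>x\<in>carrier N. x \<otimes> d = \<zero>}"
    unfolding derived_sub_def bracket_sub_def
    by (rule lie_generated_minimal) (use R bracket_closed in auto)
  then show ?L by blast
qed

lemma derived_sub_invariant:
  "(\<forall>s\<in>carrier S. \<forall>d\<in>derived_sub K N (carrier N). act N s d = \<zero>) \<longleftrightarrow>
    (\<forall>s\<in>carrier S. \<forall>x\<in>carrier N. \<forall>y\<in>carrier N. act N s (x \<otimes> y) = \<zero>)" (is "?L \<longleftrightarrow> ?R")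
proof
  assume ?L
  moreover have "y \<otimes> z \<in> derived_sub K N (carrier N)" if "y \<in> carrier N" "z \<in> carrier N" for y z
    unfolding derived_sub_def bracket_sub_def
    by (rule subsetD[OF lie_generated_superset]) (use that in blast)
  ultimately show ?R by blast
next
  assume R: ?R
  have "lie_subalgebra K {d \<in> carrier N. \<forall>s\<in>carrier S. act N s d = \<zero>} N"
    using R by (intro lie_subalgebraI subspaceI[OF vectorspace_axioms])
      (auto simp: act_zero act_add_right act_smult_right bracket_closed)
  then have "derived_sub K N (carrier N) \<subseteq> {d \<in> carrier N. \<forall>s\<in>carrier S. act N s d = \<zero>}"
    unfolding derived_sub_def bracket_sub_def
    by (rule lie_generated_minimal) (use R bracket_closed in auto)
  then show ?L by blast
qed

lemma derived_sub_closed: "derived_sub K N (carrier N) \<subseteq> carrier N"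
  unfolding derived_sub_def bracket_sub_def
  by (rule lie_generated_minimal[OF lie_subalgebra_carrier]) (use bracket_closed in auto)

lemma act_sub_full_iff:
  "act_sub K S N (carrier N) = carrier N \<longleftrightarrow>
    (\<forall>H. lie_subalgebra K H N \<and> (\<forall>s\<in>carrier S. \<forall>x\<in>carrier N. act N s x \<in> H) \<longrightarrow> carrier N \<subseteq> H)"
    (is "_ \<longleftrightarrow> ?R")
proof
  assume L: "act_sub K S N (carrier N) = carrier N"
  show ?R
  proof (intro allI impI)
    fix H assume "lie_subalgebra K H N \<and> (\<forall>s\<in>carrier S. \<forall>x\<in>carrier N. act N s x \<in> H)"
    then have "act_sub K S N (carrier N) \<subseteq> H"
      unfolding act_sub_def by (intro lie_generated_minimal) auto
    then show "carrier N \<subseteq> H" by (simp only: L)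
  qed
next
  assume R: ?R
  let ?X = "{act N s x | s x. s \<in> carrier S \<and> x \<in> carrier N}"
  have X: "?X \<subseteq> carrier N" using act_closed by blast
  have "carrier N \<subseteq> lie_generated K N ?X"
    using R lie_generated_subalgebra[OF X] lie_generated_superset[of ?X K N] by blast
  moreover have "lie_generated K N ?X \<subseteq> carrier N"
    by (rule lie_generated_minimal[OF lie_subalgebra_carrier X])
  ultimately show "act_sub K S N (carrier N) = carrier N" unfolding act_sub_def by blast
qed

text \<open>
  The conditions in terms of elements only. Solvability is a consequence of the first condition,
  since the derived subalgebra of the derived subalgebra lies in \<open>[N, DN] = 0\<close>.
\<close>

lemma almost_minimal_iff:
  "almost_minimal_s_algebra K S N \<longleftrightarrow>
    (\<forall>x\<in>carrier N. \<forall>y\<in>carrier N. \<forall>z\<in>carrier N. x \<otimes> (y \<otimes> z) = \<zero>) \<and>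
    (\<forall>s\<in>carrier S. \<forall>x\<in>carrier N. \<forall>y\<in>carrier N. act N s (x \<otimes> y) = \<zero>) \<and>
    (\<forall>H. lie_subalgebra K H N \<and> (\<forall>s\<in>carrier S. \<forall>x\<in>carrier N. act N s x \<in> H) \<longrightarrow> carrier N \<subseteq> H)"
proof -
  let ?D = "derived_sub K N (carrier N)"
  have "(\<forall>x\<in>carrier N. \<forall>d\<in>?D. x \<otimes> d = \<zero>) \<longrightarrow> lie_solvable K N"
  proof
    assume that: "\<forall>x\<in>carrier N. \<forall>d\<in>?D. x \<otimes> d = \<zero>"
    have "derived_sub K N ?D = {\<zero>}"
      unfolding derived_sub_def[of K N ?D] bracket_sub_trivial_iff[OF derived_sub_closed derived_sub_closed]
      using that derived_sub_closed by blast
    then have "(derived_sub K N ^^ 2) (carrier N) = {\<zero>}" by (simp add: numeral_2_eq_2)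
    then show "lie_solvable K N" unfolding lie_solvable_def by blast
  qed
  then show ?thesis
    unfolding almost_minimal_s_algebra_def act_sub_full_iff
      bracket_sub_trivial_iff[OF subset_refl derived_sub_closed]
      act_sub_trivial_iff[OF derived_sub_closed]
      derived_sub_annihilator[symmetric] derived_sub_invariant[symmetric]
    using lie_s_algebra_axioms by argo
qed

end

section \<open>Surjective homomorphisms\<close>

text \<open>
  Preservation of zero is demanded explicitly, so that these maps make sense for a target
  that is not yet known to be a vector space.
\<close>

definition s_algebra_epi :: "('k, 'm) ring_scheme \<Rightarrow> ('k, 's, 'n) module_scheme
    \<Rightarrow> ('k, 's, 'a, 'l1) smodule_scheme \<Rightarrow> ('k, 's, 'b, 'l2) smodule_scheme \<Rightarrow> ('a \<Rightarrow> 'b) set" where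
  "s_algebra_epi K S M N = {f \<in> module_hom K M N. f ` carrier M = carrier N \<and> f \<zero>\<^bsub>M\<^esub> = \<zero>\<^bsub>N\<^esub> \<and>
     (\<forall>x\<in>carrier M. \<forall>y\<in>carrier M. f (x \<otimes>\<^bsub>M\<^esub> y) = f x \<otimes>\<^bsub>N\<^esub> f y) \<and>
     (\<forall>s\<in>carrier S. \<forall>x\<in>carrier M. f (act M s x) = act N s (f x))}"

lemma s_algebra_epiD:
  assumes "f \<in> s_algebra_epi K S M N"
  shows "f ` carrier M = carrier N" "f \<zero>\<^bsub>M\<^esub> = \<zero>\<^bsub>N\<^esub>"
    "\<And>x. x \<in> carrier M \<Longrightarrow> f x \<in> carrier N"
    "\<And>x y. x \<in> carrier M \<Longrightarrow> y \<in> carrier M \<Longrightarrow> f (x \<oplus>\<^bsub>M\<^esub> y) = f x \<oplus>\<^bsub>N\<^esub> f y"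
    "\<And>c x. c \<in> carrier K \<Longrightarrow> x \<in> carrier M \<Longrightarrow> f (c \<odot>\<^bsub>M\<^esub> x) = c \<odot>\<^bsub>N\<^esub> f x"
    "\<And>x y. x \<in> carrier M \<Longrightarrow> y \<in> carrier M \<Longrightarrow> f (x \<otimes>\<^bsub>M\<^esub> y) = f x \<otimes>\<^bsub>N\<^esub> f y"
    "\<And>s x. s \<in> carrier S \<Longrightarrow> x \<in> carrier M \<Longrightarrow> f (act M s x) = act N s (f x)"
  using assms unfolding s_algebra_epi_def module_hom_def by blast+

lemma s_algebra_epiI:
  assumes "f ` carrier M = carrier N" "f \<zero>\<^bsub>M\<^esub> = \<zero>\<^bsub>N\<^esub>"
    "\<And>x y. x \<in> carrier M \<Longrightarrow> y \<in> carrier M \<Longrightarrow> f (x \<oplus>\<^bsub>M\<^esub> y) = f x \<oplus>\<^bsub>N\<^esub> f y"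
    "\<And>c x. c \<in> carrier K \<Longrightarrow> x \<in> carrier M \<Longrightarrow> f (c \<odot>\<^bsub>M\<^esub> x) = c \<odot>\<^bsub>N\<^esub> f x"
    "\<And>x y. x \<in> carrier M \<Longrightarrow> y \<in> carrier M \<Longrightarrow> f (x \<otimes>\<^bsub>M\<^esub> y) = f x \<otimes>\<^bsub>N\<^esub> f y"
    "\<And>s x. s \<in> carrier S \<Longrightarrow> x \<in> carrier M \<Longrightarrow> f (act M s x) = act N s (f x)"
  shows "f \<in> s_algebra_epi K S M N"
  using assms unfolding s_algebra_epi_def module_hom_def by auto

lemma vectorspace_image:
  assumes M: "vectorspace K M"
    and surj: "f ` carrier M = carrier N" and zero: "f \<zero>\<^bsub>M\<^esub> = \<zero>\<^bsub>N\<^esub>"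
    and add: "\<And>x y. x \<in> carrier M \<Longrightarrow> y \<in> carrier M \<Longrightarrow> f (x \<oplus>\<^bsub>M\<^esub> y) = f x \<oplus>\<^bsub>N\<^esub> f y"
    and smult: "\<And>c x. c \<in> carrier K \<Longrightarrow> x \<in> carrier M \<Longrightarrow> f (c \<odot>\<^bsub>M\<^esub> x) = c \<odot>\<^bsub>N\<^esub> f x"
  shows "vectorspace K N"
proof -
  interpret M: vectorspace K M by fact
  show ?thesis
  proof (rule vs_criteria[OF M.field_axioms], unfold surj[symmetric] zero[symmetric])
    show "\<forall>v\<in>f ` carrier M. \<exists>w\<in>f ` carrier M. v \<oplus>\<^bsub>N\<^esub> w = f \<zero>\<^bsub>M\<^esub>"
    proof
      fix v assume "v \<in> f ` carrier M"
      then obtain a where a: "a \<in> carrier M" "v = f a" by blast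
      then have "v \<oplus>\<^bsub>N\<^esub> f (\<ominus>\<^bsub>M\<^esub> a) = f \<zero>\<^bsub>M\<^esub>" by (simp add: add[symmetric] M.M.r_neg)
      then show "\<exists>w\<in>f ` carrier M. v \<oplus>\<^bsub>N\<^esub> w = f \<zero>\<^bsub>M\<^esub>" using a(1) by blast
    qed
  qed (auto simp: add[symmetric] smult[symmetric] M.M.a_ac M.smult_l_distr M.smult_r_distr M.smult_assoc1)
qed

lemma subspace_vimage:
  assumes M: "vectorspace K M" and f: "f \<in> module_hom K M N" "f \<zero>\<^bsub>M\<^esub> = \<zero>\<^bsub>N\<^esub>" and W: "subspace K W N"
  shows "subspace K {x \<in> carrier M. f x \<in> W} M"
proof -
  interpret M: vectorspace K M by fact
  show ?thesis
    using subspaceD(2-)[OF W] f by (intro subspaceI[OF M]) (auto simp: module_hom_def)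
qed

lemma subspace_image:
  assumes M: "vectorspace K M" and N: "vectorspace K N" and f: "f \<in> module_hom K M N" "f \<zero>\<^bsub>M\<^esub> = \<zero>\<^bsub>N\<^esub>"
    and W: "subspace K W M"
  shows "subspace K (f ` W) N"
proof (rule subspaceI[OF N])
  note WD = subspaceD[OF W]
  show "f ` W \<subseteq> carrier N" using f(1) WD(1) by (auto simp: module_hom_def)
  show "\<zero>\<^bsub>N\<^esub> \<in> f ` W" using f(2) WD(2) by force
  fix x y assume "x \<in> f ` W" "y \<in> f ` W"
  then obtain a b where ab: "a \<in> W" "b \<in> W" "x = f a" "y = f b" by blast
  then have "x \<oplus>\<^bsub>N\<^esub> y = f (a \<oplus>\<^bsub>M\<^esub> b)" using f(1) WD(1) by (auto simp: module_hom_def subset_iff)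
  then show "x \<oplus>\<^bsub>N\<^esub> y \<in> f ` W" using WD(3) ab by blast
next
  note WD = subspaceD[OF W]
  fix c x assume c: "c \<in> carrier K" and "x \<in> f ` W"
  then obtain a where a: "a \<in> W" "x = f a" by blast
  then have "c \<odot>\<^bsub>N\<^esub> x = f (c \<odot>\<^bsub>M\<^esub> a)" using f(1) WD(1) c by (auto simp: module_hom_def subset_iff)
  then show "c \<odot>\<^bsub>N\<^esub> x \<in> f ` W" using WD(4) a c by blast
qed

lemma s_algebra_epi_hom: "f \<in> s_algebra_epi K S M N \<Longrightarrow> f \<in> module_hom K M N"
  by (simp add: s_algebra_epi_def)

text \<open>
  All axioms except complete reducibility are identities, which are inherited by images. For a
  submodule \<open>W\<close> of the target, the image of a complement of the preimage of \<open>W\<close> is a complement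
  of \<open>W\<close>: it meets \<open>W\<close> trivially because an element mapped into \<open>W\<close> lies in the preimage.
\<close>

lemma lie_s_algebra_epi_image:
  assumes M: "lie_s_algebra K S M" and f: "f \<in> s_algebra_epi K S M N"
  shows "lie_s_algebra K S N"
proof -
  interpret M: lie_s_algebra K S M by fact
  note fD = s_algebra_epiD[OF f] and fh = s_algebra_epi_hom[OF f]
  have N: "vectorspace K N" by (rule vectorspace_image[OF M.vectorspace_axioms fD(1,2,4,5)])
  interpret N: vectorspace K N by (rule N)
  have f_mod_hom: "mod_hom K M N f"
    by (intro mod_hom.intro M.module_axioms N.module_axioms mod_hom_axioms.intro fh)
  have carr: "\<exists>a\<in>carrier M. x = f a" if "x \<in> carrier N" for x using that fD(1) by blast
  have fin: N.fin_dim
  proof -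
    obtain A where A: "finite A" "A \<subseteq> carrier M"
      "\<forall>W. subspace K W M \<and> A \<subseteq> W \<longrightarrow> carrier M \<subseteq> W"
      using M.finite_dimensional unfolding M.fin_dim_iff_subspaces by (elim exE conjE)
    have "carrier N \<subseteq> W" if W: "subspace K W N" "f ` A \<subseteq> W" for W
    proof -
      have "carrier M \<subseteq> {x \<in> carrier M. f x \<in> W}"
        using A(3) subspace_vimage[OF M.vectorspace_axioms fh fD(2) W(1)] A(2) W(2) by blast
      then show ?thesis unfolding fD(1)[symmetric] by blast
    qed
    then show ?thesis
      unfolding N.fin_dim_iff_subspaces using A(1,2) fD(3) by (intro exI[of _ "f ` A"]) auto
  qed
  have cr: "completely_reducible K S N"
    unfolding completely_reducible_def
  proof (intro allI impI)
    fix W assume W: "s_submodule K S W N"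
    let ?W = "{x \<in> carrier M. f x \<in> W}"
    note WD = s_submoduleD[OF W]
    have "s_submodule K S ?W M"
      unfolding s_submodule_def
      using subspace_vimage[OF M.vectorspace_axioms fh fD(2) WD(1)] WD(2) by (auto simp: M.act_closed fD(7))
    then obtain C where C: "s_submodule K S C M" "?W \<inter> C = {\<zero>\<^bsub>M\<^esub>}" "?W <+>\<^bsub>M\<^esub> C = carrier M"
      using M.completely_reducible unfolding completely_reducible_def by blast
    note CD = s_submoduleD[OF C(1)]
    have CM: "C \<subseteq> carrier M" using subspaceD(1)[OF CD(1)] .
    have fC: "s_submodule K S (f ` C) N"
      unfolding s_submodule_def
    proof (intro conjI ballI)
      show "subspace K (f ` C) N" by (rule subspace_image[OF M.vectorspace_axioms N fh fD(2) CD(1)])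
      fix s w assume s: "s \<in> carrier S" and "w \<in> f ` C"
      then obtain c where "c \<in> C" "w = f c" by blast
      then show "act N s w \<in> f ` C" using fD(7)[OF s, of c] CD(2)[OF s, of c] CM by force
    qed
    moreover have "W \<inter> f ` C \<subseteq> {\<zero>\<^bsub>N\<^esub>}"
    proof
      fix w assume "w \<in> W \<inter> f ` C"
      then obtain c where c: "c \<in> C" "w = f c" "f c \<in> W" by blast
      then have "c \<in> ?W \<inter> C" using CM by blast
      then have "c = \<zero>\<^bsub>M\<^esub>" unfolding C(2) by simp
      then show "w \<in> {\<zero>\<^bsub>N\<^esub>}" using c(2) fD(2) by simp
    qed
    then have "W \<inter> f ` C = {\<zero>\<^bsub>N\<^esub>}"
      using subspaceD(2)[OF WD(1)] subspaceD(2)[OF s_submoduleD(1)[OF fC]] by blast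
    moreover have "carrier N \<subseteq> W <+>\<^bsub>N\<^esub> f ` C"
    proof
      fix x assume "x \<in> carrier N"
      then obtain a where a: "a \<in> carrier M" "x = f a" using carr by blast
      then have "a \<in> ?W <+>\<^bsub>M\<^esub> C" using C(3) by simp
      then obtain u c where u: "u \<in> ?W" "c \<in> C" "a = u \<oplus>\<^bsub>M\<^esub> c" by (rule set_addE)
      then have "x = f u \<oplus>\<^bsub>N\<^esub> f c" using a(2) CM fD(4) by auto
      moreover have "f u \<in> W" "f c \<in> f ` C" using u by auto
      ultimately show "x \<in> W <+>\<^bsub>N\<^esub> f ` C" using set_addI[of "f u" W "f c" "f ` C" N] by simp
    qed
    then have "W <+>\<^bsub>N\<^esub> f ` C = carrier N"
      using subspaceD(1)[OF N.subspace_set_add[OF WD(1) s_submoduleD(1)[OF fC]]] by blast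
    ultimately show "\<exists>W'. s_submodule K S W' N \<and> W \<inter> W' = {\<zero>\<^bsub>N\<^esub>} \<and> W <+>\<^bsub>N\<^esub> W' = carrier N"
      by blast
  qed
  note rules = fD(4-7)[symmetric] mod_hom.f_minus[OF f_mod_hom, symmetric] fD(2)[symmetric] M.act_closed M.bracket_closed M.S.bracket_closed
    M.act_add_right M.act_smult_right M.act_add_left M.act_smult_left M.act_bracket
    M.bracket_add_left M.bracket_add_right M.bracket_smult_left M.bracket_smult_right
    M.bracket_self M.jacobi M.act_derivation fD(3)
  have "s_module_axioms K S N"
    by standard (use fin in \<open>auto dest!: carr simp: rules\<close>)
  moreover have "lie_algebra_axioms K N"
    by standard (use fin in \<open>auto dest!: carr simp: rules\<close>)
  moreover have "lie_s_algebra_axioms K S N"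
    by standard (use cr in \<open>auto dest!: carr simp: rules\<close>)
  ultimately show ?thesis
    by (intro lie_s_algebra.intro s_module.intro lie_algebra.intro N M.S.lie_algebra_axioms)
qed

lemma almost_minimal_epi_image:
  assumes M: "almost_minimal_s_algebra K S M" and f: "f \<in> s_algebra_epi K S M N"
  shows "almost_minimal_s_algebra K S N"
proof -
  interpret M: lie_s_algebra K S M using M by (simp add: almost_minimal_s_algebra_def)
  interpret N: lie_s_algebra K S N by (rule lie_s_algebra_epi_image[OF M.lie_s_algebra_axioms f])
  note fD = s_algebra_epiD[OF f]
  have carr: "\<exists>a\<in>carrier M. x = f a" if "x \<in> carrier N" for x using that fD(1) by blast
  note am = M[unfolded M.almost_minimal_iff]
  have "carrier N \<subseteq> H"
    if H: "lie_subalgebra K H N" "\<forall>s\<in>carrier S. \<forall>x\<in>carrier N. act N s x \<in> H" for H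
  proof -
    let ?H = "{x \<in> carrier M. f x \<in> H}"
    have "lie_subalgebra K ?H M"
      using subspace_vimage[OF M.vectorspace_axioms s_algebra_epi_hom[OF f] fD(2) lie_subalgebraD(1)[OF H(1)]]
        lie_subalgebraD(2)[OF H(1)]
      by (intro lie_subalgebraI) (auto simp: M.bracket_closed fD(6))
    moreover have "\<forall>s\<in>carrier S. \<forall>x\<in>carrier M. act M s x \<in> ?H"
      using H(2) by (auto simp: M.act_closed fD(3,7))
    ultimately have "carrier M \<subseteq> ?H" using am by blast
    then show ?thesis unfolding fD(1)[symmetric] by blast
  qed
  then show ?thesis
    unfolding N.almost_minimal_iff using am
    by (auto dest!: carr simp: fD(6,7)[symmetric] fD(2)[symmetric] M.bracket_closed)
qed

text \<open>
  The isomorphism sends \<open>p x\<close> to \<open>q x\<close>.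
\<close>

lemma isomorphic_if_same_kernel:
  assumes H: "lie_s_algebra K S H"
    and p: "p \<in> s_algebra_epi K S H M" and q: "q \<in> s_algebra_epi K S H N"
    and ker: "\<And>x y. x \<in> carrier H \<Longrightarrow> y \<in> carrier H \<Longrightarrow> p x = p y \<longleftrightarrow> q x = q y"
  shows "s_algebra_isomorphic K S M N"
proof -
  interpret H: lie_s_algebra K S H by fact
  note pD = s_algebra_epiD[OF p] and qD = s_algebra_epiD[OF q]
  define f where "f m = q (inv_into (carrier H) p m)" for m
  have fp: "f (p x) = q x" if "x \<in> carrier H" for x
    unfolding f_def using ker[OF inv_into_into[of "p x" p "carrier H"] that]
      f_inv_into_f[of "p x" p "carrier H"] that by simp
  have carr: "\<exists>a\<in>carrier H. x = p a" if "x \<in> carrier M" for x using that pD(1) by blast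
  have "f ` carrier M = carrier N"
    unfolding pD(1)[symmetric] qD(1)[symmetric] image_image using fp by (simp cong: image_cong)
  moreover have "inj_on f (carrier M)"
    by (rule inj_onI) (auto dest!: carr simp: fp ker)
  moreover have "f \<in> module_hom K M N"
    unfolding module_hom_def
    by (auto dest!: carr simp: fp pD(4,5)[symmetric] qD)
  moreover have "f (x \<otimes>\<^bsub>M\<^esub> y) = f x \<otimes>\<^bsub>N\<^esub> f y" if "x \<in> carrier M" "y \<in> carrier M" for x y
    using that by (auto dest!: carr simp: fp pD(6)[symmetric] qD H.bracket_closed)
  moreover have "f (act M s x) = act N s (f x)" if "s \<in> carrier S" "x \<in> carrier M" for s x
    using that by (auto dest!: carr simp: fp pD(7)[symmetric] qD H.act_closed)
  ultimately have "f \<in> s_algebra_iso K S M N"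
    unfolding s_algebra_iso_def bij_betw_def by blast
  then show ?thesis unfolding s_algebra_isomorphic_def by blast
qed

lemma iso_inverse_epi:
  assumes M: "lie_s_algebra K S M" and f: "f \<in> s_algebra_iso K S M N"
    and zero: "f \<zero>\<^bsub>M\<^esub> = \<zero>\<^bsub>N\<^esub>"
  shows "inv_into (carrier M) f \<in> s_algebra_epi K S N M"
proof -
  interpret M: lie_s_algebra K S M by fact
  have bij: "inj_on f (carrier M)" "f ` carrier M = carrier N"
    using f by (auto simp: s_algebra_iso_def bij_betw_def)
  have inv: "inv_into (carrier M) f (f x) = x" if "x \<in> carrier M" for x
    by (rule inv_into_f_f[OF bij(1) that])
  have carr: "\<exists>a\<in>carrier M. x = f a" if "x \<in> carrier N" for x using that bij(2) by blast
  have fD: "f x \<oplus>\<^bsub>N\<^esub> f y = f (x \<oplus>\<^bsub>M\<^esub> y)" "f x \<otimes>\<^bsub>N\<^esub> f y = f (x \<otimes>\<^bsub>M\<^esub> y)"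
    "c \<in> carrier K \<Longrightarrow> c \<odot>\<^bsub>N\<^esub> f x = f (c \<odot>\<^bsub>M\<^esub> x)" "s \<in> carrier S \<Longrightarrow> act N s (f x) = f (act M s x)"
    if "x \<in> carrier M" "y \<in> carrier M" for x y c s
    using f that unfolding s_algebra_iso_def module_hom_def by auto
  show ?thesis
  proof (rule s_algebra_epiI)
    show "inv_into (carrier M) f ` carrier N = carrier M"
      unfolding bij(2)[symmetric] image_image using inv by (simp cong: image_cong)
    show "inv_into (carrier M) f \<zero>\<^bsub>N\<^esub> = \<zero>\<^bsub>M\<^esub>" unfolding zero[symmetric] by (rule inv) simp
  qed (auto dest!: carr simp: inv fD M.bracket_closed M.act_closed)
qed

lemma epi_comp:
  assumes "f \<in> s_algebra_epi K S L M" "g \<in> s_algebra_epi K S M N"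
  shows "(\<lambda>x. g (f x)) \<in> s_algebra_epi K S L N"
proof (rule s_algebra_epiI)
  show "(\<lambda>x. g (f x)) ` carrier L = carrier N"
    using s_algebra_epiD(1)[OF assms(1)] s_algebra_epiD(1)[OF assms(2)] by (simp add: image_image[symmetric])
qed (simp_all add: s_algebra_epiD[OF assms(1)] s_algebra_epiD[OF assms(2)])

context lie_s_algebra
begin

lemma quotient_coset_eq_iff:
  assumes I: "subspace K I N" and "x \<in> carrier N" "y \<in> carrier N"
  shows "I +> x = I +> y \<longleftrightarrow> x \<ominus> y \<in> I"
proof
  note ID = subspaceD[OF I]
  assume "I +> x = I +> y"
  moreover have "\<zero> \<oplus> x \<in> I +> x" using ID(2) by (auto simp: a_r_coset_def')
  ultimately obtain i where "i \<in> I" "\<zero> \<oplus> x = i \<oplus> y" by (auto simp: a_r_coset_def')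
  then have "x \<ominus> y = i" using assms(2,3) ID(1) by (simp add: add_minus_cancel subset_iff)
  then show "x \<ominus> y \<in> I" using \<open>i \<in> I\<close> by simp
next
  note ID = subspaceD[OF I]
  have sub: "I +> x \<subseteq> I +> y" if "x \<ominus> y \<in> I" "x \<in> carrier N" "y \<in> carrier N" for x y
  proof
    fix z assume "z \<in> I +> x"
    then obtain i where i: "i \<in> I" "z = i \<oplus> x" by (auto simp: a_r_coset_def')
    then have "z = (i \<oplus> (x \<ominus> y)) \<oplus> y"
      using that ID(1) by (simp add: M.a_assoc minus_add_cancel subset_iff)
    then show "z \<in> I +> y" using ID(3)[OF i(1) that(1)] by (auto simp: a_r_coset_def')
  qed
  assume "x \<ominus> y \<in> I"
  moreover from this have "y \<ominus> x \<in> I"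
    using subspace_uminus[OF I, of "x \<ominus> y"] assms(2,3) by (simp add: a_minus_def M.minus_add M.a_comm)
  ultimately show "I +> x = I +> y" using sub assms(2,3) by blast
qed

text \<open>
  The operations of the quotient are unions over representatives; for an ideal stable under the
  action all cosets in such a union coincide, so the unions are the cosets one expects.
\<close>

lemma quotient_epi:
  assumes I: "subspace K I N"
    and ideal: "\<And>x i. x \<in> carrier N \<Longrightarrow> i \<in> I \<Longrightarrow> x \<otimes> i \<in> I" "\<And>x i. x \<in> carrier N \<Longrightarrow> i \<in> I \<Longrightarrow> i \<otimes> x \<in> I"
    and stable: "\<And>s i. s \<in> carrier S \<Longrightarrow> i \<in> I \<Longrightarrow> act N s i \<in> I"
  shows "(\<lambda>x. I +> x) \<in> s_algebra_epi K S N (s_quotient N I)"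
proof (rule s_algebra_epiI)
  note ID = subspaceD[OF I]
  note eq = quotient_coset_eq_iff[OF I]
  have coset: "(\<Union>i\<in>I. F (i \<oplus> x)) = F x"
    if "x \<in> carrier N" "\<And>i. i \<in> I \<Longrightarrow> F (i \<oplus> x) = F x" for x and F :: "'a \<Rightarrow> 'a set"
    using that ID(2) by auto
  have coset_mem: "I +> x = {i \<oplus> x | i. i \<in> I}" for x by (auto simp: a_r_coset_def')
  have UN: "(\<Union>a\<in>I +> x. F a) = (\<Union>i\<in>I. F (i \<oplus> x))" for x and F :: "'a \<Rightarrow> 'a set"
    unfolding coset_mem by auto
  have absorb: "I +> (i \<oplus> x) = I +> x" if "i \<in> I" "x \<in> carrier N" for i x
    using that ID(1) by (subst eq) (auto simp: add_minus_cancel)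
  show "(\<lambda>x. I +> x) ` carrier N = carrier (s_quotient N I)"
    by (auto simp: s_quotient_def A_RCOSETS_def')
  show "I +> \<zero> = \<zero>\<^bsub>s_quotient N I\<^esub>"
    using ID(1) by (simp add: s_quotient_def)
  show "I +> (x \<oplus> y) = (I +> x) \<oplus>\<^bsub>s_quotient N I\<^esub> (I +> y)"
    if x: "x \<in> carrier N" and y: "y \<in> carrier N" for x y
  proof -
    have "(I +> x) <+>\<^bsub>N\<^esub> (I +> y) = I +> (x \<oplus> y)"
    proof (intro equalityI subsetI)
      fix z assume "z \<in> (I +> x) <+>\<^bsub>N\<^esub> (I +> y)"
      then obtain i j where ij: "i \<in> I" "j \<in> I" "z = (i \<oplus> x) \<oplus> (j \<oplus> y)"
        unfolding set_add_def' coset_mem by auto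
      then have "z = (i \<oplus> j) \<oplus> (x \<oplus> y)" using x y ID(1) by (simp add: M.a_ac subset_iff)
      then show "z \<in> I +> (x \<oplus> y)" unfolding coset_mem using ID(3)[OF ij(1,2)] by blast
    next
      fix z assume "z \<in> I +> (x \<oplus> y)"
      then obtain i where i: "i \<in> I" "z = i \<oplus> (x \<oplus> y)" unfolding coset_mem by blast
      then have z: "z = (i \<oplus> x) \<oplus> (\<zero> \<oplus> y)" using x y ID(1) by (simp add: M.a_assoc subset_iff)
      have "i \<oplus> x \<in> I +> x" "\<zero> \<oplus> y \<in> I +> y" unfolding coset_mem using i(1) ID(2) by blast+
      then show "z \<in> (I +> x) <+>\<^bsub>N\<^esub> (I +> y)" unfolding z by (rule set_addI)
    qed
    then show ?thesis by (simp add: s_quotient_def)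
  qed
  show "I +> (c \<odot> x) = c \<odot>\<^bsub>s_quotient N I\<^esub> (I +> x)"
    if c: "c \<in> carrier K" and x: "x \<in> carrier N" for c x
  proof -
    have "I +> (c \<odot> (i \<oplus> x)) = I +> (c \<odot> x)" if "i \<in> I" for i
      using that c x ID(1,4) by (simp add: smult_r_distr absorb subset_iff)
    then have "(\<Union>a\<in>I +> x. I +> (c \<odot> a)) = I +> (c \<odot> x)"
      unfolding UN by (intro coset x)
    then show ?thesis by (simp add: s_quotient_def)
  qed
  show "I +> act N s x = act (s_quotient N I) s (I +> x)"
    if s: "s \<in> carrier S" and x: "x \<in> carrier N" for s x
  proof -
    have "I +> act N s (i \<oplus> x) = I +> act N s x" if "i \<in> I" for i
      using that s x ID(1) stable by (simp add: act_add_right absorb act_closed subset_iff)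
    then have "(\<Union>a\<in>I +> x. I +> act N s a) = I +> act N s x"
      unfolding UN by (intro coset x)
    then show ?thesis by (simp add: s_quotient_def)
  qed
  show "I +> (x \<otimes> y) = (I +> x) \<otimes>\<^bsub>s_quotient N I\<^esub> (I +> y)"
    if x: "x \<in> carrier N" and y: "y \<in> carrier N" for x y
  proof -
    have "I +> ((i \<oplus> x) \<otimes> (j \<oplus> y)) = I +> (x \<otimes> y)" if ij: "i \<in> I" "j \<in> I" for i j
    proof -
      have carr: "i \<in> carrier N" "j \<in> carrier N" using ij ID(1) by auto
      have "(i \<oplus> x) \<otimes> (j \<oplus> y) = (i \<otimes> (j \<oplus> y) \<oplus> x \<otimes> j) \<oplus> x \<otimes> y"
        using carr x y by (simp add: bracket_add_left bracket_add_right bracket_closed M.a_ac)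
      moreover have "i \<otimes> (j \<oplus> y) \<oplus> x \<otimes> j \<in> I"
        using carr x y ij by (intro ID(3) ideal) auto
      ultimately show ?thesis using absorb x y by (simp add: bracket_closed)
    qed
    then have "(\<Union>a\<in>I +> x. \<Union>b\<in>I +> y. I +> (a \<otimes> b)) = I +> (x \<otimes> y)"
      unfolding UN using ID(2) by auto
    then show ?thesis by (simp add: s_quotient_def rcoset_mult_def)
  qed
qed

end

section \<open>The algebras h(V)\<close>

lemma h_algebra_simps:
  "carrier (h_algebra K S V) = carrier V \<times> carrier (alt_dual K S V)"
  "\<zero>\<^bsub>h_algebra K S V\<^esub> = (\<zero>\<^bsub>V\<^esub>, \<zero>\<^bsub>alt_dual K S V\<^esub>)"
  "p \<oplus>\<^bsub>h_algebra K S V\<^esub> q = (fst p \<oplus>\<^bsub>V\<^esub> fst q, snd p \<oplus>\<^bsub>alt_dual K S V\<^esub> snd q)"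
  "c \<odot>\<^bsub>h_algebra K S V\<^esub> p = (c \<odot>\<^bsub>V\<^esub> fst p, c \<odot>\<^bsub>alt_dual K S V\<^esub> snd p)"
  "p \<otimes>\<^bsub>h_algebra K S V\<^esub> q = (\<zero>\<^bsub>V\<^esub>, alt_eval K S V (fst p) (fst q))"
  "act (h_algebra K S V) s p = (act V s (fst p), \<zero>\<^bsub>alt_dual K S V\<^esub>)"
  by (simp_all add: h_algebra_def alt_eval_def)

context s_module
begin

lemma alt_eval_zero:
  assumes "x \<in> carrier V"
  shows "alt_eval K S V x \<zero> = \<zero>\<^bsub>alt_dual K S V\<^esub>" "alt_eval K S V \<zero> x = \<zero>\<^bsub>alt_dual K S V\<^esub>"
proof -
  interpret D: vectorspace K "alt_dual K S V" by (rule alt_dual_vectorspace)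
  show "alt_eval K S V x \<zero> = \<zero>\<^bsub>alt_dual K S V\<^esub>" "alt_eval K S V \<zero> x = \<zero>\<^bsub>alt_dual K S V\<^esub>"
    using alt_eval_smult[of "\<zero>\<^bsub>K\<^esub>" x \<zero>] alt_eval_smult[of "\<zero>\<^bsub>K\<^esub>" \<zero> x]
      alt_eval_closed[of x \<zero>] alt_eval_closed[of \<zero> x] assms by simp_all
qed

lemma alt_dual_fin_dim: "vectorspace.fin_dim K (alt_dual K S V)"
proof -
  interpret D: vectorspace K "alt_dual K S V" by (rule alt_dual_vectorspace)
  obtain F where F: "finite F" "F \<subseteq> {alt_eval K S V x y | x y. x \<in> carrier V \<and> y \<in> carrier V}"
    "\<forall>W. subspace K W (alt_dual K S V) \<and> F \<subseteq> W \<longrightarrow> carrier (alt_dual K S V) \<subseteq> W"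
    using alt_dual_finitely_generated by (elim exE conjE)
  have "F \<subseteq> carrier (alt_dual K S V)" using F(2) by (auto simp: alt_eval_closed)
  then show ?thesis unfolding D.fin_dim_iff_subspaces using F(1,3) by blast
qed

lemma h_vectorspace: "vectorspace K (h_algebra K S V)"
proof -
  interpret D: vectorspace K "alt_dual K S V" by (rule alt_dual_vectorspace)
  show ?thesis
  proof (rule vs_criteria[OF S.field_axioms])
    show "\<forall>v\<in>carrier (h_algebra K S V). \<exists>w\<in>carrier (h_algebra K S V).
        v \<oplus>\<^bsub>h_algebra K S V\<^esub> w = \<zero>\<^bsub>h_algebra K S V\<^esub>"
    proof
      fix v assume "v \<in> carrier (h_algebra K S V)"
      then show "\<exists>w\<in>carrier (h_algebra K S V). v \<oplus>\<^bsub>h_algebra K S V\<^esub> w = \<zero>\<^bsub>h_algebra K S V\<^esub>"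
        by (intro bexI[of _ "(\<ominus> fst v, \<ominus>\<^bsub>alt_dual K S V\<^esub> snd v)"])
          (auto simp: h_algebra_simps M.r_neg D.M.r_neg)
    qed
  qed (auto simp: h_algebra_simps M.a_ac D.M.a_ac smult_l_distr D.smult_l_distr
      smult_r_distr D.smult_r_distr smult_assoc1 D.smult_assoc1)
qed

lemma h_subspace_parts:
  assumes "subspace K W (h_algebra K S V)"
  shows "subspace K {x \<in> carrier V. (x, \<zero>\<^bsub>alt_dual K S V\<^esub>) \<in> W} V"
    "subspace K {z \<in> carrier (alt_dual K S V). (\<zero>, z) \<in> W} (alt_dual K S V)"
proof -
  interpret D: vectorspace K "alt_dual K S V" by (rule alt_dual_vectorspace)
  note W = subspaceD[OF assms, unfolded h_algebra_simps]
  show "subspace K {x \<in> carrier V. (x, \<zero>\<^bsub>alt_dual K S V\<^esub>) \<in> W} V"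
  proof (rule subspaceI[OF vectorspace_axioms])
    fix x y assume "x \<in> {x \<in> carrier V. (x, \<zero>\<^bsub>alt_dual K S V\<^esub>) \<in> W}"
      "y \<in> {x \<in> carrier V. (x, \<zero>\<^bsub>alt_dual K S V\<^esub>) \<in> W}"
    then show "x \<oplus> y \<in> {x \<in> carrier V. (x, \<zero>\<^bsub>alt_dual K S V\<^esub>) \<in> W}"
      using W(3)[of "(x, \<zero>\<^bsub>alt_dual K S V\<^esub>)" "(y, \<zero>\<^bsub>alt_dual K S V\<^esub>)"] by simp
  next
    fix c x assume "c \<in> carrier K" "x \<in> {x \<in> carrier V. (x, \<zero>\<^bsub>alt_dual K S V\<^esub>) \<in> W}"
    then show "c \<odot> x \<in> {x \<in> carrier V. (x, \<zero>\<^bsub>alt_dual K S V\<^esub>) \<in> W}"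
      using W(4)[of c "(x, \<zero>\<^bsub>alt_dual K S V\<^esub>)"] by simp
  qed (use W(2) in auto)
  show "subspace K {z \<in> carrier (alt_dual K S V). (\<zero>, z) \<in> W} (alt_dual K S V)"
  proof (rule subspaceI[OF D.vectorspace_axioms])
    fix x y assume "x \<in> {z \<in> carrier (alt_dual K S V). (\<zero>, z) \<in> W}"
      "y \<in> {z \<in> carrier (alt_dual K S V). (\<zero>, z) \<in> W}"
    then show "x \<oplus>\<^bsub>alt_dual K S V\<^esub> y \<in> {z \<in> carrier (alt_dual K S V). (\<zero>, z) \<in> W}"
      using W(3)[of "(\<zero>, x)" "(\<zero>, y)"] by simp
  next
    fix c x assume "c \<in> carrier K" "x \<in> {z \<in> carrier (alt_dual K S V). (\<zero>, z) \<in> W}"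
    then show "c \<odot>\<^bsub>alt_dual K S V\<^esub> x \<in> {z \<in> carrier (alt_dual K S V). (\<zero>, z) \<in> W}"
      using W(4)[of c "(\<zero>, x)"] by simp
  qed (use W(2) in auto)
qed

lemma h_subspace_combine:
  assumes "subspace K W (h_algebra K S V)" "(x, \<zero>\<^bsub>alt_dual K S V\<^esub>) \<in> W" "(\<zero>, z) \<in> W"
    "x \<in> carrier V" "z \<in> carrier (alt_dual K S V)"
  shows "(x, z) \<in> W"
proof -
  interpret D: vectorspace K "alt_dual K S V" by (rule alt_dual_vectorspace)
  show ?thesis using subspaceD(3)[OF assms(1-3)] assms(4,5) by (simp add: h_algebra_simps)
qed

lemma h_fin_dim: "vectorspace.fin_dim K (h_algebra K S V)"
proof -
  interpret D: vectorspace K "alt_dual K S V" by (rule alt_dual_vectorspace)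
  interpret H: vectorspace K "h_algebra K S V" by (rule h_vectorspace)
  obtain A where A: "finite A" "A \<subseteq> carrier V" "\<forall>W. subspace K W V \<and> A \<subseteq> W \<longrightarrow> carrier V \<subseteq> W"
    using finite_dimensional unfolding fin_dim_iff_subspaces by (elim exE conjE)
  obtain F where F: "finite F" "F \<subseteq> carrier (alt_dual K S V)"
    "\<forall>W. subspace K W (alt_dual K S V) \<and> F \<subseteq> W \<longrightarrow> carrier (alt_dual K S V) \<subseteq> W"
    using alt_dual_fin_dim unfolding D.fin_dim_iff_subspaces by (elim exE conjE)
  let ?G = "A \<times> {\<zero>\<^bsub>alt_dual K S V\<^esub>} \<union> {\<zero>} \<times> F"
  have "carrier (h_algebra K S V) \<subseteq> W" if W: "subspace K W (h_algebra K S V)" "?G \<subseteq> W" for W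
  proof -
    have "carrier V \<subseteq> {x \<in> carrier V. (x, \<zero>\<^bsub>alt_dual K S V\<^esub>) \<in> W}"
      by (intro A(3)[rule_format] conjI h_subspace_parts[OF W(1)]) (use W(2) A(2) in auto)
    moreover have "carrier (alt_dual K S V) \<subseteq> {z \<in> carrier (alt_dual K S V). (\<zero>, z) \<in> W}"
      by (intro F(3)[rule_format] conjI h_subspace_parts[OF W(1)]) (use W(2) F(2) in auto)
    ultimately show ?thesis
      using h_subspace_combine[OF W(1)] by (auto simp: h_algebra_simps)
  qed
  moreover have "finite ?G" "?G \<subseteq> carrier (h_algebra K S V)"
    using A(1,2) F(1,2) by (auto simp: h_algebra_simps)
  ultimately show ?thesis unfolding H.fin_dim_iff_subspaces by blast
qed

lemma h_minus:
  assumes "p \<in> carrier (h_algebra K S V)" "q \<in> carrier (h_algebra K S V)"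
  shows "p \<ominus>\<^bsub>h_algebra K S V\<^esub> q = (fst p \<ominus> fst q, snd p \<ominus>\<^bsub>alt_dual K S V\<^esub> snd q)"
proof -
  interpret D: vectorspace K "alt_dual K S V" by (rule alt_dual_vectorspace)
  interpret H: vectorspace K "h_algebra K S V" by (rule h_vectorspace)
  let ?r = "(fst p \<ominus> fst q, snd p \<ominus>\<^bsub>alt_dual K S V\<^esub> snd q)"
  have r: "?r \<in> carrier (h_algebra K S V)" "?r \<oplus>\<^bsub>h_algebra K S V\<^esub> q = p"
    using assms by (auto simp: h_algebra_simps minus_add_cancel D.minus_add_cancel)
  show ?thesis using H.add_minus_cancel[OF r(1) assms(2)] unfolding r(2) .
qed

text \<open>
  Although \<open>h(V)\<close> is \<open>V\<close> plus a trivial module, a general submodule \<open>W\<close> is the product of its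
  intersections with both summands because \<open>V\<close> is full: choose a complement \<open>C\<close> of the part of \<open>W\<close>
  in \<open>V\<close>; the component in \<open>C\<close> of an element of \<open>W\<close> is moved by \<open>S\<close> into \<open>W\<close> and into \<open>C\<close>, hence is
  invariant, hence zero. Then complements can be chosen separately in the two summands.
\<close>

lemma h_completely_reducible:
  assumes full: "full_module K S V"
  shows "completely_reducible K S (h_algebra K S V)"
  unfolding completely_reducible_def
proof (intro allI impI)
  interpret D: vectorspace K "alt_dual K S V" by (rule alt_dual_vectorspace)
  interpret H: vectorspace K "h_algebra K S V" by (rule h_vectorspace)
  let ?H = "h_algebra K S V" and ?D = "alt_dual K S V"
  fix W assume W: "s_submodule K S W ?H"
  note Ws = s_submoduleD(1)[OF W] and Wact = s_submoduleD(2)[OF W]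
  note WD = subspaceD[OF Ws]
  let ?U = "{x \<in> carrier V. (x, \<zero>\<^bsub>?D\<^esub>) \<in> W}" and ?T = "{z \<in> carrier ?D. (\<zero>, z) \<in> W}"
  note parts = h_subspace_parts[OF Ws]
  have "s_submodule K S ?U V"
    unfolding s_submodule_def
  proof (intro conjI ballI parts(1))
    fix s x assume "s \<in> carrier S" "x \<in> ?U"
    then show "act V s x \<in> ?U" using Wact[of s "(x, \<zero>\<^bsub>?D\<^esub>)"] by (simp add: h_algebra_simps act_closed)
  qed
  then obtain C where C: "s_submodule K S C V" "?U \<inter> C = {\<zero>}" "?U <+>\<^bsub>V\<^esub> C = carrier V"
    using full unfolding full_module_def completely_reducible_def by blast
  obtain E where E: "subspace K E ?D" "?T \<inter> E = {\<zero>\<^bsub>?D\<^esub>}" "?T <+>\<^bsub>?D\<^esub> E = carrier ?D"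
    using D.complement_exists[OF alt_dual_fin_dim parts(2)] by blast
  note CD = s_submoduleD[OF C(1)] and CS = subspaceD[OF s_submoduleD(1)[OF C(1)]] and ED = subspaceD[OF E(1)]
  have split: "x \<in> ?U \<and> z \<in> ?T" if xz: "(x, z) \<in> W" for x z
  proof -
    have carr: "x \<in> carrier V" "z \<in> carrier ?D" using xz WD(1) by (auto simp: h_algebra_simps)
    have "x \<in> ?U <+>\<^bsub>V\<^esub> C" using carr(1) C(3) by simp
    then obtain u c where u: "u \<in> ?U" and c: "c \<in> C" and x: "x = u \<oplus> c" by (rule set_addE)
    have uc: "u \<in> carrier V" "c \<in> carrier V" using u c CS(1) by auto
    have "(x, z) \<ominus>\<^bsub>?H\<^esub> (u, \<zero>\<^bsub>?D\<^esub>) \<in> W" using subspace_minus[OF Ws xz] u by blast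
    moreover have "(x, z) \<ominus>\<^bsub>?H\<^esub> (u, \<zero>\<^bsub>?D\<^esub>) = (c, z)"
      using carr uc by (subst h_minus)
        (auto simp: h_algebra_simps x M.a_comm[of u c] add_minus_cancel D.M.minus_eq)
    ultimately have cz: "(c, z) \<in> W" by simp
    have "act V s c = \<zero>" if s: "s \<in> carrier S" for s
    proof -
      have "act V s c \<in> ?U" using Wact[OF s cz] uc s by (simp add: h_algebra_simps act_closed)
      then show ?thesis using CD(2)[OF s c] C(2) by blast
    qed
    then have "c = \<zero>" using full uc(2) unfolding full_module_iff by blast
    then show ?thesis using cz carr u uc x by simp
  qed
  let ?W' = "C \<times> E"
  have W's: "subspace K ?W' ?H"
    using CS ED by (intro subspaceI[OF h_vectorspace]) (auto simp: h_algebra_simps)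
  have "s_submodule K S ?W' ?H"
    unfolding s_submodule_def using W's CD(2) ED(2) by (auto simp: h_algebra_simps)
  moreover have "W \<inter> ?W' = {\<zero>\<^bsub>?H\<^esub>}"
  proof (intro equalityI subsetI)
    fix p assume p: "p \<in> W \<inter> ?W'"
    then have "fst p \<in> ?U \<inter> C" "snd p \<in> ?T \<inter> E" using split[of "fst p" "snd p"] by auto
    then have "fst p = \<zero>" "snd p = \<zero>\<^bsub>?D\<^esub>" unfolding C(2) E(2) by auto
    then show "p \<in> {\<zero>\<^bsub>?H\<^esub>}" by (simp add: h_algebra_simps prod_eq_iff)
  next
    fix p assume "p \<in> {\<zero>\<^bsub>?H\<^esub>}"
    then show "p \<in> W \<inter> ?W'" using WD(2) subspaceD(2)[OF W's] by simp
  qed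
  moreover have "W <+>\<^bsub>?H\<^esub> ?W' = carrier ?H"
  proof (intro equalityI subsetI)
    fix p assume "p \<in> carrier ?H"
    then have p: "fst p \<in> ?U <+>\<^bsub>V\<^esub> C" "snd p \<in> ?T <+>\<^bsub>?D\<^esub> E" unfolding C(3) E(3) by (auto simp: h_algebra_simps)
    obtain u c where u: "u \<in> ?U" and c: "c \<in> C" and x: "fst p = u \<oplus> c" using p(1) by (rule set_addE)
    obtain t e where t: "t \<in> ?T" and e: "e \<in> E" and z: "snd p = t \<oplus>\<^bsub>?D\<^esub> e" using p(2) by (rule set_addE)
    have "(u, t) \<in> W" using h_subspace_combine[OF Ws] u t by blast
    moreover have "(c, e) \<in> ?W'" using c e by simp
    moreover have "p = (u, t) \<oplus>\<^bsub>?H\<^esub> (c, e)" using x z by (simp add: h_algebra_simps prod_eq_iff)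
    ultimately show "p \<in> W <+>\<^bsub>?H\<^esub> ?W'" using set_addI[of "(u, t)" W "(c, e)" ?W' ?H] by simp
  next
    fix p assume "p \<in> W <+>\<^bsub>?H\<^esub> ?W'"
    then show "p \<in> carrier ?H" using subspaceD(1)[OF H.subspace_set_add[OF Ws W's]] by blast
  qed
  ultimately show "\<exists>W'. s_submodule K S W' ?H \<and> W \<inter> W' = {\<zero>\<^bsub>?H\<^esub>} \<and> W <+>\<^bsub>?H\<^esub> W' = carrier ?H"
    by blast
qed

lemma h_lie_s_algebra:
  assumes "full_module K S V"
  shows "lie_s_algebra K S (h_algebra K S V)"
proof -
  interpret D: vectorspace K "alt_dual K S V" by (rule alt_dual_vectorspace)
  interpret H: vectorspace K "h_algebra K S V" by (rule h_vectorspace)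
  note rules = h_algebra_simps act_closed alt_eval_closed act_zero act_add_right act_add_left
    act_smult_right act_smult_left act_bracket alt_eval_add alt_eval_smult alt_eval_self alt_eval_act alt_eval_zero
  have zz: "\<zero>\<^bsub>alt_dual K S V\<^esub> \<ominus>\<^bsub>alt_dual K S V\<^esub> \<zero>\<^bsub>alt_dual K S V\<^esub> = \<zero>\<^bsub>alt_dual K S V\<^esub>"
    by (simp add: D.minus_eq_zero_iff)
  have "act (h_algebra K S V) (s \<otimes>\<^bsub>S\<^esub> t) x = act (h_algebra K S V) s (act (h_algebra K S V) t x)
      \<ominus>\<^bsub>h_algebra K S V\<^esub> act (h_algebra K S V) t (act (h_algebra K S V) s x)"
    if "s \<in> carrier S" "t \<in> carrier S" "x \<in> carrier (h_algebra K S V)" for s t x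
    using that by (subst h_minus) (auto simp: rules zz)
  then have "s_module_axioms K S (h_algebra K S V)"
    by (intro s_module_axioms.intro) (auto simp: rules h_fin_dim)
  moreover have "lie_algebra_axioms K (h_algebra K S V)"
    by standard (auto simp: rules h_fin_dim)
  moreover have "lie_s_algebra_axioms K S (h_algebra K S V)"
    by standard (auto simp: rules h_completely_reducible[OF assms])
  ultimately show ?thesis
    by (intro lie_s_algebra.intro s_module.intro lie_algebra.intro h_vectorspace S.lie_algebra_axioms)
qed

text \<open>
  For generation by \<open>[S, h(V)]\<close>: a subalgebra that contains it contains \<open>V\<close> by fullness, then all
  brackets of elements of \<open>V\<close>, which are the evaluations, and these span the second summand.
\<close>

lemma h_almost_minimal:
  assumes full: "full_module K S V"
  shows "almost_minimal_s_algebra K S (h_algebra K S V)"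
proof -
  interpret D: vectorspace K "alt_dual K S V" by (rule alt_dual_vectorspace)
  let ?H = "h_algebra K S V" and ?D = "alt_dual K S V"
  interpret H: lie_s_algebra K S ?H by (rule h_lie_s_algebra[OF full])
  have "carrier ?H \<subseteq> G"
    if G: "lie_subalgebra K G ?H" "\<forall>s\<in>carrier S. \<forall>p\<in>carrier ?H. act ?H s p \<in> G" for G
  proof -
    note Gs = lie_subalgebraD(1)[OF G(1)]
    let ?U = "{x \<in> carrier V. (x, \<zero>\<^bsub>?D\<^esub>) \<in> G}"
    have act: "act V s x \<in> ?U" if "s \<in> carrier S" "x \<in> carrier V" for s x
      using G(2)[rule_format, of s "(x, \<zero>\<^bsub>?D\<^esub>)"] that by (simp add: h_algebra_simps act_closed)
    have "s_submodule K S ?U V"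
      unfolding s_submodule_def using h_subspace_parts(1)[OF Gs] act by blast
    then have U: "?U = carrier V" by (rule full_module_generated[OF full _ act])
    have "alt_eval K S V x y \<in> {z \<in> carrier ?D. (\<zero>, z) \<in> G}" if xy: "x \<in> carrier V" "y \<in> carrier V" for x y
    proof -
      have "(x, \<zero>\<^bsub>?D\<^esub>) \<in> G" "(y, \<zero>\<^bsub>?D\<^esub>) \<in> G" using xy U by auto
      then show ?thesis
        using lie_subalgebraD(2)[OF G(1)] xy by (force simp: h_algebra_simps alt_eval_closed)
    qed
    then have T: "carrier ?D \<subseteq> {z \<in> carrier ?D. (\<zero>, z) \<in> G}"
      by (rule alt_dual_generated[OF h_subspace_parts(2)[OF Gs]])
    show ?thesis
      using h_subspace_combine[OF Gs] U T by (auto simp: h_algebra_simps)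
  qed
  then show ?thesis
    unfolding H.almost_minimal_iff
    by (auto simp: h_algebra_simps alt_eval_zero act_zero)
qed

lemma h_quotient_epi:
  assumes full: "full_module K S V" and Z: "subspace K Z (alt_dual K S V)"
  shows "(\<lambda>p. ({\<zero>} \<times> Z) +>\<^bsub>h_algebra K S V\<^esub> p) \<in> s_algebra_epi K S (h_algebra K S V) (h_quotient K S V Z)"
    and "\<And>p q. p \<in> carrier (h_algebra K S V) \<Longrightarrow> q \<in> carrier (h_algebra K S V) \<Longrightarrow>
      ({\<zero>} \<times> Z) +>\<^bsub>h_algebra K S V\<^esub> p = ({\<zero>} \<times> Z) +>\<^bsub>h_algebra K S V\<^esub> q \<longleftrightarrow>
      fst p = fst q \<and> snd p \<ominus>\<^bsub>alt_dual K S V\<^esub> snd q \<in> Z"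
proof -
  interpret D: vectorspace K "alt_dual K S V" by (rule alt_dual_vectorspace)
  let ?H = "h_algebra K S V" and ?D = "alt_dual K S V"
  interpret H: lie_s_algebra K S ?H by (rule h_lie_s_algebra[OF full])
  note ZD = subspaceD[OF Z]
  have I: "subspace K ({\<zero>} \<times> Z) ?H"
    using ZD by (intro subspaceI[OF h_vectorspace]) (auto simp: h_algebra_simps)
  show "(\<lambda>p. ({\<zero>} \<times> Z) +>\<^bsub>?H\<^esub> p) \<in> s_algebra_epi K S ?H (h_quotient K S V Z)"
    unfolding h_quotient_def
    by (rule H.quotient_epi[OF I]) (use ZD in \<open>auto simp: h_algebra_simps alt_eval_zero act_zero\<close>)
  fix p q assume pq: "p \<in> carrier ?H" "q \<in> carrier ?H"
  show "({\<zero>} \<times> Z) +>\<^bsub>?H\<^esub> p = ({\<zero>} \<times> Z) +>\<^bsub>?H\<^esub> q \<longleftrightarrow> fst p = fst q \<and> snd p \<ominus>\<^bsub>?D\<^esub> snd q \<in> Z"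
    unfolding H.quotient_coset_eq_iff[OF I pq] h_minus[OF pq]
    using pq by (auto simp: h_algebra_simps minus_eq_zero_iff)
qed

end

section \<open>Minimality and irreducibility\<close>

context s_module
begin

text \<open>
  The hypothesis on the kernel says that the first component \<open>fst q\<close> is determined by \<open>p q\<close>, which is
  the projection of \<open>N\<close> onto \<open>V\<close>. A submodule \<open>W\<close> of \<open>V\<close> corresponds to the subalgebra
  \<open>p(W \<times> Alt(V)\<^sup>*)\<close>. Conversely the projection of a subalgebra \<open>G\<close> to \<open>V\<close> is zero, and then \<open>S\<close> kills \<open>G\<close>,
  or it is \<open>V\<close>; in the latter case \<open>[S, N] \<subseteq> G\<close>, as \<open>S\<close> acts on \<open>N\<close> through the projection, so that
  \<open>G = N\<close>.
\<close>

lemma minimal_iff_irreducible: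
  assumes full: "full_module K S V"
    and p: "p \<in> s_algebra_epi K S (h_algebra K S V) N"
    and ker: "\<And>q. q \<in> carrier (h_algebra K S V) \<Longrightarrow> p q = \<zero>\<^bsub>N\<^esub> \<Longrightarrow> fst q = \<zero>"
  shows "minimal_s_algebra K S N \<longleftrightarrow> irreducible_module K S V"
proof -
  let ?H = "h_algebra K S V" and ?D = "alt_dual K S V"
  interpret D: vectorspace K ?D by (rule alt_dual_vectorspace)
  interpret H: lie_s_algebra K S ?H by (rule h_lie_s_algebra[OF full])
  have amN: "almost_minimal_s_algebra K S N"
    by (rule almost_minimal_epi_image[OF h_almost_minimal[OF full] p])
  interpret N: lie_s_algebra K S N using amN by (simp add: almost_minimal_s_algebra_def)
  note pD = s_algebra_epiD[OF p] and ph = s_algebra_epi_hom[OF p]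
  have carr: "\<exists>q\<in>carrier ?H. n = p q" if "n \<in> carrier N" for n using that pD(1) by blast
  have actN: "act N s (p q) = p (act V s (fst q), \<zero>\<^bsub>?D\<^esub>)" if "s \<in> carrier S" "q \<in> carrier ?H" for s q
    using pD(7)[OF that] by (simp add: h_algebra_simps)
  have fst_eq: "fst q = fst r" if "q \<in> carrier ?H" "r \<in> carrier ?H" "p q = p r" for q r
  proof -
    have "p (q \<ominus>\<^bsub>?H\<^esub> r) \<oplus>\<^bsub>N\<^esub> p r = p q"
      using that by (simp add: pD(4)[symmetric] H.minus_add_cancel)
    then have "p (q \<ominus>\<^bsub>?H\<^esub> r) = \<zero>\<^bsub>N\<^esub>"
      using that pD(3) H.M.minus_closed by (metis N.M.add.r_cancel_one')
    then have "fst (q \<ominus>\<^bsub>?H\<^esub> r) = \<zero>" using that by (intro ker) auto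
    then have "fst q \<ominus> fst r = \<zero>" using that by (simp add: h_minus)
    then show ?thesis using that by (auto simp: minus_eq_zero_iff h_algebra_simps)
  qed
  have act_nonzero: "x = \<zero>"
    if "x \<in> carrier V" "\<And>s. s \<in> carrier S \<Longrightarrow> p (act V s x, \<zero>\<^bsub>?D\<^esub>) = \<zero>\<^bsub>N\<^esub>" for x
  proof -
    note x = that
    have "act V s x = \<zero>" if s: "s \<in> carrier S" for s
      using ker[OF _ x(2)[OF s]] s x(1) by (simp add: h_algebra_simps act_closed)
    then show ?thesis using full x(1) unfolding full_module_iff by blast
  qed
  have pz: "p (\<zero>, \<zero>\<^bsub>?D\<^esub>) = \<zero>\<^bsub>N\<^esub>" using pD(2) by (simp add: h_algebra_simps)
  show ?thesis
  proof
    assume min: "minimal_s_algebra K S N"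
    have "carrier V \<noteq> {\<zero>}"
    proof
      assume V0: "carrier V = {\<zero>}"
      have "act N s n = \<zero>\<^bsub>N\<^esub>" if s: "s \<in> carrier S" and n: "n \<in> carrier N" for s n
      proof -
        obtain q where q: "q \<in> carrier ?H" "n = p q" using carr[OF n] by blast
        have "fst q \<in> carrier V" using q(1) by (auto simp: h_algebra_simps)
        then have "fst q = \<zero>" using V0 by blast
        then show ?thesis using actN[OF s q(1)] q(2) pz s by (simp add: act_zero)
      qed
      then have "act_sub K S N (carrier N) = {\<zero>\<^bsub>N\<^esub>}" by (simp add: N.act_sub_trivial_iff)
      then show False using min by (simp add: minimal_s_algebra_def)
    qed
    moreover have "W = {\<zero>} \<or> W = carrier V" if W: "s_submodule K S W V" for W
    proof -
      note Ws = s_submoduleD(1)[OF W] and Wact = s_submoduleD(2)[OF W]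
      note WD = subspaceD[OF Ws]
      let ?G = "p ` (W \<times> carrier ?D)"
      have WDs: "subspace K (W \<times> carrier ?D) ?H"
        using WD by (intro subspaceI[OF h_vectorspace]) (auto simp: h_algebra_simps)
      note incl = subspaceD(1)[OF WDs]
      have "s_subalgebra K S ?G N"
        unfolding s_subalgebra_def
      proof (intro conjI ballI lie_subalgebraI)
        show "subspace K ?G N"
          by (rule subspace_image[OF h_vectorspace N.vectorspace_axioms ph pD(2) WDs])
      next
        fix x y assume "x \<in> ?G" "y \<in> ?G"
        then obtain a b where ab: "a \<in> W \<times> carrier ?D" "b \<in> W \<times> carrier ?D" "x = p a" "y = p b" by blast
        then have "a \<in> carrier ?H" "b \<in> carrier ?H" using incl by blast+
        from pD(6)[OF this] have "x \<otimes>\<^bsub>N\<^esub> y = p (a \<otimes>\<^bsub>?H\<^esub> b)" unfolding ab(3,4) by (rule sym)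
        moreover have "a \<otimes>\<^bsub>?H\<^esub> b \<in> W \<times> carrier ?D"
          using ab WD(1,2) by (auto simp: h_algebra_simps alt_eval_closed subset_iff)
        ultimately show "x \<otimes>\<^bsub>N\<^esub> y \<in> ?G" by (simp only: imageI)
      next
        fix s x assume s: "s \<in> carrier S" and "x \<in> ?G"
        then obtain a where a: "a \<in> W \<times> carrier ?D" "x = p a" by blast
        then have "a \<in> carrier ?H" using incl by blast
        from actN[OF s this] have "act N s x = p (act V s (fst a), \<zero>\<^bsub>?D\<^esub>)" unfolding a(2) .
        moreover have "(act V s (fst a), \<zero>\<^bsub>?D\<^esub>) \<in> W \<times> carrier ?D" using a Wact[OF s] by auto
        ultimately show "act N s x \<in> ?G" by (simp only: imageI)
      qed
      then consider "?G = carrier N" | "act_sub K S N ?G = {\<zero>\<^bsub>N\<^esub>}"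
        using min unfolding minimal_s_algebra_def by blast
      then show ?thesis
      proof cases
        case 1
        have "x \<in> W" if x: "x \<in> carrier V" for x
        proof -
          have xH: "(x, \<zero>\<^bsub>?D\<^esub>) \<in> carrier ?H" using x by (simp add: h_algebra_simps)
          then have "p (x, \<zero>\<^bsub>?D\<^esub>) \<in> ?G" unfolding 1 by (rule pD(3))
          then obtain a where a: "a \<in> W \<times> carrier ?D" "p (x, \<zero>\<^bsub>?D\<^esub>) = p a" by blast
          then have "x = fst a" using fst_eq[OF xH _ a(2)] incl by auto
          then show ?thesis using a(1) by auto
        qed
        then show ?thesis using WD(1) by blast
      next
        case 2
        have "x = \<zero>" if x: "x \<in> W" for x
        proof (rule act_nonzero)
          show xV: "x \<in> carrier V" using x WD(1) by blast
          fix s assume s: "s \<in> carrier S"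
          have "?G \<subseteq> carrier N" using incl pD(3) by blast
          then have "act N s (p (x, \<zero>\<^bsub>?D\<^esub>)) = \<zero>\<^bsub>N\<^esub>"
            using 2 s x N.act_sub_trivial_iff by (metis (no_types, lifting) D.M.zero_closed SigmaI image_eqI)
          then show "p (act V s x, \<zero>\<^bsub>?D\<^esub>) = \<zero>\<^bsub>N\<^esub>"
            using actN[OF s, of "(x, \<zero>\<^bsub>?D\<^esub>)"] xV by (simp add: h_algebra_simps)
        qed
        then show ?thesis using WD(2) by blast
      qed
    qed
    ultimately show "irreducible_module K S V"
      unfolding irreducible_module_def using s_module_axioms by blast
  next
    assume irr: "irreducible_module K S V"
    then obtain x where x: "x \<in> carrier V" "x \<noteq> \<zero>"
      unfolding irreducible_module_def by (metis M.zero_closed singletonI subsetI subset_antisym subset_singletonD insertE empty_iff)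
    have "act_sub K S N (carrier N) \<noteq> {\<zero>\<^bsub>N\<^esub>}"
    proof
      assume "act_sub K S N (carrier N) = {\<zero>\<^bsub>N\<^esub>}"
      then have triv: "\<forall>s\<in>carrier S. \<forall>n\<in>carrier N. act N s n = \<zero>\<^bsub>N\<^esub>"
        by (simp add: N.act_sub_trivial_iff)
      have xH: "(x, \<zero>\<^bsub>?D\<^esub>) \<in> carrier ?H" using x by (simp add: h_algebra_simps)
      have "p (act V s x, \<zero>\<^bsub>?D\<^esub>) = \<zero>\<^bsub>N\<^esub>" if s: "s \<in> carrier S" for s
        using actN[OF s xH] triv s pD(3)[OF xH] by simp
      then show False using act_nonzero[OF x(1)] x(2) by blast
    qed
    moreover have "G = carrier N \<or> act_sub K S N G = {\<zero>\<^bsub>N\<^esub>}" if G: "s_subalgebra K S G N" for G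
    proof -
      have Gl: "lie_subalgebra K G N" and Gact: "\<And>s x. s \<in> carrier S \<Longrightarrow> x \<in> G \<Longrightarrow> act N s x \<in> G"
        using G by (auto simp: s_subalgebra_def)
      note Gs = lie_subalgebraD(1)[OF Gl]
      note GD = subspaceD[OF Gs]
      let ?P = "{q \<in> carrier ?H. p q \<in> G}"
      have P: "subspace K ?P ?H" by (rule subspace_vimage[OF h_vectorspace ph pD(2) Gs])
      have fsth: "fst \<in> module_hom K ?H V" "fst \<zero>\<^bsub>?H\<^esub> = \<zero>"
        by (auto simp: module_hom_def h_algebra_simps)
      have "s_submodule K S (fst ` ?P) V"
        unfolding s_submodule_def
      proof (intro conjI ballI)
        show "subspace K (fst ` ?P) V"
          by (rule subspace_image[OF h_vectorspace vectorspace_axioms fsth P])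
        fix s w assume s: "s \<in> carrier S" and "w \<in> fst ` ?P"
        then obtain q where q: "q \<in> carrier ?H" "p q \<in> G" "w = fst q" by blast
        have "(act V s w, \<zero>\<^bsub>?D\<^esub>) \<in> ?P"
          using Gact[OF s q(2)] actN[OF s q(1)] q s by (auto simp: h_algebra_simps act_closed)
        then show "act V s w \<in> fst ` ?P" by force
      qed
      then consider "fst ` ?P = {\<zero>}" | "fst ` ?P = carrier V"
        using irr unfolding irreducible_module_def by blast
      then show ?thesis
      proof cases
        case 1
        have "act N s n = \<zero>\<^bsub>N\<^esub>" if s: "s \<in> carrier S" and n: "n \<in> G" for s n
        proof -
          obtain q where q: "q \<in> carrier ?H" "n = p q" using carr GD(1) n by blast
          then have "fst q \<in> fst ` ?P" using n by blast
          then have "fst q = \<zero>" using 1 by blast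
          then show ?thesis using actN[OF s q(1)] q(2) pz s by (simp add: act_zero)
        qed
        then show ?thesis using N.act_sub_trivial_iff[OF GD(1)] by blast
      next
        case 2
        have "act N s n \<in> G" if s: "s \<in> carrier S" and n: "n \<in> carrier N" for s n
        proof -
          obtain q where q: "q \<in> carrier ?H" "n = p q" using carr n by blast
          then have "fst q \<in> fst ` ?P" unfolding 2 by (auto simp: h_algebra_simps)
          then obtain r where r: "r \<in> carrier ?H" "p r \<in> G" "fst q = fst r" by blast
          have "act N s n = act N s (p r)" using actN[OF s q(1)] actN[OF s r(1)] q(2) r(3) by simp
          then show ?thesis using Gact[OF s r(2)] by simp
        qed
        then have "carrier N \<subseteq> G" using amN Gl unfolding N.almost_minimal_iff by blast
        then show ?thesis using GD(1) by blast
      qed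
    qed
    ultimately show "minimal_s_algebra K S N"
      unfolding minimal_s_algebra_def using N.lie_s_algebra_axioms by blast
  qed
qed

lemma isomorphic_h_quotient_minimal_iff:
  assumes full: "full_module K S V" and Z: "subspace K Z (alt_dual K S V)"
    and N: "lie_s_algebra K S N" and iso: "s_algebra_isomorphic K S N (h_quotient K S V Z)"
  shows "minimal_s_algebra K S N \<longleftrightarrow> irreducible_module K S V"
proof -
  let ?H = "h_algebra K S V" and ?Q = "h_quotient K S V Z"
  let ?q = "\<lambda>p. ({\<zero>} \<times> Z) +>\<^bsub>?H\<^esub> p"
  note q = h_quotient_epi[OF full Z]
  interpret H: lie_s_algebra K S ?H by (rule h_lie_s_algebra[OF full])
  interpret N: lie_s_algebra K S N by (rule N)
  interpret Q: lie_s_algebra K S ?Q by (rule lie_s_algebra_epi_image[OF H.lie_s_algebra_axioms q(1)])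
  obtain f where f: "f \<in> s_algebra_iso K S N ?Q" using iso unfolding s_algebra_isomorphic_def by blast
  have fh: "f \<in> module_hom K N ?Q" and bij: "bij_betw f (carrier N) (carrier ?Q)"
    using f by (auto simp: s_algebra_iso_def)
  have f0: "f \<zero>\<^bsub>N\<^esub> = \<zero>\<^bsub>?Q\<^esub>"
    by (rule mod_hom.f0_is_0[OF mod_hom.intro[OF N.module_axioms Q.module_axioms mod_hom_axioms.intro[OF fh]]])
  have p: "(\<lambda>x. inv_into (carrier N) f (?q x)) \<in> s_algebra_epi K S ?H N"
    by (rule epi_comp[OF q(1) iso_inverse_epi[OF N f f0]])
  show ?thesis
  proof (rule minimal_iff_irreducible[OF full p])
    fix r assume r: "r \<in> carrier ?H" and "inv_into (carrier N) f (?q r) = \<zero>\<^bsub>N\<^esub>"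
    then have "?q r = f \<zero>\<^bsub>N\<^esub>"
      using f_inv_into_f[of "?q r" f "carrier N"] s_algebra_epiD(3)[OF q(1) r] bij
      by (simp add: bij_betw_def)
    also have "\<dots> = ?q \<zero>\<^bsub>?H\<^esub>" using f0 s_algebra_epiD(2)[OF q(1)] by simp
    finally show "fst r = \<zero>" using q(2)[OF r H.M.zero_closed] by (simp add: h_algebra_simps(2))
  qed
qed

end

section \<open>Almost minimal algebras as quotients\<close>

lemma submodule_s_module:
  assumes V: "s_module K S V" and W: "s_submodule K S W V"
    and fin: "vectorspace.fin_dim K (V\<lparr>carrier := W\<rparr>)"
  shows "s_module K S (V\<lparr>carrier := W\<rparr>)"
proof -
  interpret V: s_module K S V by fact
  note Ws = s_submoduleD(1)[OF W] and Wact = s_submoduleD(2)[OF W]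
  note WD = subspaceD[OF Ws]
  interpret W: vectorspace K "V\<lparr>carrier := W\<rparr>" by (rule V.subspace_is_vs[OF Ws])
  \<comment> \<open>Subtraction depends on the carrier through the choice of the additive inverse.\<close>
  have minus: "x \<ominus>\<^bsub>V\<lparr>carrier := W\<rparr>\<^esub> y = x \<ominus>\<^bsub>V\<^esub> y" if "x \<in> W" "y \<in> W" for x y
  proof -
    let ?d = "x \<ominus>\<^bsub>V\<lparr>carrier := W\<rparr>\<^esub> y"
    have d: "?d \<in> W" "?d \<oplus>\<^bsub>V\<^esub> y = x"
      using W.M.minus_closed[of x y] W.minus_add_cancel[of x y] that by simp_all
    have "?d \<in> carrier V" "y \<in> carrier V" using d(1) that WD(1) by auto
    from V.add_minus_cancel[OF this] show ?thesis unfolding d(2) by (rule sym)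
  qed
  have carr: "x \<in> carrier V" if "x \<in> W" for x using that WD(1) by blast
  have "s_module_axioms K S (V\<lparr>carrier := W\<rparr>)"
    by (intro s_module_axioms.intro)
      (use fin Wact in \<open>auto simp: minus carr V.act_add_right V.act_smult_right V.act_add_left
        V.act_smult_left V.act_bracket\<close>)
  then show ?thesis
    by (intro s_module.intro V.S.lie_algebra_axioms W.vectorspace_axioms)
qed

context lie_s_algebra
begin

text \<open>
  Complementing the invariants, rather than the derived subalgebra, makes the complement
  visibly full: an invariant vector in it lies in both summands.
\<close>

lemma complement_of_invariants:
  obtains V where "full_module K S (N\<lparr>carrier := V\<rparr>)" "s_submodule K S V N"
    "V \<inter> {n \<in> carrier N. \<forall>s\<in>carrier S. act N s n = \<zero>} = {\<zero>}"
    "V <+>\<^bsub>N\<^esub> {n \<in> carrier N. \<forall>s\<in>carrier S. act N s n = \<zero>} = carrier N"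
proof -
  let ?I = "{n \<in> carrier N. \<forall>s\<in>carrier S. act N s n = \<zero>}"
  have Is: "subspace K ?I N"
    by (intro subspaceI[OF vectorspace_axioms]) (auto simp: act_zero act_add_right act_smult_right)
  have I: "s_submodule K S ?I N"
    unfolding s_submodule_def using Is by (auto simp: act_zero)
  obtain V where V: "s_submodule K S V N" "?I \<inter> V = {\<zero>}" "?I <+>\<^bsub>N\<^esub> V = carrier N"
    using completely_reducible I unfolding completely_reducible_def by blast
  note Vs = s_submoduleD(1)[OF V(1)] and Vact = s_submoduleD(2)[OF V(1)]
  note VD = subspaceD[OF Vs]
  have VI: "V \<inter> ?I = {\<zero>}" "V <+>\<^bsub>N\<^esub> ?I = carrier N"
    using V(2,3) set_add_comm[OF vectorspace_axioms subspaceD(1)[OF Is] VD(1)] by (simp_all add: Int_commute)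
  let ?V = "N\<lparr>carrier := V\<rparr>"
  interpret V: s_module K S ?V
    by (rule submodule_s_module[OF s_module_axioms V(1) fin_dim_complemented[OF finite_dimensional Vs Is VI]])
  have "completely_reducible K S ?V"
    unfolding completely_reducible_def
  proof (intro allI impI)
    fix W assume W: "s_submodule K S W ?V"
    have WV: "W \<subseteq> V" using subspaceD(1)[OF s_submoduleD(1)[OF W]] by simp
    have "s_submodule K S W N"
      unfolding s_submodule_def
    proof
      show "subspace K W N"
        using subspaceD[OF s_submoduleD(1)[OF W]] VD(1) by (intro subspaceI[OF vectorspace_axioms]) auto
      show "\<forall>s\<in>carrier S. \<forall>w\<in>W. act N s w \<in> W" using s_submoduleD(2)[OF W] by simp
    qed
    then obtain C where C: "s_submodule K S C N" "W \<inter> C = {\<zero>}" "W <+>\<^bsub>N\<^esub> C = carrier N"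
      using completely_reducible unfolding completely_reducible_def by blast
    note Cs = s_submoduleD(1)[OF C(1)]
    have "subspace K (C \<inter> V) ?V"
      using subspaceD[OF Cs] VD by (intro subspaceI[OF V.vectorspace_axioms]) auto
    then have "s_submodule K S (C \<inter> V) ?V"
      unfolding s_submodule_def using s_submoduleD(2)[OF C(1)] Vact by simp
    moreover have "W \<inter> (C \<inter> V) = {\<zero>\<^bsub>?V\<^esub>}" using C(2) WV by auto
    moreover have "W <+>\<^bsub>?V\<^esub> (C \<inter> V) = carrier ?V"
    proof (intro equalityI subsetI)
      fix x assume "x \<in> W <+>\<^bsub>?V\<^esub> (C \<inter> V)"
      then obtain w c where "w \<in> W" "c \<in> C \<inter> V" "x = w \<oplus>\<^bsub>?V\<^esub> c" by (rule set_addE)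
      then show "x \<in> carrier ?V" using WV VD(3) by auto
    next
      fix x assume "x \<in> carrier ?V"
      then have xV: "x \<in> V" by simp
      then have "x \<in> W <+>\<^bsub>N\<^esub> C" using C(3) VD(1) by auto
      then obtain w c where wc: "w \<in> W" "c \<in> C" "x = w \<oplus> c" by (rule set_addE)
      have wcN: "w \<in> carrier N" "c \<in> carrier N" using wc WV VD(1) subspaceD(1)[OF Cs] by auto
      have "c = x \<ominus> w" unfolding wc(3) using wcN by (simp add: M.a_comm[of w c] add_minus_cancel)
      also have "\<dots> \<in> V" by (rule subspace_minus[OF Vs xV]) (use wc(1) WV in blast)
      finally have "c \<in> C \<inter> V" using wc(2) by blast
      then have "w \<oplus>\<^bsub>?V\<^esub> c \<in> W <+>\<^bsub>?V\<^esub> (C \<inter> V)" by (rule set_addI[OF wc(1)])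
      then show "x \<in> W <+>\<^bsub>?V\<^esub> (C \<inter> V)" using wc(3) by simp
    qed
    ultimately show "\<exists>W'. s_submodule K S W' ?V \<and> W \<inter> W' = {\<zero>\<^bsub>?V\<^esub>} \<and> W <+>\<^bsub>?V\<^esub> W' = carrier ?V"
      by blast
  qed
  moreover have "x = \<zero>" if "x \<in> V" "\<forall>s\<in>carrier S. act N s x = \<zero>" for x
    using that VI(1) VD(1) by blast
  ultimately have "full_module K S ?V" unfolding V.full_module_iff by simp
  from that[OF this V(1) VI] show thesis .
qed

text \<open>
  With coordinate functionals \<open>coord b\<close> for a basis \<open>B\<close> of \<open>N\<close>, every \<open>\<phi> b (x, y) = coord b [x, y]\<close> is an
  invariant alternating form on \<open>V\<close>, and \<open>\<psi> z\<close> is the vector whose coordinates are the \<open>z (\<phi> b)\<close>.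
\<close>

lemma bracket_factorization:
  assumes V: "s_module K S (N\<lparr>carrier := V\<rparr>)" and VN: "V \<subseteq> carrier N"
    and inv: "\<And>s x y. s \<in> carrier S \<Longrightarrow> x \<in> V \<Longrightarrow> y \<in> V \<Longrightarrow> act N s (x \<otimes> y) = \<zero>"
  obtains \<psi> where "\<psi> \<in> module_hom K (alt_dual K S (N\<lparr>carrier := V\<rparr>)) N"
    "\<And>x y. x \<in> V \<Longrightarrow> y \<in> V \<Longrightarrow> \<psi> (alt_eval K S (N\<lparr>carrier := V\<rparr>) x y) = x \<otimes> y"
proof -
  let ?V = "N\<lparr>carrier := V\<rparr>"
  interpret V: s_module K S ?V by (rule V)
  let ?A = "alt_space K S ?V" and ?D = "alt_dual K S ?V"
  note A = alt_space_simps[OF S.R.ring_axioms, of S ?V]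
  obtain B coord where B: "finite B" "B \<subseteq> carrier N"
    and cl: "\<And>b x. b \<in> B \<Longrightarrow> x \<in> carrier N \<Longrightarrow> coord b x \<in> carrier K"
    and add: "\<And>b x y. b \<in> B \<Longrightarrow> x \<in> carrier N \<Longrightarrow> y \<in> carrier N \<Longrightarrow> coord b (x \<oplus> y) = coord b x \<oplus>\<^bsub>K\<^esub> coord b y"
    and smult: "\<And>b c x. b \<in> B \<Longrightarrow> c \<in> carrier K \<Longrightarrow> x \<in> carrier N \<Longrightarrow> coord b (c \<odot> x) = c \<otimes>\<^bsub>K\<^esub> coord b x"
    and expand: "\<And>x. x \<in> carrier N \<Longrightarrow> lincomb (\<lambda>b. coord b x) B = x"
    using coordinates_exist[OF finite_dimensional] by blast
  have zero: "coord b \<zero> = \<zero>\<^bsub>K\<^esub>" if "b \<in> B" for b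
    using smult[OF that, of "\<zero>\<^bsub>K\<^esub>" \<zero>] cl[OF that, of \<zero>] by simp
  define \<phi> where "\<phi> b = (\<lambda>p\<in>V \<times> V. coord b (fst p \<otimes> snd p))" for b
  have VNx: "x \<in> carrier N" if "x \<in> V" for x using that VN by blast
  have \<phi>: "\<phi> b \<in> carrier ?A" if b: "b \<in> B" for b
  proof -
    have "coord b (act N s x \<otimes> y) \<oplus>\<^bsub>K\<^esub> coord b (x \<otimes> act N s y) = \<zero>\<^bsub>K\<^esub>"
      if "s \<in> carrier S" "x \<in> V" "y \<in> V" for s x y
      using that b inv[OF that]
      by (simp add: add[symmetric] bracket_closed act_closed VNx act_derivation[symmetric] zero)
    then show ?thesis
      using b V.act_closed V.M.a_closed V.smult_closed
      by (auto simp: A \<phi>_def VNx cl bracket_closed bracket_add_left bracket_add_right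
          bracket_smult_left bracket_smult_right bracket_self add smult zero)
  qed
  define \<psi> where "\<psi> z = lincomb (\<lambda>b. z (\<phi> b)) B" for z
  have zK: "z (\<phi> b) \<in> carrier K" if "z \<in> carrier ?D" "b \<in> B" for z b
    using that \<phi>[OF that(2)] by (auto simp: V.alt_dual_simps)
  show thesis
  proof (rule that)
    show "\<psi> \<in> module_hom K ?D N"
      unfolding module_hom_def
    proof (intro CollectI conjI allI impI)
      show "\<psi> \<in> carrier ?D \<rightarrow> carrier N"
        unfolding \<psi>_def using B zK by (intro Pi_I lincomb_closed) auto
    next
      fix y z assume yz: "y \<in> carrier ?D \<and> z \<in> carrier ?D"
      have "\<psi> (y \<oplus>\<^bsub>?D\<^esub> z) = lincomb (\<lambda>b. y (\<phi> b) \<oplus>\<^bsub>K\<^esub> z (\<phi> b)) B"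
        unfolding \<psi>_def by (rule lincomb_cong) (use B yz zK \<phi> in \<open>auto simp: V.alt_dual_simps(3)\<close>)
      also have "\<dots> = \<psi> y \<oplus> \<psi> z"
        unfolding \<psi>_def by (rule lincomb_sum) (use B yz zK in auto)
      finally show "\<psi> (y \<oplus>\<^bsub>?D\<^esub> z) = \<psi> y \<oplus> \<psi> z" .
    next
      fix c z assume cz: "c \<in> carrier K \<and> z \<in> carrier ?D"
      have "\<psi> (c \<odot>\<^bsub>?D\<^esub> z) = lincomb (\<lambda>b. c \<otimes>\<^bsub>K\<^esub> z (\<phi> b)) B"
        unfolding \<psi>_def by (rule lincomb_cong) (use B cz zK \<phi> in \<open>auto simp: V.alt_dual_simps(4)\<close>)
      also have "\<dots> = c \<odot> \<psi> z"
        unfolding \<psi>_def by (rule lincomb_smult) (use B cz zK in auto)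
      finally show "\<psi> (c \<odot>\<^bsub>?D\<^esub> z) = c \<odot> \<psi> z" .
    qed
    fix x y assume xy: "x \<in> V" "y \<in> V"
    then have xyN: "x \<otimes> y \<in> carrier N" by (simp add: bracket_closed VNx)
    have "\<psi> (alt_eval K S ?V x y) = lincomb (\<lambda>b. coord b (x \<otimes> y)) B"
      unfolding \<psi>_def
      by (rule lincomb_cong) (use B xy xyN cl \<phi> in \<open>auto simp: alt_eval_def \<phi>_def\<close>)
    then show "\<psi> (alt_eval K S ?V x y) = x \<otimes> y" by (simp add: expand[OF xyN])
  qed
qed

text \<open>
  The values of \<open>\<psi>\<close> are central and invariant, since this holds for the values \<open>[x, y]\<close> on
  evaluations. Hence \<open>f (x, z) = x + \<psi> z\<close> respects brackets and the action. If \<open>x + \<psi> z = x' + \<psi> z'\<close>, then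
  \<open>x - x'\<close> is an invariant element of \<open>V\<close> and so vanishes.
\<close>

lemma almost_minimal_is_h_quotient:
  assumes am: "almost_minimal_s_algebra K S N"
  shows "\<exists>(V :: ('k, 's, 'a, 'l) smodule_scheme) Z. full_module K S V \<and> subspace K Z (alt_dual K S V) \<and>
    s_algebra_isomorphic K S N (h_quotient K S V Z)"
proof -
  let ?I = "{n \<in> carrier N. \<forall>s\<in>carrier S. act N s n = \<zero>}"
  note am' = am[unfolded almost_minimal_iff]
  have br3: "x \<otimes> (y \<otimes> z) = \<zero>" if "x \<in> carrier N" "y \<in> carrier N" "z \<in> carrier N" for x y z
    using am' that by blast
  have br3': "(x \<otimes> y) \<otimes> z = \<zero>" if "x \<in> carrier N" "y \<in> carrier N" "z \<in> carrier N" for x y z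
    using bracket_antisym[of "x \<otimes> y" z] br3[of z x y] that by (simp add: bracket_closed)
  have inv: "act N s (x \<otimes> y) = \<zero>" if "s \<in> carrier S" "x \<in> carrier N" "y \<in> carrier N" for s x y
    using am' that by blast
  have gen: "carrier N \<subseteq> H" if "lie_subalgebra K H N" "\<And>s x. s \<in> carrier S \<Longrightarrow> x \<in> carrier N \<Longrightarrow> act N s x \<in> H" for H
    using am' that by blast
  obtain V where full: "full_module K S (N\<lparr>carrier := V\<rparr>)" and Vsub: "s_submodule K S V N"
    and VI: "V \<inter> ?I = {\<zero>}" "V <+>\<^bsub>N\<^esub> ?I = carrier N"
    by (rule complement_of_invariants)
  note Vs = s_submoduleD(1)[OF Vsub] and Vact = s_submoduleD(2)[OF Vsub]
  note VD = subspaceD[OF Vs]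
  let ?V = "N\<lparr>carrier := V\<rparr>"
  interpret V: s_module K S ?V using full by (simp add: full_module_def)
  let ?D = "alt_dual K S ?V" and ?H = "h_algebra K S ?V"
  interpret D: vectorspace K ?D by (rule V.alt_dual_vectorspace)
  interpret H: lie_s_algebra K S ?H by (rule V.h_lie_s_algebra[OF full])
  have VNx: "x \<in> carrier N" if "x \<in> V" for x using that VD(1) by blast
  obtain \<psi> where \<psi>: "\<psi> \<in> module_hom K ?D N"
    and \<psi>_eval: "\<And>x y. x \<in> V \<Longrightarrow> y \<in> V \<Longrightarrow> \<psi> (alt_eval K S ?V x y) = x \<otimes> y"
    by (rule bracket_factorization[OF V.s_module_axioms VD(1)]) (use inv VNx in auto)
  have \<psi>_closed: "\<psi> z \<in> carrier N" if "z \<in> carrier ?D" for z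
    using \<psi> that by (auto simp: module_hom_def)
  have \<psi>_add: "\<psi> (y \<oplus>\<^bsub>?D\<^esub> z) = \<psi> y \<oplus> \<psi> z" if "y \<in> carrier ?D" "z \<in> carrier ?D" for y z
    using \<psi> that by (auto simp: module_hom_def)
  have \<psi>_smult: "\<psi> (c \<odot>\<^bsub>?D\<^esub> z) = c \<odot> \<psi> z" if "c \<in> carrier K" "z \<in> carrier ?D" for c z
    using \<psi> that by (auto simp: module_hom_def)
  have \<psi>_zero: "\<psi> \<zero>\<^bsub>?D\<^esub> = \<zero>"
    using \<psi>_smult[of "\<zero>\<^bsub>K\<^esub>" "\<zero>\<^bsub>?D\<^esub>"] \<psi>_closed[of "\<zero>\<^bsub>?D\<^esub>"] by simp
  let ?C = "{d \<in> ?I. \<forall>x\<in>carrier N. x \<otimes> d = \<zero> \<and> d \<otimes> x = \<zero>}"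
  have C: "subspace K ?C N"
    by (intro subspaceI[OF vectorspace_axioms])
      (auto simp: act_zero act_add_right act_smult_right bracket_zero_left bracket_zero_right
        bracket_add_left bracket_add_right bracket_smult_left bracket_smult_right)
  have "carrier ?D \<subseteq> {z \<in> carrier ?D. \<psi> z \<in> ?C}"
  proof (rule V.alt_dual_generated)
    show "subspace K {z \<in> carrier ?D. \<psi> z \<in> ?C} ?D"
      using subspace_vimage[of K ?D \<psi> N ?C, OF D.vectorspace_axioms \<psi> \<psi>_zero C] .
    fix x y assume "x \<in> carrier ?V" "y \<in> carrier ?V"
    then show "alt_eval K S ?V x y \<in> {z \<in> carrier ?D. \<psi> z \<in> ?C}"
      using V.alt_eval_closed[of x y] by (simp add: \<psi>_eval VNx bracket_closed inv br3 br3')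
  qed
  then have \<psi>C: "\<psi> z \<in> ?C" if "z \<in> carrier ?D" for z using that by blast
  have \<psi>_left: "\<psi> z \<otimes> x = \<zero>" and \<psi>_right: "x \<otimes> \<psi> z = \<zero>"
    if "z \<in> carrier ?D" "x \<in> carrier N" for x z
    using \<psi>C[OF that(1)] that(2) by blast+
  have \<psi>_act: "act N s (\<psi> z) = \<zero>" if "z \<in> carrier ?D" "s \<in> carrier S" for s z
    using \<psi>C[OF that(1)] that(2) by blast
  define f where "f p = fst p \<oplus> \<psi> (snd p)" for p
  have Hc: "fst p \<in> V" "fst p \<in> carrier N" "snd p \<in> carrier ?D" "\<psi> (snd p) \<in> carrier N" if "p \<in> carrier ?H" for p
    using that \<psi>_closed VNx by (auto simp: h_algebra_simps)
  have f_closed: "f p \<in> carrier N" if "p \<in> carrier ?H" for p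
    using Hc[OF that] by (simp add: f_def)
  have f_zero: "f \<zero>\<^bsub>?H\<^esub> = \<zero>" by (simp add: f_def h_algebra_simps \<psi>_zero)
  have f_add: "f (p \<oplus>\<^bsub>?H\<^esub> q) = f p \<oplus> f q" if "p \<in> carrier ?H" "q \<in> carrier ?H" for p q
    using Hc[OF that(1)] Hc[OF that(2)] by (simp add: f_def h_algebra_simps \<psi>_add M.a_ac)
  have f_smult: "f (c \<odot>\<^bsub>?H\<^esub> p) = c \<odot> f p" if "c \<in> carrier K" "p \<in> carrier ?H" for c p
    using that(1) Hc[OF that(2)] by (simp add: f_def h_algebra_simps \<psi>_smult smult_r_distr)
  have f_bracket: "f (p \<otimes>\<^bsub>?H\<^esub> q) = f p \<otimes> f q" if "p \<in> carrier ?H" "q \<in> carrier ?H" for p q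
    using Hc[OF that(1)] Hc[OF that(2)]
    by (simp add: f_def h_algebra_simps \<psi>_eval bracket_add_left bracket_add_right bracket_closed \<psi>_left \<psi>_right)
  have f_act: "f (act ?H s p) = act N s (f p)" if "s \<in> carrier S" "p \<in> carrier ?H" for s p
    using that(1) Hc[OF that(2)]
    by (simp add: f_def h_algebra_simps act_add_right \<psi>_act \<psi>_zero act_closed)
  have f_hom: "f \<in> module_hom K ?H N"
    using f_closed f_add f_smult by (simp add: module_hom_def)
  have "carrier N \<subseteq> f ` carrier ?H"
  proof (rule gen)
    show "lie_subalgebra K (f ` carrier ?H) N"
    proof (rule lie_subalgebraI)
      have "subspace K (carrier ?H) ?H" by (rule subspaceI[OF H.vectorspace_axioms]) auto
      then show "subspace K (f ` carrier ?H) N"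
        by (rule subspace_image[OF H.vectorspace_axioms vectorspace_axioms f_hom f_zero])
      fix x y assume "x \<in> f ` carrier ?H" "y \<in> f ` carrier ?H"
      then obtain p q where pq: "p \<in> carrier ?H" "q \<in> carrier ?H" "x = f p" "y = f q" by blast
      have "x \<otimes> y = f (p \<otimes>\<^bsub>?H\<^esub> q)" using f_bracket[OF pq(1,2)] pq(3,4) by simp
      then show "x \<otimes> y \<in> f ` carrier ?H" using H.bracket_closed[OF pq(1,2)] by (simp only: imageI)
    qed
    fix s n assume s: "s \<in> carrier S" and "n \<in> carrier N"
    then have "n \<in> V <+>\<^bsub>N\<^esub> ?I" using VI(2) by simp
    then obtain v i where vi: "v \<in> V" "i \<in> ?I" "n = v \<oplus> i" by (rule set_addE)
    have "act N s n = f (act N s v, \<zero>\<^bsub>?D\<^esub>)"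
      using vi s VNx by (auto simp: f_def \<psi>_zero act_add_right act_closed)
    moreover have "(act N s v, \<zero>\<^bsub>?D\<^esub>) \<in> carrier ?H" using Vact[OF s vi(1)] by (simp add: h_algebra_simps)
    ultimately show "act N s n \<in> f ` carrier ?H" by (simp only: imageI)
  qed
  then have f_epi: "f \<in> s_algebra_epi K S ?H N"
    using f_closed by (intro s_algebra_epiI f_zero f_add f_smult f_bracket f_act) auto
  let ?Z = "{z \<in> carrier ?D. \<psi> z \<in> {\<zero>}}"
  have zsub: "subspace K {\<zero>} N" by (rule lie_subalgebraD(1)[OF lie_subalgebra_zero])
  have Z: "subspace K ?Z ?D" by (rule subspace_vimage[of K ?D \<psi> N "{\<zero>}", OF D.vectorspace_axioms \<psi> \<psi>_zero zsub])
  note quot = V.h_quotient_epi[OF full Z]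
  have "f p = f q \<longleftrightarrow> fst p = fst q \<and> snd p \<ominus>\<^bsub>?D\<^esub> snd q \<in> ?Z"
    if pq: "p \<in> carrier ?H" "q \<in> carrier ?H" for p q
  proof -
    note p = Hc[OF pq(1)] and q = Hc[OF pq(2)]
    have d: "snd p \<ominus>\<^bsub>?D\<^esub> snd q \<in> carrier ?D" using p q by simp
    have \<psi>p: "\<psi> (snd p) = \<psi> (snd p \<ominus>\<^bsub>?D\<^esub> snd q) \<oplus> \<psi> (snd q)"
      using p q d by (simp add: \<psi>_add[symmetric] D.minus_add_cancel)
    have Zd: "snd p \<ominus>\<^bsub>?D\<^esub> snd q \<in> ?Z \<longleftrightarrow> \<psi> (snd p) = \<psi> (snd q)"
      using \<psi>p d \<psi>_closed[OF d] q(4) by (auto simp: M.add.r_cancel_one)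
    have "fst p = fst q" if eq: "f p = f q"
    proof -
      have "act N s (fst p \<ominus> fst q) = \<zero>" if s: "s \<in> carrier S" for s
      proof -
        have "act N s (fst p) = act N s (f p)" "act N s (fst q) = act N s (f q)"
          using s p q by (simp_all add: f_def act_add_right \<psi>_act act_closed)
        then have e: "act N s (fst p) = act N s (fst q)" using eq by simp
        have "act N s (fst p \<ominus> fst q) \<oplus> act N s (fst q) = act N s (fst p)"
          using s p q by (simp add: act_add_right[symmetric] minus_add_cancel)
        then show ?thesis using e s p q by (simp add: M.add.r_cancel_one act_closed)
      qed
      then have "fst p \<ominus> fst q \<in> V \<inter> ?I"
        using subspace_minus[OF Vs p(1) q(1)] p q by simp
      then have "fst p \<ominus> fst q = \<zero>" unfolding VI(1) by simp
      then show ?thesis using p q by (simp add: minus_eq_zero_iff)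
    qed
    moreover have "f p = f q \<longleftrightarrow> \<psi> (snd p) = \<psi> (snd q)" if "fst p = fst q"
      unfolding f_def that using p q by (metis M.a_comm add_minus_cancel)
    ultimately show ?thesis unfolding Zd by blast
  qed
  then have "s_algebra_isomorphic K S N (h_quotient K S ?V ?Z)"
    by (intro isomorphic_if_same_kernel[OF H.lie_s_algebra_axioms f_epi quot(1)]) (simp only: quot(2))
  with full Z show ?thesis by blast
qed

end

section \<open>Isomorphisms between quotients\<close>

text \<open>
  The contravariant action on forms to which the action on functionals is dual.
\<close>

definition alt_pullback :: "('k, 's, 'v, 'l) smodule_scheme \<Rightarrow> ('v \<Rightarrow> 'v) \<Rightarrow> ('v \<times> 'v \<Rightarrow> 'k) \<Rightarrow> ('v \<times> 'v \<Rightarrow> 'k)" where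
  "alt_pullback V g \<phi> = (\<lambda>(x, y)\<in>carrier V \<times> carrier V. \<phi> (g x, g y))"

lemma alt_dual_action_eq:
  "alt_dual_action K S V g z = (\<lambda>\<phi>\<in>carrier (alt_space K S V). z (alt_pullback V g \<phi>))"
  by (simp add: alt_dual_action_def alt_pullback_def)

lemma module_autD:
  assumes "g \<in> carrier (module_aut_group K S V)"
  shows "\<And>x. x \<in> carrier V \<Longrightarrow> g x \<in> carrier V"
    "\<And>x y. x \<in> carrier V \<Longrightarrow> y \<in> carrier V \<Longrightarrow> g (x \<oplus>\<^bsub>V\<^esub> y) = g x \<oplus>\<^bsub>V\<^esub> g y"
    "\<And>c x. c \<in> carrier K \<Longrightarrow> x \<in> carrier V \<Longrightarrow> g (c \<odot>\<^bsub>V\<^esub> x) = c \<odot>\<^bsub>V\<^esub> g x"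
    "\<And>s x. s \<in> carrier S \<Longrightarrow> x \<in> carrier V \<Longrightarrow> g (act V s x) = act V s (g x)"
    "bij_betw g (carrier V) (carrier V)"
  using assms by (auto simp: module_aut_group_def module_hom_def Bij_def)

lemma module_autI:
  assumes "\<And>x. x \<in> carrier V \<Longrightarrow> g x \<in> carrier V"
    "\<And>x y. x \<in> carrier V \<Longrightarrow> y \<in> carrier V \<Longrightarrow> g (x \<oplus>\<^bsub>V\<^esub> y) = g x \<oplus>\<^bsub>V\<^esub> g y"
    "\<And>c x. c \<in> carrier K \<Longrightarrow> x \<in> carrier V \<Longrightarrow> g (c \<odot>\<^bsub>V\<^esub> x) = c \<odot>\<^bsub>V\<^esub> g x"
    "\<And>s x. s \<in> carrier S \<Longrightarrow> x \<in> carrier V \<Longrightarrow> g (act V s x) = act V s (g x)"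
    "bij_betw g (carrier V) (carrier V)" "g \<in> extensional (carrier V)"
  shows "g \<in> carrier (module_aut_group K S V)"
  using assms by (auto simp: module_aut_group_def module_hom_def Bij_def)

context s_module
begin

lemma module_aut_inverse:
  assumes g: "g \<in> carrier (module_aut_group K S V)"
  obtains k where "k \<in> carrier (module_aut_group K S V)"
    "\<And>x. x \<in> carrier V \<Longrightarrow> g (k x) = x" "\<And>x. x \<in> carrier V \<Longrightarrow> k (g x) = x"
proof -
  note gD = module_autD[OF g]
  define k where "k = (\<lambda>x\<in>carrier V. inv_into (carrier V) g x)"
  have inj: "inj_on g (carrier V)" and surj: "g ` carrier V = carrier V"
    using gD(5) by (auto simp: bij_betw_def)
  have gk: "g (k x) = x" "k x \<in> carrier V" if "x \<in> carrier V" for x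
    using that surj by (auto simp: k_def f_inv_into_f inv_into_into)
  have kg: "k (g x) = x" if "x \<in> carrier V" for x
    using that gD(1)[OF that] by (simp add: k_def inv_into_f_f[OF inj that])
  have eqI: "x = y" if "g x = g y" "x \<in> carrier V" "y \<in> carrier V" for x y
    using inj_onD[OF inj that] .
  have "k \<in> carrier (module_aut_group K S V)"
  proof (rule module_autI)
    show "bij_betw k (carrier V) (carrier V)"
      unfolding k_def using bij_betw_inv_into[OF gD(5)] by (simp cong: bij_betw_cong)
    show "k \<in> extensional (carrier V)" by (simp add: k_def)
  next
    fix x y assume "x \<in> carrier V" "y \<in> carrier V"
    then show "k (x \<oplus> y) = k x \<oplus> k y" by - (rule eqI, simp_all add: gk gD)
  next
    fix c x assume "c \<in> carrier K" "x \<in> carrier V"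
    then show "k (c \<odot> x) = c \<odot> k x" by - (rule eqI, simp_all add: gk gD)
  next
    fix s x assume "s \<in> carrier S" "x \<in> carrier V"
    then show "k (act V s x) = act V s (k x)" by - (rule eqI, simp_all add: gk gD act_closed)
  qed (rule gk)
  then show thesis using that gk(1) kg by blast
qed

lemma module_aut_id: "(\<lambda>x\<in>carrier V. x) \<in> carrier (module_aut_group K S V)"
  by (rule module_autI) (auto simp: act_closed bij_betw_def inj_on_def)

lemma alt_pullback_closed:
  assumes g: "g \<in> carrier (module_aut_group K S V)" and \<phi>: "\<phi> \<in> carrier (alt_space K S V)"
  shows "alt_pullback V g \<phi> \<in> carrier (alt_space K S V)"
proof -
  note A = alt_space_simps[OF S.R.ring_axioms, of S V] and gD = module_autD[OF g]
  show ?thesis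
    using \<phi> alt_space_closed[OF \<phi>] gD(1)
    by (auto simp: A alt_pullback_def gD act_closed)
qed

lemma alt_pullback_pullback:
  assumes "\<phi> \<in> carrier (alt_space K S V)" "k \<in> carrier (module_aut_group K S V)"
    and "\<And>x. x \<in> carrier V \<Longrightarrow> g (k x) = x"
  shows "alt_pullback V k (alt_pullback V g \<phi>) = \<phi>"
proof -
  note A = alt_space_simps[OF S.R.ring_axioms, of S V]
  show ?thesis
  proof (rule extensionalityI[of _ "carrier V \<times> carrier V"])
    show "\<phi> \<in> extensional (carrier V \<times> carrier V)" using assms(1) by (auto simp: A PiE_def)
  qed (auto simp: alt_pullback_def assms(3) module_autD(1)[OF assms(2)])
qed

lemma alt_dual_action_closed:
  assumes g: "g \<in> carrier (module_aut_group K S V)" and z: "z \<in> carrier (alt_dual K S V)"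
  shows "alt_dual_action K S V g z \<in> carrier (alt_dual K S V)"
proof -
  interpret A: vectorspace K "alt_space K S V" by (rule alt_space_vectorspace)
  note pb = alt_pullback_closed[OF g] and gD = module_autD[OF g]
  have add: "alt_pullback V g (\<phi> \<oplus>\<^bsub>alt_space K S V\<^esub> \<psi>) = alt_pullback V g \<phi> \<oplus>\<^bsub>alt_space K S V\<^esub> alt_pullback V g \<psi>" for \<phi> \<psi>
    by (auto simp: alt_pullback_def alt_space_simps[OF S.R.ring_axioms] fun_eq_iff gD(1))
  have smult: "alt_pullback V g (c \<odot>\<^bsub>alt_space K S V\<^esub> \<phi>) = c \<odot>\<^bsub>alt_space K S V\<^esub> alt_pullback V g \<phi>" for c \<phi>
    by (auto simp: alt_pullback_def alt_space_simps[OF S.R.ring_axioms] fun_eq_iff gD(1))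
  show ?thesis
    using z pb by (auto simp: alt_dual_simps alt_dual_action_eq add smult)
qed

lemma alt_dual_action_add:
  assumes g: "g \<in> carrier (module_aut_group K S V)"
  shows "alt_dual_action K S V g (y \<oplus>\<^bsub>alt_dual K S V\<^esub> z) =
    alt_dual_action K S V g y \<oplus>\<^bsub>alt_dual K S V\<^esub> alt_dual_action K S V g z"
  using alt_pullback_closed[OF g] by (auto simp: alt_dual_simps alt_dual_action_eq fun_eq_iff)

lemma alt_dual_action_smult:
  assumes g: "g \<in> carrier (module_aut_group K S V)"
  shows "alt_dual_action K S V g (c \<odot>\<^bsub>alt_dual K S V\<^esub> z) = c \<odot>\<^bsub>alt_dual K S V\<^esub> alt_dual_action K S V g z"
  using alt_pullback_closed[OF g] by (auto simp: alt_dual_simps alt_dual_action_eq fun_eq_iff)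

lemma alt_dual_action_zero:
  assumes g: "g \<in> carrier (module_aut_group K S V)"
  shows "alt_dual_action K S V g \<zero>\<^bsub>alt_dual K S V\<^esub> = \<zero>\<^bsub>alt_dual K S V\<^esub>"
  using alt_pullback_closed[OF g] by (auto simp: alt_dual_simps alt_dual_action_eq fun_eq_iff)

lemma alt_dual_action_eval:
  assumes g: "g \<in> carrier (module_aut_group K S V)" and "x \<in> carrier V" "y \<in> carrier V"
  shows "alt_dual_action K S V g (alt_eval K S V x y) = alt_eval K S V (g x) (g y)"
proof -
  have "alt_eval K S V x y (alt_pullback V g \<phi>) = \<phi> (g x, g y)" if "\<phi> \<in> carrier (alt_space K S V)" for \<phi>
    using alt_pullback_closed[OF g that] assms(2,3) by (simp add: alt_eval_def alt_pullback_def)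
  then show ?thesis by (auto simp: alt_dual_action_eq alt_eval_def fun_eq_iff)
qed

lemma alt_dual_action_inverse:
  assumes g: "g \<in> carrier (module_aut_group K S V)" and k: "k \<in> carrier (module_aut_group K S V)"
    and inv: "\<And>x. x \<in> carrier V \<Longrightarrow> g (k x) = x" and z: "z \<in> carrier (alt_dual K S V)"
  shows "alt_dual_action K S V g (alt_dual_action K S V k z) = z"
proof (rule extensionalityI[of _ "carrier (alt_space K S V)"])
  show "z \<in> extensional (carrier (alt_space K S V))" using z by (auto simp: alt_dual_simps PiE_def)
  fix \<phi> assume \<phi>: "\<phi> \<in> carrier (alt_space K S V)"
  then show "alt_dual_action K S V g (alt_dual_action K S V k z) \<phi> = z \<phi>"
    using alt_pullback_closed[OF g \<phi>] alt_pullback_pullback[OF \<phi> k inv]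
    by (simp add: alt_dual_action_eq)
qed (simp add: alt_dual_action_eq)

lemma alt_dual_action_id:
  assumes z: "z \<in> carrier (alt_dual K S V)"
  shows "alt_dual_action K S V (\<lambda>x\<in>carrier V. x) z = z"
proof (rule extensionalityI[of _ "carrier (alt_space K S V)"])
  show "z \<in> extensional (carrier (alt_space K S V))" using z by (auto simp: alt_dual_simps PiE_def)
  fix \<phi> assume \<phi>: "\<phi> \<in> carrier (alt_space K S V)"
  have "alt_pullback V (\<lambda>x\<in>carrier V. x) \<phi> = \<phi>"
  proof (rule extensionalityI[of _ "carrier V \<times> carrier V"])
    show "\<phi> \<in> extensional (carrier V \<times> carrier V)"
      using \<phi> by (auto simp: alt_space_simps[OF S.R.ring_axioms] PiE_def)
  qed (auto simp: alt_pullback_def)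
  then show "alt_dual_action K S V (\<lambda>x\<in>carrier V. x) z \<phi> = z \<phi>"
    using \<phi> by (simp add: alt_dual_action_eq)
qed (simp add: alt_dual_action_eq)

lemma alt_dual_action_bij:
  assumes g: "g \<in> carrier (module_aut_group K S V)"
  shows "bij_betw (alt_dual_action K S V g) (carrier (alt_dual K S V)) (carrier (alt_dual K S V))"
proof -
  obtain k where k: "k \<in> carrier (module_aut_group K S V)"
    "\<And>x. x \<in> carrier V \<Longrightarrow> g (k x) = x" "\<And>x. x \<in> carrier V \<Longrightarrow> k (g x) = x"
    using module_aut_inverse[OF g] by blast
  show ?thesis
    by (rule bij_betw_byWitness[where f' = "alt_dual_action K S V k"])
      (auto simp: alt_dual_action_inverse[OF g k(1) k(2)] alt_dual_action_inverse[OF k(1) g k(3)]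
        alt_dual_action_closed[OF g] alt_dual_action_closed[OF k(1)])
qed

lemma alt_dual_action_minus:
  assumes g: "g \<in> carrier (module_aut_group K S V)"
    and yz: "y \<in> carrier (alt_dual K S V)" "z \<in> carrier (alt_dual K S V)"
  shows "alt_dual_action K S V g (y \<ominus>\<^bsub>alt_dual K S V\<^esub> z) =
    alt_dual_action K S V g y \<ominus>\<^bsub>alt_dual K S V\<^esub> alt_dual_action K S V g z"
proof -
  interpret D: vectorspace K "alt_dual K S V" by (rule alt_dual_vectorspace)
  have "alt_dual_action K S V g y = alt_dual_action K S V g (y \<ominus>\<^bsub>alt_dual K S V\<^esub> z)
      \<oplus>\<^bsub>alt_dual K S V\<^esub> alt_dual_action K S V g z"
    using yz by (simp add: alt_dual_action_add[OF g, symmetric] D.minus_add_cancel)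
  then show ?thesis
    using D.add_minus_cancel[of "alt_dual_action K S V g (y \<ominus>\<^bsub>alt_dual K S V\<^esub> z)" "alt_dual_action K S V g z"]
      alt_dual_action_closed[OF g] yz by simp
qed

text \<open>
  The automorphism \<open>\<theta> = g \<times> g\<close> of \<open>h(V)\<close> carries \<open>X\<close> to \<open>Z\<close>, so its composition with the projection to
  \<open>h(V)/Z\<close> has kernel \<open>0 \<times> X\<close>.
\<close>

lemma module_aut_quotient_epi:
  assumes full: "full_module K S V" and X: "subspace K X (alt_dual K S V)"
    and Z: "subspace K Z (alt_dual K S V)" and g: "g \<in> carrier (module_aut_group K S V)"
    and gX: "Z = alt_dual_action K S V g ` X"
  shows "\<exists>p\<in>s_algebra_epi K S (h_algebra K S V) (h_quotient K S V Z).
    \<forall>a\<in>carrier (h_algebra K S V). \<forall>b\<in>carrier (h_algebra K S V).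
      p a = p b \<longleftrightarrow> fst a = fst b \<and> snd a \<ominus>\<^bsub>alt_dual K S V\<^esub> snd b \<in> X"
proof -
  let ?H = "h_algebra K S V" and ?D = "alt_dual K S V" and ?T = "alt_dual_action K S V g"
  interpret D: vectorspace K ?D by (rule alt_dual_vectorspace)
  note gD = module_autD[OF g] and q = h_quotient_epi[OF full Z]
  note bij = alt_dual_action_bij[OF g] and Tc = alt_dual_action_closed[OF g]
  define \<theta> where "\<theta> p = (g (fst p), ?T (snd p))" for p
  have \<theta>c: "\<theta> a \<in> carrier ?H" if "a \<in> carrier ?H" for a
    using that by (auto simp: \<theta>_def h_algebra_simps gD Tc)
  have g0: "g \<zero> = \<zero>"
    using gD(3)[of "\<zero>\<^bsub>K\<^esub>" \<zero>] gD(1)[of \<zero>] by simp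
  have \<theta>: "\<theta> \<in> s_algebra_epi K S ?H ?H"
  proof (rule s_algebra_epiI)
    have "\<theta> ` carrier ?H = (g ` carrier V) \<times> (?T ` carrier ?D)"
      unfolding \<theta>_def h_algebra_simps by force
    then show "\<theta> ` carrier ?H = carrier ?H"
      using gD(5) bij by (simp add: h_algebra_simps bij_betw_def)
  qed (auto simp: \<theta>_def h_algebra_simps g0 gD alt_dual_action_zero[OF g] alt_dual_action_add[OF g]
      alt_dual_action_smult[OF g] alt_dual_action_eval[OF g])
  show ?thesis
  proof (intro bexI[OF _ epi_comp[OF \<theta> q(1)]] ballI)
    fix a b assume ab: "a \<in> carrier ?H" "b \<in> carrier ?H"
    then have c: "fst a \<in> carrier V" "fst b \<in> carrier V" "snd a \<in> carrier ?D" "snd b \<in> carrier ?D"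
      by (auto simp: h_algebra_simps)
    have XD: "X \<subseteq> carrier ?D" by (rule subspaceD(1)[OF X])
    have "g (fst a) = g (fst b) \<longleftrightarrow> fst a = fst b"
      using gD(5) c by (auto simp: bij_betw_def inj_on_def)
    moreover have "?T (snd a) \<ominus>\<^bsub>?D\<^esub> ?T (snd b) \<in> Z \<longleftrightarrow> snd a \<ominus>\<^bsub>?D\<^esub> snd b \<in> X"
      unfolding gX alt_dual_action_minus[OF g c(3,4), symmetric]
      using bij c XD by (intro inj_on_image_mem_iff[of _ "carrier ?D"]) (auto simp: bij_betw_def)
    ultimately show "({\<zero>} \<times> Z) +>\<^bsub>?H\<^esub> \<theta> a = ({\<zero>} \<times> Z) +>\<^bsub>?H\<^esub> \<theta> b \<longleftrightarrow>
        fst a = fst b \<and> snd a \<ominus>\<^bsub>?D\<^esub> snd b \<in> X"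
      unfolding q(2)[OF \<theta>c[OF ab(1)] \<theta>c[OF ab(2)]] by (simp add: \<theta>_def)
  qed
qed

text \<open>
  Two quotients of \<open>h(V)\<close> that are identified with one algebra \<open>M\<close> are here two surjections \<open>u\<close> and \<open>q\<close>
  onto \<open>M\<close>. For \<open>a\<close> in \<open>h(V)\<close> let \<open>G a\<close> be the first component of any \<open>b\<close> with \<open>u a = q b\<close>; the kernel of \<open>q\<close>
  makes it well defined. It vanishes on the second summand, whose elements are invariant, and its
  restriction \<open>g\<close> to \<open>V\<close> is the required automorphism: if \<open>g x = 0\<close>, then \<open>u\<close> kills \<open>[S, x]\<close>, and the
  kernel of \<open>u\<close> forces \<open>[S, x] = 0\<close>, that is, \<open>x = 0\<close>.
\<close>

lemma common_quotient_module_aut: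
  assumes full: "full_module K S V"
    and Z: "subspace K Z (alt_dual K S V)" and Z': "subspace K Z' (alt_dual K S V)"
    and u: "u \<in> s_algebra_epi K S (h_algebra K S V) M" and q: "q \<in> s_algebra_epi K S (h_algebra K S V) M"
    and ku: "\<And>a b. a \<in> carrier (h_algebra K S V) \<Longrightarrow> b \<in> carrier (h_algebra K S V) \<Longrightarrow>
      u a = u b \<longleftrightarrow> fst a = fst b \<and> snd a \<ominus>\<^bsub>alt_dual K S V\<^esub> snd b \<in> Z"
    and kq: "\<And>a b. a \<in> carrier (h_algebra K S V) \<Longrightarrow> b \<in> carrier (h_algebra K S V) \<Longrightarrow>
      q a = q b \<longleftrightarrow> fst a = fst b \<and> snd a \<ominus>\<^bsub>alt_dual K S V\<^esub> snd b \<in> Z'"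
  shows "\<exists>g\<in>carrier (module_aut_group K S V). Z' = alt_dual_action K S V g ` Z"
proof -
  let ?H = "h_algebra K S V" and ?D = "alt_dual K S V"
  interpret D: vectorspace K ?D by (rule alt_dual_vectorspace)
  interpret H: lie_s_algebra K S ?H by (rule h_lie_s_algebra[OF full])
  note uD = s_algebra_epiD[OF u] and qD = s_algebra_epiD[OF q]
  have inv_zero: "x = \<zero>" if "x \<in> carrier V" "\<And>s. s \<in> carrier S \<Longrightarrow> act V s x = \<zero>" for x
    using full that unfolding full_module_iff by blast
  have Hfst: "fst a \<in> carrier V" "snd a \<in> carrier ?D" if "a \<in> carrier ?H" for a
    using that by (auto simp: h_algebra_simps)
  have Vin: "(x, \<zero>\<^bsub>?D\<^esub>) \<in> carrier ?H" if "x \<in> carrier V" for x using that by (simp add: h_algebra_simps)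
  have Din: "(\<zero>, z) \<in> carrier ?H" if "z \<in> carrier ?D" for z using that by (simp add: h_algebra_simps)
  define G where "G a = fst (inv_into (carrier ?H) q (u a))" for a
  have G: "G a = fst b" if "a \<in> carrier ?H" "b \<in> carrier ?H" "u a = q b" for a b
  proof -
    let ?r = "inv_into (carrier ?H) q (u a)"
    have "u a \<in> q ` carrier ?H" using uD(3)[OF that(1)] qD(1) by simp
    then have "?r \<in> carrier ?H" "q ?r = q b"
      using that(3) by (simp_all add: inv_into_into f_inv_into_f)
    then show ?thesis using kq[of ?r b] that(2) by (simp add: G_def)
  qed
  have lift: "\<exists>b\<in>carrier ?H. u a = q b" if "a \<in> carrier ?H" for a
    using uD(3)[OF that] qD(1) by blast
  have G_closed: "G a \<in> carrier V" if a: "a \<in> carrier ?H" for a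
  proof -
    obtain b where "b \<in> carrier ?H" "u a = q b" using lift[OF a] by blast
    then show ?thesis using G[OF a] Hfst(1) by simp
  qed
  have G_add: "G (a \<oplus>\<^bsub>?H\<^esub> b) = G a \<oplus> G b" if ab: "a \<in> carrier ?H" "b \<in> carrier ?H" for a b
  proof -
    obtain a' b' where *: "a' \<in> carrier ?H" "u a = q a'" "b' \<in> carrier ?H" "u b = q b'"
      using lift ab by meson
    then have "u (a \<oplus>\<^bsub>?H\<^esub> b) = q (a' \<oplus>\<^bsub>?H\<^esub> b')" using ab by (simp add: uD qD)
    then have "G (a \<oplus>\<^bsub>?H\<^esub> b) = fst (a' \<oplus>\<^bsub>?H\<^esub> b')" using ab * by (intro G) auto
    also have "\<dots> = G a \<oplus> G b" using G[OF ab(1) *(1,2)] G[OF ab(2) *(3,4)] by (simp add: h_algebra_simps)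
    finally show ?thesis .
  qed
  have G_smult: "G (c \<odot>\<^bsub>?H\<^esub> a) = c \<odot> G a" if c: "c \<in> carrier K" and a: "a \<in> carrier ?H" for c a
  proof -
    obtain a' where *: "a' \<in> carrier ?H" "u a = q a'" using lift a by meson
    then have "u (c \<odot>\<^bsub>?H\<^esub> a) = q (c \<odot>\<^bsub>?H\<^esub> a')" using a c by (simp add: uD qD)
    then have "G (c \<odot>\<^bsub>?H\<^esub> a) = fst (c \<odot>\<^bsub>?H\<^esub> a')" using a c * by (intro G) auto
    also have "\<dots> = c \<odot> G a" using G[OF a *] by (simp add: h_algebra_simps)
    finally show ?thesis .
  qed
  have G_act: "G (act ?H s a) = act V s (G a)" if s: "s \<in> carrier S" and a: "a \<in> carrier ?H" for s a
  proof -
    obtain a' where *: "a' \<in> carrier ?H" "u a = q a'" using lift a by meson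
    then have "u (act ?H s a) = q (act ?H s a')" using a s by (simp add: uD qD)
    then have "G (act ?H s a) = fst (act ?H s a')" using a s * by (intro G) (auto simp: H.act_closed)
    also have "\<dots> = act V s (G a)" using G[OF a *] by (simp add: h_algebra_simps)
    finally show ?thesis .
  qed
  have G_zero: "G \<zero>\<^bsub>?H\<^esub> = \<zero>"
    using G[of "\<zero>\<^bsub>?H\<^esub>" "\<zero>\<^bsub>?H\<^esub>"] uD(2) qD(2) by (simp add: h_algebra_simps(2) H.M.zero_closed[unfolded h_algebra_simps(2)])
  have G_center: "G (\<zero>, z) = \<zero>" if z: "z \<in> carrier ?D" for z
  proof (rule inv_zero)
    show "G (\<zero>, z) \<in> carrier V" using G_closed Din[OF z] .
    fix s assume s: "s \<in> carrier S"
    have "act V s (G (\<zero>, z)) = G (act ?H s (\<zero>, z))" using G_act[OF s Din[OF z]] by simp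
    also have "act ?H s (\<zero>, z) = \<zero>\<^bsub>?H\<^esub>" using s by (simp add: h_algebra_simps act_zero)
    finally show "act V s (G (\<zero>, z)) = \<zero>" using G_zero by simp
  qed
  have G_fst: "G a = G (fst a, \<zero>\<^bsub>?D\<^esub>)" if a: "a \<in> carrier ?H" for a
  proof -
    have c: "fst a \<in> carrier V" "snd a \<in> carrier ?D" using Hfst[OF a] .
    have "a = (fst a, \<zero>\<^bsub>?D\<^esub>) \<oplus>\<^bsub>?H\<^esub> (\<zero>, snd a)" using c by (simp add: h_algebra_simps prod_eq_iff)
    then have "G a = G ((fst a, \<zero>\<^bsub>?D\<^esub>) \<oplus>\<^bsub>?H\<^esub> (\<zero>, snd a))" by (rule arg_cong)
    also have "\<dots> = G (fst a, \<zero>\<^bsub>?D\<^esub>)"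
      using G_add[OF Vin[OF c(1)] Din[OF c(2)]] G_center[OF c(2)] G_closed[OF Vin[OF c(1)]] by simp
    finally show ?thesis .
  qed
  define g where "g = (\<lambda>x\<in>carrier V. G (x, \<zero>\<^bsub>?D\<^esub>))"
  have g_eq: "g x = G (x, \<zero>\<^bsub>?D\<^esub>)" if "x \<in> carrier V" for x using that by (simp add: g_def)
  have g_closed: "g x \<in> carrier V" if "x \<in> carrier V" for x using g_eq[OF that] G_closed[OF Vin[OF that]] by simp
  have g_add: "g (x \<oplus> y) = g x \<oplus> g y" if "x \<in> carrier V" "y \<in> carrier V" for x y
    using G_add[OF Vin[OF that(1)] Vin[OF that(2)]] that by (simp add: g_eq h_algebra_simps)
  have g_smult: "g (c \<odot> x) = c \<odot> g x" if "c \<in> carrier K" "x \<in> carrier V" for c x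
    using G_smult[OF that(1) Vin[OF that(2)]] that by (simp add: g_eq h_algebra_simps)
  have g_act: "g (act V s x) = act V s (g x)" if "s \<in> carrier S" "x \<in> carrier V" for s x
    using G_act[OF that(1) Vin[OF that(2)]] that by (simp add: g_eq h_algebra_simps act_closed)
  have g_ker: "x = \<zero>" if x: "x \<in> carrier V" and gx: "g x = \<zero>" for x
  proof (rule inv_zero[OF x])
    fix s assume s: "s \<in> carrier S"
    obtain b where b: "b \<in> carrier ?H" "u (x, \<zero>\<^bsub>?D\<^esub>) = q b" using lift[OF Vin[OF x]] by blast
    have "fst b = \<zero>" using G[OF Vin[OF x] b] gx g_eq[OF x] by simp
    then have "act ?H s b = \<zero>\<^bsub>?H\<^esub>" using s by (simp add: h_algebra_simps act_zero)
    then have "u (act ?H s (x, \<zero>\<^bsub>?D\<^esub>)) = u \<zero>\<^bsub>?H\<^esub>"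
      using uD(7)[OF s Vin[OF x]] qD(7)[OF s b(1)] b(2) uD(2) qD(2) by simp
    then have "fst (act ?H s (x, \<zero>\<^bsub>?D\<^esub>)) = fst \<zero>\<^bsub>?H\<^esub>"
      using ku H.act_closed[OF s Vin[OF x]] H.M.zero_closed by blast
    then show "act V s x = \<zero>" by (simp add: h_algebra_simps)
  qed
  have "inj_on g (carrier V)"
  proof (rule inj_onI)
    fix x y assume xy: "x \<in> carrier V" "y \<in> carrier V" "g x = g y"
    have "g (x \<ominus> y) \<oplus> g y = g x" using xy by (simp add: g_add[symmetric] minus_add_cancel)
    then have g0: "g (x \<ominus> y) = \<zero>" using xy g_closed by (simp add: M.add.r_cancel_one)
    have "x \<ominus> y = \<zero>" by (rule g_ker[OF _ g0]) (use xy(1,2) in simp)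
    then show "x = y" using xy by (simp add: minus_eq_zero_iff)
  qed
  moreover have "g ` carrier V = carrier V"
  proof (intro equalityI subsetI)
    fix v assume v: "v \<in> carrier V"
    have "q (v, \<zero>\<^bsub>?D\<^esub>) \<in> u ` carrier ?H" using qD(3)[OF Vin[OF v]] uD(1) by simp
    then obtain a where a: "a \<in> carrier ?H" "u a = q (v, \<zero>\<^bsub>?D\<^esub>)" by force
    have "v = g (fst a)" using G[OF a(1) Vin[OF v] a(2)] G_fst[OF a(1)] g_eq[OF Hfst(1)[OF a(1)]] by simp
    then show "v \<in> g ` carrier V" using Hfst(1)[OF a(1)] by (simp only: imageI)
  qed (auto simp: g_closed)
  ultimately have gaut: "g \<in> carrier (module_aut_group K S V)"
    by (intro module_autI g_closed g_add g_smult g_act) (auto simp: bij_betw_def g_def)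
  let ?T = "alt_dual_action K S V g"
  note Tc = alt_dual_action_closed[OF gaut]
  \<comment> \<open>Both sides are linear in \<open>z\<close>, and for an evaluation they are brackets in \<open>M\<close>.\<close>
  have "carrier ?D \<subseteq> {z \<in> carrier ?D. u (\<zero>, z) = q (\<zero>, ?T z)}"
  proof (rule alt_dual_generated)
    show "subspace K {z \<in> carrier ?D. u (\<zero>, z) = q (\<zero>, ?T z)} ?D"
    proof (rule subspaceI[OF D.vectorspace_axioms])
      show "\<zero>\<^bsub>?D\<^esub> \<in> {z \<in> carrier ?D. u (\<zero>, z) = q (\<zero>, ?T z)}"
        using uD(2) qD(2) by (simp add: alt_dual_action_zero[OF gaut] h_algebra_simps)
      fix y z assume yz: "y \<in> {z \<in> carrier ?D. u (\<zero>, z) = q (\<zero>, ?T z)}"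
        "z \<in> {z \<in> carrier ?D. u (\<zero>, z) = q (\<zero>, ?T z)}"
      then have "u ((\<zero>, y) \<oplus>\<^bsub>?H\<^esub> (\<zero>, z)) = q ((\<zero>, ?T y) \<oplus>\<^bsub>?H\<^esub> (\<zero>, ?T z))"
        using uD(4)[OF Din[of y] Din[of z]] qD(4)[OF Din[of "?T y"] Din[of "?T z"]] Tc by simp
      then show "y \<oplus>\<^bsub>?D\<^esub> z \<in> {z \<in> carrier ?D. u (\<zero>, z) = q (\<zero>, ?T z)}"
        using yz by (simp add: alt_dual_action_add[OF gaut] h_algebra_simps)
    next
      fix c z assume cz: "c \<in> carrier K" "z \<in> {z \<in> carrier ?D. u (\<zero>, z) = q (\<zero>, ?T z)}"
      then have "u (c \<odot>\<^bsub>?H\<^esub> (\<zero>, z)) = q (c \<odot>\<^bsub>?H\<^esub> (\<zero>, ?T z))"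
        using uD(5)[OF _ Din[of z]] qD(5)[OF _ Din[of "?T z"]] Tc by simp
      then show "c \<odot>\<^bsub>?D\<^esub> z \<in> {z \<in> carrier ?D. u (\<zero>, z) = q (\<zero>, ?T z)}"
        using cz by (simp add: alt_dual_action_smult[OF gaut] h_algebra_simps)
    qed auto
    fix x y assume xy: "x \<in> carrier V" "y \<in> carrier V"
    obtain a b where ab: "a \<in> carrier ?H" "u (x, \<zero>\<^bsub>?D\<^esub>) = q a" "b \<in> carrier ?H" "u (y, \<zero>\<^bsub>?D\<^esub>) = q b"
      using lift[OF Vin[OF xy(1)]] lift[OF Vin[OF xy(2)]] by blast
    have fab: "fst a = g x" "fst b = g y"
      using G[OF Vin[OF xy(1)] ab(1,2)] G[OF Vin[OF xy(2)] ab(3,4)] g_eq xy by simp_all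
    have "u ((x, \<zero>\<^bsub>?D\<^esub>) \<otimes>\<^bsub>?H\<^esub> (y, \<zero>\<^bsub>?D\<^esub>)) = q (a \<otimes>\<^bsub>?H\<^esub> b)"
      using uD(6)[OF Vin[OF xy(1)] Vin[OF xy(2)]] qD(6)[OF ab(1,3)] ab(2,4) by simp
    then show "alt_eval K S V x y \<in> {z \<in> carrier ?D. u (\<zero>, z) = q (\<zero>, ?T z)}"
      using fab xy alt_eval_closed[OF xy] by (simp add: h_algebra_simps alt_dual_action_eval[OF gaut])
  qed
  then have uq: "u (\<zero>, z) = q (\<zero>, ?T z)" if "z \<in> carrier ?D" for z using that by blast
  have D_minus_zero: "z \<ominus>\<^bsub>?D\<^esub> \<zero>\<^bsub>?D\<^esub> = z" if "z \<in> carrier ?D" for z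
    using D.add_minus_cancel[OF that D.M.zero_closed] that by simp
  have mem: "z \<in> Z \<longleftrightarrow> ?T z \<in> Z'" if z: "z \<in> carrier ?D" for z
  proof -
    have "z \<in> Z \<longleftrightarrow> u (\<zero>, z) = u (\<zero>, \<zero>\<^bsub>?D\<^esub>)"
      using ku[OF Din[OF z] Din[OF D.M.zero_closed]] by (simp add: D_minus_zero[OF z])
    also have "\<dots> \<longleftrightarrow> q (\<zero>, ?T z) = q (\<zero>, \<zero>\<^bsub>?D\<^esub>)"
      by (simp add: uq[OF z] uq[OF D.M.zero_closed] alt_dual_action_zero[OF gaut])
    also have "\<dots> \<longleftrightarrow> ?T z \<in> Z'"
      using kq[OF Din[OF Tc[OF z]] Din[OF D.M.zero_closed]] by (simp add: D_minus_zero[OF Tc[OF z]])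
    finally show ?thesis .
  qed
  have "Z' = ?T ` Z"
  proof (intro equalityI subsetI)
    fix w assume w: "w \<in> Z'"
    then have "w \<in> ?T ` carrier ?D"
      using subspaceD(1)[OF Z'] alt_dual_action_bij[OF gaut] by (auto simp: bij_betw_def)
    then obtain z where "z \<in> carrier ?D" "w = ?T z" by blast
    then show "w \<in> ?T ` Z" using mem w by blast
  next
    fix w assume "w \<in> ?T ` Z"
    then show "w \<in> Z'" using mem subspaceD(1)[OF Z] by blast
  qed
  then show ?thesis using gaut by blast
qed

text \<open>
  If \<open>Z\<close> and \<open>Z'\<close> are translates of the same \<open>X\<close>, both quotients are targets of surjections from \<open>h(V)\<close>
  with kernel \<open>0 \<times> X\<close>.
\<close>

lemma h_quotient_isomorphic_iff:
  assumes full: "full_module K S V"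
    and Z: "subspace K Z (alt_dual K S V)" and Z': "subspace K Z' (alt_dual K S V)"
  shows "s_algebra_isomorphic K S (h_quotient K S V Z) (h_quotient K S V Z') \<longleftrightarrow>
    (\<exists>orb\<in>orbits (module_aut_group K S V) (grassmannian K (alt_dual K S V)) (grassmannian_action K S V).
      Z \<in> orb \<and> Z' \<in> orb)"
proof
  let ?H = "h_algebra K S V" and ?D = "alt_dual K S V"
  interpret H: lie_s_algebra K S ?H by (rule h_lie_s_algebra[OF full])
  note q = h_quotient_epi[OF full Z] and q' = h_quotient_epi[OF full Z']
  interpret Q: lie_s_algebra K S "h_quotient K S V Z"
    by (rule lie_s_algebra_epi_image[OF H.lie_s_algebra_axioms q(1)])
  interpret Q': lie_s_algebra K S "h_quotient K S V Z'"
    by (rule lie_s_algebra_epi_image[OF H.lie_s_algebra_axioms q'(1)])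
  assume "s_algebra_isomorphic K S (h_quotient K S V Z) (h_quotient K S V Z')"
  then obtain f where f: "f \<in> s_algebra_iso K S (h_quotient K S V Z) (h_quotient K S V Z')"
    unfolding s_algebra_isomorphic_def by blast
  have fh: "f \<in> module_hom K (h_quotient K S V Z) (h_quotient K S V Z')"
    and bij: "bij_betw f (carrier (h_quotient K S V Z)) (carrier (h_quotient K S V Z'))"
    using f by (auto simp: s_algebra_iso_def)
  have f0: "f \<zero>\<^bsub>h_quotient K S V Z\<^esub> = \<zero>\<^bsub>h_quotient K S V Z'\<^esub>"
    by (rule mod_hom.f0_is_0[OF mod_hom.intro[OF Q.module_axioms Q'.module_axioms mod_hom_axioms.intro[OF fh]]])
  have f_epi: "f \<in> s_algebra_epi K S (h_quotient K S V Z) (h_quotient K S V Z')"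
    using f f0 by (auto simp: s_algebra_iso_def s_algebra_epi_def bij_betw_def)
  have "\<exists>g\<in>carrier (module_aut_group K S V). Z' = alt_dual_action K S V g ` Z"
  proof (rule common_quotient_module_aut[OF full Z Z' epi_comp[OF q(1) f_epi] q'(1) _ q'(2)])
    fix a b assume ab: "a \<in> carrier ?H" "b \<in> carrier ?H"
    show "f (({\<zero>} \<times> Z) +>\<^bsub>?H\<^esub> a) = f (({\<zero>} \<times> Z) +>\<^bsub>?H\<^esub> b) \<longleftrightarrow>
        fst a = fst b \<and> snd a \<ominus>\<^bsub>?D\<^esub> snd b \<in> Z"
      using inj_on_eq_iff[OF bij_betw_imp_inj_on[OF bij]] s_algebra_epiD(3)[OF q(1)] q(2)[OF ab] ab by simp
  qed
  then obtain g where g: "g \<in> carrier (module_aut_group K S V)" "Z' = grassmannian_action K S V g Z"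
    unfolding grassmannian_action_def by blast
  have "alt_dual_action K S V (\<lambda>x\<in>carrier V. x) z = z" if "z \<in> Z" for z
    using that subspaceD(1)[OF Z] by (intro alt_dual_action_id) blast
  then have "Z = grassmannian_action K S V (\<lambda>x\<in>carrier V. x) Z"
    unfolding grassmannian_action_def by simp
  then have "Z \<in> orbit (module_aut_group K S V) (grassmannian_action K S V) Z"
    unfolding orbit_def using module_aut_id by blast
  moreover have "Z' \<in> orbit (module_aut_group K S V) (grassmannian_action K S V) Z"
    unfolding orbit_def using g by blast
  ultimately show "\<exists>orb\<in>orbits (module_aut_group K S V) (grassmannian K ?D) (grassmannian_action K S V).
      Z \<in> orb \<and> Z' \<in> orb"
    unfolding orbits_def grassmannian_def using Z by blast
next
  let ?H = "h_algebra K S V" and ?D = "alt_dual K S V"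
  assume "\<exists>orb\<in>orbits (module_aut_group K S V) (grassmannian K ?D) (grassmannian_action K S V).
      Z \<in> orb \<and> Z' \<in> orb"
  then obtain X g g' where X: "subspace K X ?D"
    and g: "g \<in> carrier (module_aut_group K S V)" "Z = alt_dual_action K S V g ` X"
    and g': "g' \<in> carrier (module_aut_group K S V)" "Z' = alt_dual_action K S V g' ` X"
    unfolding orbits_def orbit_def grassmannian_def grassmannian_action_def by blast
  obtain p where p: "p \<in> s_algebra_epi K S ?H (h_quotient K S V Z)"
    "\<forall>a\<in>carrier ?H. \<forall>b\<in>carrier ?H. p a = p b \<longleftrightarrow> fst a = fst b \<and> snd a \<ominus>\<^bsub>?D\<^esub> snd b \<in> X"
    using module_aut_quotient_epi[OF full X Z g] by (elim bexE)
  obtain p' where p': "p' \<in> s_algebra_epi K S ?H (h_quotient K S V Z')"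
    "\<forall>a\<in>carrier ?H. \<forall>b\<in>carrier ?H. p' a = p' b \<longleftrightarrow> fst a = fst b \<and> snd a \<ominus>\<^bsub>?D\<^esub> snd b \<in> X"
    using module_aut_quotient_epi[OF full X Z' g'] by (elim bexE)
  show "s_algebra_isomorphic K S (h_quotient K S V Z) (h_quotient K S V Z')"
    by (rule isomorphic_if_same_kernel[OF h_lie_s_algebra[OF full] p(1) p'(1)]) (simp only: p(2) p'(2))
qed

end

section \<open>Classification of almost minimal algebras\<close>

theorem theorem1p5:
  fixes K :: "'k ring"
    and S :: "('k, 's) module"
    and N :: "('k, 's, 'n) smodule"
  assumes "field K" and "char_zero K" and "lie_algebra K S"
  shows
    "(almost_minimal_s_algebra K S N \<longrightarrow>
        (\<exists>(V :: ('k, 's, 'n) smodule) Z.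
           full_module K S V \<and> subspace K Z (alt_dual K S V) \<and>
           s_algebra_isomorphic K S N (h_quotient K S V Z) \<and>
           (minimal_s_algebra K S N \<longleftrightarrow> irreducible_module K S V)))
     \<and> (\<forall>(V :: ('k, 's, 'v) smodule) Z.
          almost_minimal_s_algebra K S N \<and> full_module K S V \<and> subspace K Z (alt_dual K S V) \<and>
          s_algebra_isomorphic K S N (h_quotient K S V Z) \<longrightarrow>
          (minimal_s_algebra K S N \<longleftrightarrow> irreducible_module K S V))
     \<and> (\<forall>(V :: ('k, 's, 'v) smodule) Z Z'.
          full_module K S V \<and> subspace K Z (alt_dual K S V) \<and> subspace K Z' (alt_dual K S V) \<longrightarrow>
          almost_minimal_s_algebra K S (h_quotient K S V Z) \<and>
          almost_minimal_s_algebra K S (h_quotient K S V Z') \<and>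
          (s_algebra_isomorphic K S (h_quotient K S V Z) (h_quotient K S V Z') \<longleftrightarrow>
           (\<exists>orb\<in>orbits (module_aut_group K S V) (grassmannian K (alt_dual K S V))
                       (grassmannian_action K S V).
              Z \<in> orb \<and> Z' \<in> orb)))"
proof (intro conjI impI allI, goal_cases)
  case 1
  then have am: "almost_minimal_s_algebra K S N" .
  then have N: "lie_s_algebra K S N" by (simp add: almost_minimal_s_algebra_def)
  obtain V :: "('k, 's, 'n) smodule" and Z where VZ: "full_module K S V" "subspace K Z (alt_dual K S V)"
    "s_algebra_isomorphic K S N (h_quotient K S V Z)"
    using lie_s_algebra.almost_minimal_is_h_quotient[OF N am] by blast
  then have "s_module K S V" by (simp add: full_module_def)
  from s_module.isomorphic_h_quotient_minimal_iff[OF this VZ(1,2) N VZ(3)] VZ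
  show ?case by blast
next
  case (2 V Z)
  then have "s_module K S V" "lie_s_algebra K S N"
    by (simp_all add: full_module_def almost_minimal_s_algebra_def)
  with 2 show ?case using s_module.isomorphic_h_quotient_minimal_iff by blast
next
  case (3 V Z Z')
  then have V: "full_module K S V" and "s_module K S V" by (simp_all add: full_module_def)
  then interpret s_module K S V by simp
  show ?case using 3 by (intro almost_minimal_epi_image[OF h_almost_minimal[OF V] h_quotient_epi(1)[OF V]]) simp
next
  case (4 V Z Z')
  then have V: "full_module K S V" and "s_module K S V" by (simp_all add: full_module_def)
  then interpret s_module K S V by simp
  show ?case using 4 by (intro almost_minimal_epi_image[OF h_almost_minimal[OF V] h_quotient_epi(1)[OF V]]) simp
next
  case (5 V Z Z')
  then have V: "full_module K S V" and "s_module K S V" by (simp_all add: full_module_def)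
  then interpret s_module K S V by simp
  show ?case using 5 by (intro h_quotient_isomorphic_iff[OF V]) simp_all
qed

end
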